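(* Fix an integer $p\geq 3$ and $\beta>\beta^*(p)$. Let $\bm X=(X_1,\ldots,X_N)$ be a sample from $\mathbb{P}_{\beta,0,p}$ and let $\hat\beta$ be the maximum pseudolikelihood estimate of $\beta$. Let $m_*$ be the unique positive global maximizer of $H_{\beta,0,p}$. Then $$\sup_{x\in\mathbb{R}}\left|\mathbb{P}\left(\sqrt N(\hat\beta-\beta)\leq x\right)-\mathbb{P}\left(Z\leq x\right)\right| = O\left(\frac{\log N}{\sqrt N}\right),$$ where $Z\sim N\left(0,-\frac{H_{\beta,0,p}''(m_* )}{p^2 m_*^{2p-2}}\right)$.
   Context: For $p\geq 2$ and $\beta>0$, $\mathbb{P}_{\beta,0,p}$ is the probability measure on $\{-1,1\}^N$ given by $$\mathbb{P}_{\beta,0,p}(\bm X) = \frac{\exp\left\{\beta N^{1-p}\sum_{1\leq i_1,\ldots,i_p\leq N} X_{i_1}\cdots X_{i_p}\right\}}{2^N Z_N(\beta,0,p)},$$ with $Z_N$ the normalizing constant. Let $I(x)=\frac12\{(1+x)\log(1+x)+(1-x)\log(1-x)\}$ and $H_{\beta,0,p}(x)=\beta x^p-I(x)$ for $x\in[-1,1]$. Define $\beta^*(p):=\inf\{\beta\geq 0:\ \sup_{x\in[0,1]}H_{\beta,0,p}(x)>0\}$. The pseudolikelihood is $L(\beta\mid\bm X)=\prod_{i=1}^N \mathbb{P}_{\beta,0,p}\left(X_i\mid (X_j)_{j\neq i}\right)$, and the maximum pseudolikelihood estimate is $\hat\beta:=\arg\max_{\beta\in\mathbb{R}}L(\beta\mid\bm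 X)$. *)

theory Defs
  imports "HOL-Probability.Probability" "HOL-Library.Landau_Symbols"
begin

definition config_space :: "nat \<Rightarrow> (nat \<Rightarrow> real) set" where
  "config_space N = PiE {..<N} (\<lambda>_. {-1, 1})"

definition hamil :: "real \<Rightarrow> nat \<Rightarrow> nat \<Rightarrow> (nat \<Rightarrow> real) \<Rightarrow> real" where
  "hamil \<beta> p N X = \<beta> * real N powr (1 - real p) *
     (\<Sum>\<iota>\<in>PiE {..<p} (\<lambda>_. {..<N}). \<Prod>k<p. X (\<iota> k))"

definition partition_fn :: "real \<Rightarrow> nat \<Rightarrow> nat \<Rightarrow> real" where
  "partition_fn \<beta> p N = (\<Sum>X\<in>config_space N. exp (hamil \<beta> p N X)) / 2 ^ N"

definition cw_prob :: "real \<Rightarrow> nat \<Rightarrow> nat \<Rightarrow> (nat \<Rightarrow> real) \<Rightarrow> real" where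
  "cw_prob \<beta> p N X = exp (hamil \<beta> p N X) / (2 ^ N * partition_fn \<beta> p N)"

definition cond_prob :: "real \<Rightarrow> nat \<Rightarrow> nat \<Rightarrow> (nat \<Rightarrow> real) \<Rightarrow> nat \<Rightarrow> real" where
  "cond_prob \<beta> p N X i =
     cw_prob \<beta> p N X / (cw_prob \<beta> p N X + cw_prob \<beta> p N (X(i := - X i)))"

definition pseudolik :: "real \<Rightarrow> nat \<Rightarrow> nat \<Rightarrow> (nat \<Rightarrow> real) \<Rightarrow> real" where
  "pseudolik \<beta> p N X = (\<Prod>i<N. cond_prob \<beta> p N X i)"

definition is_MPLE :: "nat \<Rightarrow> nat \<Rightarrow> (nat \<Rightarrow> real) \<Rightarrow> real \<Rightarrow> bool" where
  "is_MPLE p N X b \<longleftrightarrow> (\<forall>\<beta>'. pseudolik \<beta>' p N X \<le> pseudolik b p N X)"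

definition Ient :: "real \<Rightarrow> real" where
  "Ient x = ((1 + x) * ln (1 + x) + (1 - x) * ln (1 - x)) / 2"

definition Hfun :: "real \<Rightarrow> nat \<Rightarrow> real \<Rightarrow> real" where
  "Hfun \<beta> p x = \<beta> * x ^ p - Ient x"

definition beta_star :: "nat \<Rightarrow> real" where
  "beta_star p = Inf {\<beta>. \<beta> \<ge> 0 \<and> (SUP x\<in>{0..1}. Hfun \<beta> p x) > 0}"

end

(*  The Hamiltonian depends on X only through the magnetization x = (X_1 + ... + X_N) / N, so the
    law of x has weights binom(N,k) exp(beta N x_k^p) at x_k = 2k/N - 1, and the pseudolikelihood is
    explicit in x as well: its logarithm is strictly concave in beta, and its score vanishes up to
    O(1/N) at g(x) = artanh x / (p x^(p-1)).  Since H'(x) = p x^(p-1) (beta - g(x)), we have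
    g(m) = beta, and g'(m) = -H''(m) / (p m^(p-1)); hence sqrt N (betahat - beta) is
    Y = g'(m) sqrt N (x - m) up to O((1 + Y^2) / sqrt N).
    For the law of Y, ln (binom(N,k)) + N I(x_k) changes by only O(1/N) when k increases by 1, so near
    m the weights are those of a Gaussian up to a relative error O((1 + |Y|^3) / sqrt N), without
    appeal to Stirling's formula; entropy bounds make the remaining configurations exponentially
    unlikely.  Truncating at |Y| = O(sqrt (log N)) produces the logarithm in the rate.  For even p the
    maximizers m and -m are exchanged by the symmetry X -> -X, which preserves betahat. *)
theory Submission
  imports Defs "HOL-Real_Asymp.Real_Asymp"
begin

section \<open>Real analysis and the normal distribution function\<close>

text \<open>The bound must be uniform in the threshold although many lattice points contribute an
  error. Each weight is therefore compared with the increment of the normal distribution function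
  over one lattice cell, and the error of the cell is charged to N^(-1/2) times the increment of
  arctan over it: these increments telescope to at most pi, whatever the threshold. No asymptotics
  of the partition function are needed. The weights are scaled by \<open>Wn\<close>, read off from
  the single weight at \<open>k0\<close>; the total mass after scaling comes out near 1, or near 2
  for even p, from the same estimate with the threshold at the edge of the window. Nondegeneracy of
  m is forced by H(m) > 0: at a positive critical point with r \<le> 0, H would have decreased all
  the way from H(0) = 0. An estimate need not exist for every configuration. Its existence is proved
  together with its location when the folded magnetization is near m; all other configurations are
  absorbed by their small probability.\<close>

lemma abs_telescope_le:
  fixes f :: "nat \<Rightarrow> real"
  assumes "a \<le> b" "\<And>i. a \<le> i \<Longrightarrow> i < b \<Longrightarrow> \<bar>f (Suc i) - f i\<bar> \<le> c"
  shows "\<bar>f b - f a\<bar> \<le> c * (real b - real a)"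
  using assms
proof (induction b rule: dec_induct)
  case base
  then show ?case by simp
next
  case (step n)
  have "\<bar>f n - f a\<bar> \<le> c * (real n - real a)"
    using step by auto
  moreover have "\<bar>f (Suc n) - f n\<bar> \<le> c"
    using step by auto
  ultimately show ?case
    by (simp add: algebra_simps)
qed

text \<open>The Lagrange remainder with its factor 1/2 dropped, as is 1/6 in the cubic version: only
  the order in \<open>x - c\<close> matters.\<close>

lemma taylor2_bound:
  fixes f :: "real \<Rightarrow> real"
  assumes f: "\<And>x. x \<in> {a..b} \<Longrightarrow> (f has_real_derivative f1 x) (at x)"
    and f1: "\<And>x. x \<in> {a..b} \<Longrightarrow> (f1 has_real_derivative f2 x) (at x)"
    and M: "\<And>x. x \<in> {a..b} \<Longrightarrow> \<bar>f2 x\<bar> \<le> M"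
    and c: "c \<in> {a..b}" and x: "x \<in> {a..b}"
  shows "\<bar>f x - f c - f1 c * (x - c)\<bar> \<le> M * (x - c)\<^sup>2"
proof (cases "x = c")
  case False
  define D where "D n = (if n = 0 then f else if n = 1 then f1 else f2)" for n :: nat
  have "\<exists>t. (if x < c then x < t \<and> t < c else c < t \<and> t < x) \<and>
      f x = (\<Sum>m<2. (D m c / fact m) * (x - c)^m) + (D 2 t / fact 2) * (x - c)^2"
    using c x False f f1
    by (intro Taylor[of 2 D f a b c x]) (auto simp: D_def less_2_cases_iff)
  then obtain t where t: "if x < c then x < t \<and> t < c else c < t \<and> t < x"
    and e: "f x = (\<Sum>m<2. (D m c / fact m) * (x - c)^m) + (D 2 t / fact 2) * (x - c)^2"
    by blast
  have tab: "t \<in> {a..b}"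
    using t c x by (auto split: if_splits)
  have "f x - f c - f1 c * (x - c) = f2 t / 2 * (x - c)\<^sup>2"
    using e by (simp add: D_def numeral_2_eq_2)
  then have "\<bar>f x - f c - f1 c * (x - c)\<bar> = \<bar>f2 t\<bar> / 2 * (x - c)\<^sup>2"
    by (simp only: abs_mult abs_divide abs_power2 abs_numeral)
  also have "\<dots> \<le> M * (x - c)\<^sup>2"
    using M[OF tab] by (intro mult_right_mono) auto
  finally show ?thesis .
qed simp

lemma taylor3_bound:
  fixes f :: "real \<Rightarrow> real"
  assumes f: "\<And>x. x \<in> {a..b} \<Longrightarrow> (f has_real_derivative f1 x) (at x)"
    and f1: "\<And>x. x \<in> {a..b} \<Longrightarrow> (f1 has_real_derivative f2 x) (at x)"
    and f2: "\<And>x. x \<in> {a..b} \<Longrightarrow> (f2 has_real_derivative f3 x) (at x)"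
    and M: "\<And>x. x \<in> {a..b} \<Longrightarrow> \<bar>f3 x\<bar> \<le> M"
    and c: "c \<in> {a..b}" and x: "x \<in> {a..b}"
  shows "\<bar>f x - f c - f1 c * (x - c) - f2 c / 2 * (x - c)\<^sup>2\<bar> \<le> M * \<bar>x - c\<bar> ^ 3"
proof (cases "x = c")
  case False
  define D where "D n = (if n = 0 then f else if n = 1 then f1 else if n = 2 then f2 else f3)"
    for n :: nat
  have "\<exists>t. (if x < c then x < t \<and> t < c else c < t \<and> t < x) \<and>
      f x = (\<Sum>m<3. (D m c / fact m) * (x - c)^m) + (D 3 t / fact 3) * (x - c)^3"
    using c x False f f1 f2
    by (intro Taylor[of 3 D f a b c x]) (auto simp: D_def numeral_3_eq_3 less_Suc_eq)
  then obtain t where t: "if x < c then x < t \<and> t < c else c < t \<and> t < x"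
    and e: "f x = (\<Sum>m<3. (D m c / fact m) * (x - c)^m) + (D 3 t / fact 3) * (x - c)^3"
    by blast
  have tab: "t \<in> {a..b}"
    using t c x by (auto split: if_splits)
  have "(\<Sum>m<3. (D m c / fact m) * (x - c)^m) = f c + f1 c * (x - c) + f2 c / 2 * (x - c)\<^sup>2"
    by (simp add: D_def eval_nat_numeral)
  then have "f x - f c - f1 c * (x - c) - f2 c / 2 * (x - c)\<^sup>2 = f3 t / 6 * (x - c) ^ 3"
    using e by (simp add: D_def fact_numeral)
  then have "\<bar>f x - f c - f1 c * (x - c) - f2 c / 2 * (x - c)\<^sup>2\<bar> = \<bar>f3 t\<bar> / 6 * \<bar>x - c\<bar> ^ 3"
    by (simp only: abs_mult abs_divide power_abs abs_numeral)
  also have "\<dots> \<le> M * \<bar>x - c\<bar> ^ 3"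
    using M[OF tab] by (intro mult_right_mono) auto
  finally show ?thesis .
qed simp

lemma compact_bound:
  fixes f :: "real \<Rightarrow> real"
  assumes "continuous_on {a..b} f"
  shows "\<exists>M>0. \<forall>x\<in>{a..b}. \<bar>f x\<bar> \<le> M"
proof -
  have "bounded (f ` {a..b})"
    using assms compact_continuous_image compact_imp_bounded by blast
  then obtain M where "\<forall>x\<in>f ` {a..b}. norm x \<le> M"
    unfolding bounded_iff by blast
  then show ?thesis
    by (intro exI[of _ "max M 1"]) (auto simp: le_max_iff_disj)
qed

text \<open>Free of orientation and valid for x = y, since the sign of the increment is often
  unknown below.\<close>

lemma MVT_abs:
  fixes f :: "real \<Rightarrow> real"
  assumes "\<And>t. t \<in> {min x y..max x y} \<Longrightarrow> (f has_real_derivative f' t) (at t)"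
  shows "\<exists>t\<in>{min x y..max x y}. f y - f x = f' t * (y - x)"
proof -
  consider "x = y" | "x < y" | "y < x" by linarith
  then show ?thesis
  proof cases
    case 2
    then obtain z where "x < z" "z < y" "f y - f x = (y - x) * f' z"
      using MVT2[of x y f f'] assms by auto
    then show ?thesis using 2 by (intro bexI[of _ z]) auto
  next
    case 3
    then obtain z where "y < z" "z < x" "f x - f y = (x - y) * f' z"
      using MVT2[of y x f f'] assms by auto
    then show ?thesis using 3 by (intro bexI[of _ z]) (auto simp: algebra_simps)
  qed auto
qed

text \<open>The cube is what the cell estimate consumes: two factors come from the relative error of
  the weights, and the third leaves the integrable bound 1 / (1 + z^2), the derivative of
  arctan.\<close>

lemma poly_le_exp_square:
  fixes c :: real
  assumes "0 < c"
  shows "\<exists>C>0. \<forall>z. (1 + z\<^sup>2) ^ 3 \<le> C * exp (c * z\<^sup>2)"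
proof (intro exI conjI allI)
  \<comment> \<open>The constant comes from 1 + y \<le> exp y with y = c z^2 / 3, cubed; the maximum
    with 1 covers the constant term.\<close>
  show "0 < (max 1 (3 / c)) ^ 3" by simp
  fix z :: real
  have "1 + z\<^sup>2 \<le> max 1 (3 / c) * (1 + c / 3 * z\<^sup>2)"
  proof -
    have "z\<^sup>2 = (3 / c) * (c / 3 * z\<^sup>2)"
      using assms by simp
    also have "\<dots> \<le> max 1 (3 / c) * (c / 3 * z\<^sup>2)"
      using assms by (intro mult_right_mono) auto
    finally show ?thesis
        by (simp only: distrib_left mult_1_right)
  qed
  also have "\<dots> \<le> max 1 (3 / c) * exp (c / 3 * z\<^sup>2)"
    by (intro mult_left_mono exp_ge_add_one_self) auto
  finally have "(1 + z\<^sup>2) ^ 3 \<le> (max 1 (3 / c) * exp (c / 3 * z\<^sup>2)) ^ 3"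
    by (intro power_mono) auto
  also have "\<dots> = (max 1 (3 / c)) ^ 3 * exp (c * z\<^sup>2)"
    by (simp add: power_mult_distrib flip: exp_of_nat_mult)
  finally show "(1 + z\<^sup>2) ^ 3 \<le> (max 1 (3 / c)) ^ 3 * exp (c * z\<^sup>2)" .
qed

lemma abs_exp_diff_one_le: "\<bar>exp e - 1\<bar> \<le> \<bar>e\<bar> * exp \<bar>e\<bar>" for e :: real
proof (cases "0 \<le> e")
  case True
  have "1 - e \<le> exp (- e)"
    using exp_ge_add_one_self[of "- e"] by simp
  then have "exp e * (1 - e) \<le> exp e * exp (- e)"
    by (intro mult_left_mono) auto
  then show ?thesis
    using True by (simp add: algebra_simps flip: exp_add)
next
  case False
  have "1 - exp e \<le> - e"
    using exp_ge_add_one_self[of e] by linarith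
  also have "\<dots> \<le> - e * exp (- e)"
    using False by (simp add: mult_le_cancel_left1)
  finally show ?thesis
    using False by (simp add: abs_if)
qed

section \<open>The centred normal law: derivative, tails and Lipschitz bound of its distribution
  function\<close>

abbreviation ncdf :: "real \<Rightarrow> real \<Rightarrow> real" where
  "ncdf \<sigma> t \<equiv> measure (density lborel (normal_density 0 \<sigma>)) {..t}"

context
  fixes \<sigma> :: real
  assumes sigma: "0 < \<sigma>"
begin

interpretation nd: prob_space "density lborel (normal_density 0 \<sigma>)"
  by (rule prob_space_normal_density) (rule sigma)

lemma ncdf_bounds: "0 \<le> ncdf \<sigma> t" "ncdf \<sigma> t \<le> 1"
  by auto

lemma ncdf_mono: "s \<le> t \<Longrightarrow> ncdf \<sigma> s \<le> ncdf \<sigma> t"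
  by (intro nd.finite_measure_mono) auto

lemma measure_normal_eq:
  assumes "A \<in> sets borel"
  shows "measure (density lborel (normal_density 0 \<sigma>)) A = (LINT x:A|lborel. normal_density 0 \<sigma> x)"
proof -
  have "measure (density lborel (normal_density 0 \<sigma>)) A
      = (\<integral>x. indicator A x \<partial>density lborel (normal_density 0 \<sigma>))"
    using assms by simp
  also have "\<dots> = (\<integral>x. normal_density 0 \<sigma> x *\<^sub>R indicator A x \<partial>lborel)"
    using assms by (intro integral_density) auto
  finally show ?thesis
    by (simp add: set_lebesgue_integral_def mult.commute)
qed

lemma ncdf_diff:
  assumes "a \<le> t"
  shows "ncdf \<sigma> t = ncdf \<sigma> a + integral {a..t} (normal_density 0 \<sigma>)"
proof -
  have int: "set_integrable lborel A (normal_density 0 \<sigma>)" if "A \<in> sets borel" for A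
    unfolding set_integrable_def using sigma that
    by (intro integrable_mult_indicator) auto
  have "ncdf \<sigma> t = measure (density lborel (normal_density 0 \<sigma>)) ({..a} \<union> {a<..t})"
    using assms by (intro arg_cong[where f="measure _"]) auto
  also have "\<dots> = ncdf \<sigma> a + measure (density lborel (normal_density 0 \<sigma>)) {a<..t}"
    by (intro nd.finite_measure_Union) auto
  also have "measure (density lborel (normal_density 0 \<sigma>)) {a<..t}
      = integral {a<..t} (normal_density 0 \<sigma>)"
    using set_borel_integral_eq_integral(2)[OF int[of "{a<..t}"]] by (simp add: measure_normal_eq)
  also have "\<dots> = integral {a..t} (normal_density 0 \<sigma>)"
    by (rule integral_subset_negligible) (auto intro: negligible_subset[of "{a}"])
  finally show ?thesis .
qed

lemma ncdf_has_derivative: "(ncdf \<sigma> has_real_derivative normal_density 0 \<sigma> t) (at t)"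
proof -
  have c: "continuous_on A (normal_density 0 \<sigma>)" for A
    unfolding normal_density_def using sigma by (intro continuous_intros) auto
  have "((\<lambda>x. integral {t - 1..x} (normal_density 0 \<sigma>)) has_real_derivative normal_density 0 \<sigma> t)
      (at t within {t - 1..t + 1})"
    by (rule integral_has_real_derivative[OF c]) auto
  then have "((\<lambda>x. integral {t - 1..x} (normal_density 0 \<sigma>)) has_real_derivative normal_density 0 \<sigma> t)
      (at t)"
    by (simp add: at_within_Icc_at)
  then have "((\<lambda>x. ncdf \<sigma> (t - 1) + integral {t - 1..x} (normal_density 0 \<sigma>))
      has_real_derivative normal_density 0 \<sigma> t) (at t)"
    by (auto intro!: derivative_eq_intros)
  then show ?thesis
  proof (rule DERIV_cong_ev[OF refl _ refl, THEN iffD1, rotated])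
    have "\<forall>\<^sub>F x in nhds t. x \<in> {t - 1<..}"
      by (rule eventually_nhds_in_open) auto
    then show "\<forall>\<^sub>F x in nhds t. ncdf \<sigma> (t - 1) + integral {t - 1..x} (normal_density 0 \<sigma>) = ncdf \<sigma> x"
      by eventually_elim (rule ncdf_diff[symmetric], simp)
  qed
qed

text \<open>Recentring the density at the end point u of the half-line yields the Gaussian factor:
  there x u \<ge> u^2, hence x^2 \<ge> u^2 + (x - u)^2, and the recentred density has total mass
  1.\<close>

lemma normal_tail:
  assumes "0 \<le> L"
  shows "ncdf \<sigma> (- L) \<le> exp (- L\<^sup>2 / (2 * \<sigma>\<^sup>2))"
    and "1 - ncdf \<sigma> L \<le> exp (- L\<^sup>2 / (2 * \<sigma>\<^sup>2))"
proof -
  have shift: "measure (density lborel (normal_density 0 \<sigma>)) A \<le> exp (- L\<^sup>2 / (2 * \<sigma>\<^sup>2))"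
    if A: "A \<in> sets borel" and *: "\<And>x. x \<in> A \<Longrightarrow> x * u \<ge> u\<^sup>2" and u: "u\<^sup>2 = L\<^sup>2" for A u
  proof -
    have le: "normal_density 0 \<sigma> x \<le> exp (- L\<^sup>2 / (2 * \<sigma>\<^sup>2)) * normal_density u \<sigma> x"
      if "x \<in> A" for x
    proof -
      have "L\<^sup>2 + (x - u)\<^sup>2 \<le> x\<^sup>2"
        using *[OF that] u by (simp add: power2_eq_square algebra_simps)
      then have "- x\<^sup>2 / (2 * \<sigma>\<^sup>2) \<le> - L\<^sup>2 / (2 * \<sigma>\<^sup>2) + - (x - u)\<^sup>2 / (2 * \<sigma>\<^sup>2)"
        using sigma by (simp add: field_simps)
      then have "exp (- x\<^sup>2 / (2 * \<sigma>\<^sup>2)) \<le> exp (- L\<^sup>2 / (2 * \<sigma>\<^sup>2)) * exp (- (x - u)\<^sup>2 / (2 * \<sigma>\<^sup>2))"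
        by (simp flip: exp_add)
      then have "1 / sqrt (2 * pi * \<sigma>\<^sup>2) * exp (- x\<^sup>2 / (2 * \<sigma>\<^sup>2))
          \<le> 1 / sqrt (2 * pi * \<sigma>\<^sup>2) * (exp (- L\<^sup>2 / (2 * \<sigma>\<^sup>2)) * exp (- (x - u)\<^sup>2 / (2 * \<sigma>\<^sup>2)))"
        by (intro mult_left_mono) auto
      then show ?thesis
        by (simp add: normal_density_def mult_ac)
    qed
    have "(LINT x:A|lborel. normal_density 0 \<sigma> x)
        \<le> (LINT x|lborel. exp (- L\<^sup>2 / (2 * \<sigma>\<^sup>2)) * normal_density u \<sigma> x)"
      unfolding set_lebesgue_integral_def using A sigma le
      by (intro integral_mono integrable_mult_indicator) (auto simp: indicator_def)
    then show ?thesis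
      using A sigma by (simp add: measure_normal_eq)
  qed
  show "ncdf \<sigma> (- L) \<le> exp (- L\<^sup>2 / (2 * \<sigma>\<^sup>2))"
  proof (rule shift[of _ "- L"])
    show "(- L)\<^sup>2 \<le> x * - L" if "x \<in> {..- L}" for x
      using mult_right_mono[of L "- x" L] that assms by (simp add: power2_eq_square)
  qed auto
  have "1 - ncdf \<sigma> L = measure (density lborel (normal_density 0 \<sigma>)) {L<..}"
    using nd.prob_compl[of "{..L}"] by (simp add: Compl_eq_Diff_UNIV[symmetric])
  also have "\<dots> \<le> exp (- L\<^sup>2 / (2 * \<sigma>\<^sup>2))"
  proof (rule shift[of _ L])
    show "L\<^sup>2 \<le> x * L" if "x \<in> {L<..}" for x
      using mult_right_mono[of L x L] that assms by (simp add: power2_eq_square)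
  qed auto
  finally show "1 - ncdf \<sigma> L \<le> exp (- L\<^sup>2 / (2 * \<sigma>\<^sup>2))" .
qed

lemma ncdf_lipschitz: "\<bar>ncdf \<sigma> t - ncdf \<sigma> s\<bar> \<le> \<bar>t - s\<bar> / \<sigma>"
proof -
  obtain u where u: "ncdf \<sigma> t - ncdf \<sigma> s = normal_density 0 \<sigma> u * (t - s)"
    using MVT_abs[of s t "ncdf \<sigma>" "normal_density 0 \<sigma>"] ncdf_has_derivative by blast
  have "1 \<le> sqrt (2 * pi)"
    using pi_gt3 by (intro real_le_rsqrt) simp
  then have "exp (- u\<^sup>2 / (2 * \<sigma>\<^sup>2)) \<le> sqrt (2 * pi)"
    by (rule order_trans[rotated]) simp
  then have "normal_density 0 \<sigma> u \<le> 1 / \<sigma>"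
    using sigma by (simp add: normal_density_def real_sqrt_mult field_simps)
  then have "\<bar>ncdf \<sigma> t - ncdf \<sigma> s\<bar> \<le> 1 / \<sigma> * \<bar>t - s\<bar>"
    unfolding u abs_mult by (intro mult_right_mono) auto
  then show ?thesis by simp
qed

lemma normal_density_has_derivative:
  "(normal_density 0 \<sigma> has_real_derivative - t / \<sigma>\<^sup>2 * normal_density 0 \<sigma> t) (at t)"
proof -
  have "((\<lambda>t. - (t - 0)\<^sup>2 / (2 * \<sigma>\<^sup>2)) has_real_derivative - t / \<sigma>\<^sup>2) (at t)"
    using sigma by (auto intro!: derivative_eq_intros simp: power2_eq_square)
  then have "((\<lambda>t. 1 / sqrt (2 * pi * \<sigma>\<^sup>2) * exp (- (t - 0)\<^sup>2 / (2 * \<sigma>\<^sup>2))) has_real_derivative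
      1 / sqrt (2 * pi * \<sigma>\<^sup>2) * (exp (- (t - 0)\<^sup>2 / (2 * \<sigma>\<^sup>2)) * (- t / \<sigma>\<^sup>2))) (at t)"
    by (intro DERIV_cmult DERIV_fun_exp)
  moreover have "normal_density 0 \<sigma> = (\<lambda>t. 1 / sqrt (2 * pi * \<sigma>\<^sup>2) * exp (- (t - 0)\<^sup>2 / (2 * \<sigma>\<^sup>2)))"
    by (rule ext) (simp only: normal_density_def)
  ultimately show ?thesis
    by (simp only: mult_ac)
qed

end

section \<open>The free energy and its maximizer\<close>

text \<open>The sign of \<open>rfun\<close> is the sign of the derivative of \<open>gfun\<close>, whose level set at \<open>\<beta>\<close> consists
of the positive critical points of \<open>Hfun \<beta> p\<close>.\<close>

definition rfun :: "nat \<Rightarrow> real \<Rightarrow> real" where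
  "rfun p x = x / (1 - x\<^sup>2) - (real p - 1) * artanh x"

definition gfun :: "nat \<Rightarrow> real \<Rightarrow> real" where
  "gfun p x = artanh x / (real p * x ^ (p - 1))"

text \<open>Folds the two maximizers \<open>m\<close> and \<open>-m\<close>, which coexist exactly for even \<open>p\<close>, into one.\<close>

definition theta :: "nat \<Rightarrow> real \<Rightarrow> real" where
  "theta p x = (if even p then \<bar>x\<bar> else x)"

lemma artanh_eq: "\<bar>x\<bar> < 1 \<Longrightarrow> artanh x = (ln (1 + x) - ln (1 - x)) / 2" for x :: real
  by (simp add: artanh_def ln_div abs_less_iff)

lemma artanh_strict_mono: "- 1 < x \<Longrightarrow> x < y \<Longrightarrow> y < 1 \<Longrightarrow> artanh x < artanh y" for x :: real
proof -
  assume *: "- 1 < x" "x < y" "y < 1"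
  have "ln (1 + x) < ln (1 + y)" "ln (1 - y) < ln (1 - x)"
    using * by auto
  moreover have "artanh x = (ln (1 + x) - ln (1 - x)) / 2" "artanh y = (ln (1 + y) - ln (1 - y)) / 2"
    using * by (auto simp del: divide_const_simps intro!: artanh_eq)
  ultimately show ?thesis
    by (metis diff_strict_mono divide_strict_right_mono zero_less_numeral)
qed

lemma Ient_has_derivative: "\<bar>x\<bar> < 1 \<Longrightarrow> (Ient has_real_derivative artanh x) (at x)"
  unfolding Ient_def by (auto intro!: derivative_eq_intros simp: artanh_eq)

lemma Ient_minus: "Ient (- x) = Ient x"
  by (simp add: Ient_def)

text \<open>At 0 the product is 0 whatever \<open>ln 0\<close> is, and this is its limit from the
  right. Hence the entropy is continuous up to the ends of [-1, 1], where its slope is infinite, and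
  compactness arguments apply to the closed interval.\<close>

lemma continuous_on_x_ln_x: "continuous_on {0..} (\<lambda>x::real. x * ln x)"
  unfolding continuous_on_eq_continuous_within
proof (intro ballI)
  fix x :: real assume "x \<in> {0..}"
  then consider "x = 0" | "0 < x" by fastforce
  then show "continuous (at x within {0..}) (\<lambda>x::real. x * ln x)"
  proof cases
    case 1
    have "((\<lambda>x::real. x * ln x) \<longlongrightarrow> 0) (at_right 0)"
      by real_asymp
    moreover have "(at (0::real) within {0..}) = at_right 0"
      by (rule at_within_Ici_at_right)
    ultimately show ?thesis
      unfolding continuous_within 1 by simp
  next
    case 2
    then have "isCont (\<lambda>x::real. x * ln x) x"
      by (intro isCont_mult continuous_ident isCont_ln) auto
    then show ?thesis
      by (rule continuous_at_imp_continuous_at_within)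
  qed
qed

lemma continuous_on_Ient: "continuous_on {-1..1} Ient"
proof -
  have "continuous_on {-1..1} (\<lambda>x::real. (1 + x) * ln (1 + x))"
    by (rule continuous_on_compose2[OF continuous_on_x_ln_x]) (auto intro!: continuous_intros)
  moreover have "continuous_on {-1..1} (\<lambda>x::real. (1 - x) * ln (1 - x))"
    by (rule continuous_on_compose2[OF continuous_on_x_ln_x]) (auto intro!: continuous_intros)
  ultimately show ?thesis
    unfolding Ient_def by (intro continuous_on_divide continuous_on_add continuous_on_const) auto
qed

lemma continuous_on_Hfun: "continuous_on {-1..1} (Hfun \<beta> p)"
  unfolding Hfun_def by (intro continuous_intros continuous_on_Ient)

lemma Hfun_has_derivative:
  "\<bar>x\<bar> < 1 \<Longrightarrow> (Hfun \<beta> p has_real_derivative \<beta> * real p * x ^ (p - 1) - artanh x) (at x)"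
  unfolding Hfun_def
  by (auto intro!: derivative_eq_intros Ient_has_derivative simp: mult_ac)

lemma Hfun_0: "p \<noteq> 0 \<Longrightarrow> Hfun \<beta> p 0 = 0"
  by (simp add: Hfun_def Ient_def)

lemma rfun_0: "rfun p 0 = 0"
  by (simp add: rfun_def)

lemma one_minus_square_pos: "\<bar>x\<bar> < 1 \<Longrightarrow> 0 < 1 - x\<^sup>2" for x :: real
  by (simp add: abs_square_less_1)

text \<open>For p \<ge> 3 the numerator changes sign once on (0, 1), at x^2 = (p - 2) / p. So
  \<open>rfun p\<close> starts at 0, falls, and then rises: it can cross zero at most once.\<close>

lemma rfun_has_derivative:
  assumes "\<bar>x\<bar> < 1"
  shows "(rfun p has_real_derivative (real p * x\<^sup>2 - (real p - 2)) / (1 - x\<^sup>2)\<^sup>2) (at x)"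
proof -
  have [simp]: "1 - x\<^sup>2 \<noteq> 0"
    using one_minus_square_pos[OF assms] by linarith
  have *: "((\<lambda>x. x / (1 - x\<^sup>2)) has_real_derivative (1 + x\<^sup>2) / (1 - x\<^sup>2)\<^sup>2) (at x)"
  proof -
    have "((\<lambda>x. 1 - x\<^sup>2) has_real_derivative - 2 * x) (at x)"
      by (auto intro!: derivative_eq_intros)
    from DERIV_divide[OF DERIV_ident this \<open>1 - x\<^sup>2 \<noteq> 0\<close>] show ?thesis
      by (rule DERIV_cong) (simp only: power2_eq_square, simp add: algebra_simps)
  qed
  have "(rfun p has_real_derivative (1 + x\<^sup>2) / (1 - x\<^sup>2)\<^sup>2 - (real p - 1) * (1 / (1 - x\<^sup>2))) (at x)"
    unfolding rfun_def
    by (rule DERIV_diff[OF * DERIV_cmult[OF artanh_real_has_field_derivative[OF assms]]])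
  also have "(1 + x\<^sup>2) / (1 - x\<^sup>2)\<^sup>2 - (real p - 1) * (1 / (1 - x\<^sup>2))
      = (1 + x\<^sup>2) / (1 - x\<^sup>2)\<^sup>2 - (real p - 1) * (1 - x\<^sup>2) / (1 - x\<^sup>2)\<^sup>2"
    by (simp add: power2_eq_square[of "1 - x\<^sup>2"])
  also have "\<dots> = (real p * x\<^sup>2 - (real p - 2)) / (1 - x\<^sup>2)\<^sup>2"
    by (simp add: algebra_simps flip: diff_divide_distrib)
  finally show ?thesis .
qed

lemma gfun_has_derivative:
  assumes "0 < x" "x < 1" "1 \<le> p"
  shows "(gfun p has_real_derivative rfun p x / (real p * x ^ p)) (at x)"
proof -
  obtain q where p: "p = Suc q" using assms by (cases p) auto
  have 1: "((\<lambda>x. real p * x ^ q) has_real_derivative real p * (real q * x ^ (q - 1))) (at x)"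
    using DERIV_cmult[OF DERIV_pow] by simp
  have 2: "(artanh has_real_derivative 1 / (1 - x\<^sup>2)) (at x)"
    using assms by (intro artanh_real_has_field_derivative) auto
  have "(gfun p has_real_derivative
     (1 / (1 - x\<^sup>2) * (real p * x ^ q) - artanh x * (real p * (real q * x ^ (q - 1))))
       / ((real p * x ^ q) * (real p * x ^ q))) (at x)"
    unfolding gfun_def p diff_Suc_1
    by (rule DERIV_divide[OF 2 1[unfolded p]]) (use assms in auto)
  also have "(1 / (1 - x\<^sup>2) * (real p * x ^ q) - artanh x * (real p * (real q * x ^ (q - 1))))
       / ((real p * x ^ q) * (real p * x ^ q)) = rfun p x / (real p * x ^ p)"
  proof -
    have q: "real q * x ^ (q - 1) * x = real q * x ^ q"
      by (cases q) auto
    define D where "D = 1 - x\<^sup>2"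
    have D: "D > 0" unfolding D_def using assms one_minus_square_pos[of x] by auto
    define X where "X = x ^ q"
    define Y where "Y = real q * x ^ (q - 1)"
    have X: "X > 0" using assms by (simp add: X_def)
    have Y: "Y = real q * X / x"
      using q assms by (simp add: X_def Y_def field_simps)
    have "(1 / D * (real p * X) - artanh x * (real p * Y)) / (real p * X * (real p * X))
      = (x / D - (real p - 1) * artanh x) / (real p * (x * X))"
      unfolding Y using assms D X p by (simp add: divide_simps) (simp add: algebra_simps)
    then show ?thesis
      unfolding rfun_def X_def Y_def D_def p by simp
  qed
  finally show ?thesis .
qed

section \<open>Sign pattern of \<open>rfun\<close>; uniqueness and nondegeneracy of the
  maximizer\<close>

context
  fixes p :: nat
  assumes p3: "3 \<le> p"
begin

lemma rfun_neg_initial: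
  assumes "0 < x" "x < 1" "real p * x\<^sup>2 \<le> real p - 2"
  shows "rfun p x < 0"
proof -
  obtain z where z: "0 < z" "z < x"
    "rfun p x - rfun p 0 = (x - 0) * ((real p * z\<^sup>2 - (real p - 2)) / (1 - z\<^sup>2)\<^sup>2)"
    using MVT2[of 0 x "rfun p" "\<lambda>x. (real p * x\<^sup>2 - (real p - 2)) / (1 - x\<^sup>2)\<^sup>2"]
      rfun_has_derivative assms by auto
  have "z\<^sup>2 < x\<^sup>2"
    using z by (intro power_strict_mono) auto
  then have "real p * z\<^sup>2 < real p * x\<^sup>2"
    using p3 by (intro mult_strict_left_mono) auto
  then have "(real p * z\<^sup>2 - (real p - 2)) / (1 - z\<^sup>2)\<^sup>2 < 0"
    using assms z one_minus_square_pos[of z] by (intro divide_neg_pos) auto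
  then have "(x - 0) * ((real p * z\<^sup>2 - (real p - 2)) / (1 - z\<^sup>2)\<^sup>2) < 0"
    using assms by (intro mult_pos_neg) auto
  then show ?thesis
    using z by (simp only: rfun_0)
qed

lemma rfun_increasing:
  assumes "real p - 2 \<le> real p * x\<^sup>2" "0 < x" "x < y" "y < 1"
  shows "rfun p x < rfun p y"
proof -
  obtain z where z: "x < z" "z < y"
    "rfun p y - rfun p x = (y - x) * ((real p * z\<^sup>2 - (real p - 2)) / (1 - z\<^sup>2)\<^sup>2)"
    using MVT2[of x y "rfun p" "\<lambda>x. (real p * x\<^sup>2 - (real p - 2)) / (1 - x\<^sup>2)\<^sup>2"]
      rfun_has_derivative assms by auto
  have "x\<^sup>2 < z\<^sup>2"
    using z assms by (intro power_strict_mono) auto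
  then have "real p * x\<^sup>2 < real p * z\<^sup>2"
    using p3 by (intro mult_strict_left_mono) auto
  then have "(real p * z\<^sup>2 - (real p - 2)) / (1 - z\<^sup>2)\<^sup>2 > 0"
    using assms z one_minus_square_pos[of z] by (intro divide_pos_pos) auto
  then have "(y - x) * ((real p * z\<^sup>2 - (real p - 2)) / (1 - z\<^sup>2)\<^sup>2) > 0"
    using assms by (intro mult_pos_pos) auto
  then show ?thesis
    using z by linarith
qed

text \<open>Either x lies in the initial range, where \<open>rfun p\<close> is negative anyway, or
  \<open>rfun p\<close> increases strictly from x to y.\<close>

lemma rfun_neg_below: "rfun p y \<le> 0 \<Longrightarrow> 0 < x \<Longrightarrow> x < y \<Longrightarrow> y < 1 \<Longrightarrow> rfun p x < 0"
  using rfun_neg_initial[of x] rfun_increasing[of x y] by linarith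

lemma rfun_pos_above: "0 < rfun p x \<Longrightarrow> 0 < x \<Longrightarrow> x \<le> y \<Longrightarrow> y < 1 \<Longrightarrow> 0 < rfun p y"
  using rfun_neg_below[of y x] by (cases "x = y") force+

end

text \<open>The threshold enters through the positive maximum: it rules out 0 as a maximizer and
  later forces the second derivative at m to be negative. Uniqueness of m is not assumed but
  derived.\<close>

locale supercritical =
  fixes p :: nat and \<beta> m :: real
  assumes p3: "3 \<le> p" and beta_pos: "0 < \<beta>"
    and m_pos: "0 < m" and m_le1: "m \<le> 1"
    and m_max: "\<And>x. x \<in> {-1..1} \<Longrightarrow> Hfun \<beta> p x \<le> Hfun \<beta> p m"
    and Hm_pos: "0 < Hfun \<beta> p m"
begin

abbreviation "H \<equiv> Hfun \<beta> p"

abbreviation "H1 x \<equiv> \<beta> * real p * x ^ (p - 1) - artanh x"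

lemma H1_eq: "0 < x \<Longrightarrow> H1 x = real p * x ^ (p - 1) * (\<beta> - gfun p x)"
  using p3 by (simp add: gfun_def field_simps)

text \<open>The slope of H is at most \<beta> p - artanh z, and artanh is unbounded near 1. Beyond
  tanh (\<beta> p) the slope is negative, so H strictly decreases up to the end point.\<close>

lemma H_one_less: "H 1 < H m"
proof -
  define x where "x = tanh (\<beta> * real p)"
  have x: "0 < x" "x < 1"
    using beta_pos p3 by (simp_all add: x_def tanh_real_lt_1)
  have "\<exists>l z. x < z \<and> z < 1 \<and> (H has_real_derivative l) (at z) \<and> H 1 - H x = (1 - x) * l"
  proof (rule MVT)
    show "x < 1" by (rule x)
    show "continuous_on {x..1} H"
      by (rule continuous_on_subset[OF continuous_on_Hfun]) (use x in auto)
    show "H differentiable (at z)" if "x < z" "z < 1" for z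
      unfolding real_differentiable_def
      by (rule exI, rule Hfun_has_derivative) (use x that in linarith)
  qed
  then obtain l z where z: "x < z" "z < 1" "(H has_real_derivative l) (at z)" "H 1 - H x = (1 - x) * l"
    by blast
  have l: "l = H1 z"
    by (rule DERIV_unique[OF z(3) Hfun_has_derivative]) (use x z in linarith)
  have "artanh z > artanh x"
    by (rule artanh_strict_mono) (use x z in linarith)+
  moreover have "artanh x = \<beta> * real p"
    by (simp add: x_def artanh_tanh_real)
  moreover have "\<beta> * real p * z ^ (p - 1) \<le> \<beta> * real p"
    by (rule mult_left_le) (use beta_pos z x in \<open>auto intro!: power_le_one\<close>)
  ultimately have "l < 0" using l by linarith
  then have "(1 - x) * l < 0" using x by (intro mult_pos_neg) auto
  then have "H 1 < H x" using z by linarith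
  also have "H x \<le> H m" using x by (intro m_max) auto
  finally show ?thesis .
qed

lemma H_negative: "0 < x \<Longrightarrow> odd p \<Longrightarrow> H (- x) < H x"
proof -
  assume *: "0 < x" "odd p"
  have "0 < \<beta> * x ^ p" using * beta_pos by simp
  moreover have "H (- x) = - (\<beta> * x ^ p) - Ient x" "H x = \<beta> * x ^ p - Ient x"
    using * by (auto simp: Hfun_def Ient_minus)
  ultimately show ?thesis by linarith
qed

lemma H_minus: "even p \<Longrightarrow> H (- x) = H x"
  by (simp add: Hfun_def Ient_minus)

text \<open>For the strict sign, suppose r(y) \<le> 0. Then r < 0 on all of (0, y), so g decreases
  there to its value \<beta> at y and exceeds \<beta> before; hence H' < 0 on (0, y) and H(y) < H(0)
  = 0, against positivity of the maximum.\<close>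

lemma gfun_at_max:
  assumes y: "0 < y" "y < 1" "H y = H m"
  shows "gfun p y = \<beta>" and "0 < rfun p y"
proof -
  have d: "(H has_real_derivative H1 y) (at y)"
    using y by (intro Hfun_has_derivative) auto
  have "H1 y = 0"
  proof (rule DERIV_local_max[OF d])
    show "0 < min y (1 - y)" using y by auto
    show "\<forall>z. \<bar>y - z\<bar> < min y (1 - y) \<longrightarrow> H z \<le> H y"
      using y by (auto intro!: m_max simp: abs_if split: if_splits)
  qed
  then show g: "gfun p y = \<beta>"
    using H1_eq[of y] y p3 by auto
  show "0 < rfun p y"
  proof (rule ccontr)
    assume neg: "\<not> 0 < rfun p y"
    obtain z where z: "0 < z" "z < y" "H y - H 0 = (y - 0) * H1 z"
      using MVT2[of 0 y H "\<lambda>x. H1 x"] Hfun_has_derivative y by auto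
    obtain w where w: "z < w" "w < y"
      "gfun p y - gfun p z = (y - z) * (rfun p w / (real p * w ^ p))"
      using MVT2[of z y "gfun p" "\<lambda>x. rfun p x / (real p * x ^ p)"] gfun_has_derivative y z p3
      by auto
    have "rfun p w < 0"
      using rfun_neg_below[of p y w] neg w z y p3 by auto
    then have "(y - z) * (rfun p w / (real p * w ^ p)) < 0"
      using w z p3 by (intro mult_pos_neg divide_neg_pos) auto
    then have "\<beta> < gfun p z"
      using g w by linarith
    then have "H1 z < 0"
      using z p3 by (subst H1_eq) (auto intro!: mult_pos_neg)
    then have "y * H1 z < 0"
      using y by (intro mult_pos_neg)
    then have "H y < 0" using z p3 by (simp add: Hfun_0)
    then show False using y Hm_pos by simp
  qed
qed

text \<open>To the right of a maximizer x the function r stays positive, so g increases beyond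
  \<beta> and H strictly decreases: its value cannot be regained at y.\<close>

lemma maximizers_not_less:
  assumes x: "0 < x" "H x = H m" and y: "y < 1" "H y = H m" and xy: "x < y"
  shows False
proof -
  obtain z where z: "x < z" "z < y" "H y - H x = (y - x) * H1 z"
    using MVT2[of x y H "\<lambda>x. H1 x"] Hfun_has_derivative assms by auto
  obtain w where w: "x < w" "w < z"
    "gfun p z - gfun p x = (z - x) * (rfun p w / (real p * w ^ p))"
    using MVT2[of x z "gfun p" "\<lambda>x. rfun p x / (real p * x ^ p)"] gfun_has_derivative assms z p3
    by auto
  have "rfun p w > 0"
    using rfun_pos_above[of p x w] gfun_at_max[of x] assms w z p3 by auto
  then have "(z - x) * (rfun p w / (real p * w ^ p)) > 0"
    using w z x p3 by (intro mult_pos_pos divide_pos_pos) auto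
  then have "\<beta> < gfun p z"
    using w gfun_at_max[of x] assms by auto
  then have "H1 z < 0"
    using z x p3 by (subst H1_eq) (auto intro!: mult_pos_neg)
  then have "(y - x) * H1 z < 0"
    using xy by (intro mult_pos_neg) auto
  then show False using z assms by simp
qed

lemma m_less1: "m < 1"
  using H_one_less m_le1 by (cases "m = 1") auto

lemma maximizer_unique:
  assumes "x \<in> {-1..1}" "H x = H m"
  shows "theta p x = m"
proof -
  have pos: "x = m" if "0 < x" "x \<le> 1" "H x = H m" for x
  proof -
    have "x < 1" using that H_one_less by (cases "x = 1") auto
    then show ?thesis
      using maximizers_not_less[of x m] maximizers_not_less[of m x] that m_pos m_less1
      by (cases x m rule: linorder_cases) auto
  qed
  consider "0 < x" | "x = 0" | "x < 0" by linarith
  then show ?thesis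
  proof cases
    case 1
    then show ?thesis using pos[of x] assms by (auto simp: theta_def)
  next
    case 2
    then show ?thesis using assms Hm_pos p3 by (simp add: Hfun_0)
  next
    case 3
    show ?thesis
    proof (cases "even p")
      case True
      then show ?thesis using pos[of "- x"] 3 assms by (auto simp: theta_def H_minus)
    next
      case False
      then show ?thesis using H_negative[of "- x"] m_max[of "- x"] 3 assms by auto
    qed
  qed
qed

lemma continuous_on_theta: "continuous_on A (theta p)"
  unfolding theta_def by (cases "even p") (auto intro!: continuous_intros)

text \<open>On the compact set of points away from the maximizers H attains its supremum, which
  uniqueness keeps below H(m). This gap is the exponential rate for the configurations far from the
  maximizers.\<close>

lemma H_gap:
  assumes "0 < \<delta>"
  shows "\<exists>\<epsilon>>0. \<forall>x\<in>{-1..1}. \<delta> \<le> \<bar>theta p x - m\<bar> \<longrightarrow> H x \<le> H m - \<epsilon>"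
proof -
  define S where "S = {-1..1} \<inter> {x. \<delta> \<le> \<bar>theta p x - m\<bar>}"
  have "closed {x. \<delta> \<le> \<bar>theta p x - m\<bar>}"
    by (intro closed_Collect_le continuous_intros continuous_on_theta)
  then have S: "compact S"
    unfolding S_def by (intro compact_Int_closed) auto
  show ?thesis
  proof (cases "S = {}")
    case True
    then show ?thesis by (intro exI[of _ 1]) (auto simp: S_def)
  next
    case False
    obtain x where x: "x \<in> S" "\<forall>y\<in>S. H y \<le> H x"
      using continuous_attains_sup[OF S False, of H] continuous_on_subset[OF continuous_on_Hfun]
      by (auto simp: S_def)
    have "H x \<noteq> H m"
      using maximizer_unique[of x] x assms by (auto simp: S_def)
    then have "H x < H m"
      using m_max[of x] x by (auto simp: S_def)
    then show ?thesis
      using x by (intro exI[of _ "H m - H x"]) (auto simp: S_def)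
  qed
qed

section \<open>Constants and Taylor expansions at the maximizer\<close>

lemma gfun_m: "gfun p m = \<beta>" and rfun_m_pos: "0 < rfun p m"
  using gfun_at_max[of m] m_pos m_less1 by auto

text \<open>\<open>lam\<close> is -H''(m), \<open>kap\<close> is g'(m), and \<open>sig\<close> is
  the limiting standard deviation. Written through \<open>rfun\<close>, the first two are visibly
  positive.\<close>

definition lam :: real where "lam = rfun p m / m"
definition kap :: real where "kap = rfun p m / (real p * m ^ p)"
definition sig :: real where "sig = sqrt (lam / (real p ^ 2 * m ^ (2 * p - 2)))"
text \<open>With \<open>hi\<close>, a compact neighbourhood of m inside (0, 1): it avoids the
  singularity of \<open>gfun\<close> at 0 and of artanh at 1, so derivatives are bounded on
  it.\<close>

definition lo :: real where "lo = m / 2"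
definition hi :: real where "hi = (1 + m) / 2"

lemma lam_pos: "0 < lam" and kap_pos: "0 < kap"
  using rfun_m_pos m_pos p3 by (auto simp: lam_def kap_def)

lemma lo_hi: "0 < lo" "lo < m" "m < hi" "hi < 1"
  using m_pos m_less1 by (auto simp: lo_def hi_def)

lemma sig_pos: "0 < sig"
  using lam_pos m_pos p3 by (simp add: sig_def)

text \<open>Under the substitution z = kap sqrt N (x - m) this identity turns the exponent N lam (x
  - m)^2 / 2 into z^2 / (2 sig^2).\<close>

lemma kap_sig: "kap\<^sup>2 = lam * sig\<^sup>2"
proof -
  have "kap = lam / (real p * m ^ (p - 1))"
  proof -
    have "m ^ p = m * m ^ (p - 1)"
      using p3 by (simp flip: power_Suc)
    then show ?thesis
      unfolding kap_def lam_def by simp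
  qed
  moreover have "m ^ (2 * p - 2) = (m ^ (p - 1))\<^sup>2"
    by (simp add: power_mult[symmetric] mult.commute diff_mult_distrib2)
  moreover have "sig\<^sup>2 = lam / (real p ^ 2 * m ^ (2 * p - 2))"
    using lam_pos m_pos by (simp add: sig_def)
  ultimately show ?thesis
    by (simp add: power_divide power_mult_distrib power2_eq_square)
qed

abbreviation "H2 x \<equiv> \<beta> * real p * (real (p - 1) * x ^ (p - 2)) - 1 / (1 - x\<^sup>2)"

lemma H1_has_derivative: "\<bar>x\<bar> < 1 \<Longrightarrow> ((\<lambda>x. H1 x) has_real_derivative H2 x) (at x)"
  by (auto intro!: derivative_eq_intros simp: numeral_2_eq_2)

lemma H2_m: "H2 m = - lam"
proof -
  \<comment> \<open>The critical point equation eliminates \<beta> from the second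
    derivative.\<close>
  have "artanh m = \<beta> * real p * m ^ (p - 1)"
    using gfun_m m_pos p3 by (auto simp: gfun_def field_simps)
  also have "m ^ (p - 1) = m * m ^ (p - 2)"
    using p3 by (simp flip: power_Suc add: Suc_diff_le[symmetric] Suc_diff_Suc numeral_2_eq_2)
  finally have "artanh m = \<beta> * real p * (m * m ^ (p - 2))" .
  then show ?thesis
    using m_pos p3 one_minus_square_pos[of m] m_less1
    by (simp add: lam_def rfun_def of_nat_diff field_simps)
qed

lemma deriv_deriv_H: "deriv (deriv H) m = - lam"
proof -
  have "\<forall>\<^sub>F x in nhds m. x \<in> {-1<..<1}"
    using m_pos m_less1 by (intro eventually_nhds_in_open) auto
  then have "\<forall>\<^sub>F x in nhds m. deriv H x = H1 x"
    by eventually_elim (rule DERIV_imp_deriv, rule Hfun_has_derivative, auto)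
  then have "deriv (deriv H) m = deriv (\<lambda>x. H1 x) m"
    by (intro deriv_cong_ev) auto
  also have "\<dots> = H2 m"
    using m_pos m_less1 by (intro DERIV_imp_deriv H1_has_derivative) auto
  finally show ?thesis unfolding H2_m .
qed

lemma H1_m: "H1 m = 0"
  using H1_eq[of m] m_pos gfun_m by simp

lemma in_lo_hi: "x \<in> {lo..hi} \<Longrightarrow> 0 < x \<and> x < 1 \<and> \<bar>x\<bar> < 1 \<and> 0 < 1 - x\<^sup>2"
  using lo_hi one_minus_square_pos[of x] by auto

lemma H_taylor:
  "\<exists>M>0. \<forall>x\<in>{lo..hi}. \<bar>H x - H m + lam / 2 * (x - m)\<^sup>2\<bar> \<le> M * \<bar>x - m\<bar> ^ 3"
proof -
  define H3 where "H3 x = \<beta> * real p * (real (p - 1) * (real (p - 2) * x ^ (p - 3))) - 2 * x / (1 - x\<^sup>2)\<^sup>2"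
    for x
  have "((\<lambda>x. H2 x) has_real_derivative H3 x) (at x)" if "x \<in> {lo..hi}" for x
    using in_lo_hi[OF that] unfolding H3_def
    by (auto intro!: derivative_eq_intros simp: power2_eq_square numeral_2_eq_2 numeral_3_eq_3)
  moreover have "continuous_on {lo..hi} H3"
    unfolding H3_def by (intro continuous_intros) (use in_lo_hi in force)
  then obtain M where M: "M > 0" "\<forall>x\<in>{lo..hi}. \<bar>H3 x\<bar> \<le> M"
    using compact_bound by blast
  ultimately have "\<bar>H x - H m - H1 m * (x - m) - H2 m / 2 * (x - m)\<^sup>2\<bar> \<le> M * \<bar>x - m\<bar> ^ 3"
    if "x \<in> {lo..hi}" for x
    using lo_hi that in_lo_hi
    by (intro taylor3_bound[of lo hi _ "\<lambda>x. H1 x" "\<lambda>x. H2 x" H3] Hfun_has_derivative H1_has_derivative) auto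
  then show ?thesis
    unfolding H1_m H2_m using M by (intro exI[of _ M]) auto
qed

lemma gfun_taylor:
  "\<exists>M>0. \<forall>x\<in>{lo..hi}. \<bar>gfun p x - \<beta> - kap * (x - m)\<bar> \<le> M * (x - m)\<^sup>2"
proof -
  define r' where "r' x = (real p * x\<^sup>2 - (real p - 2)) / (1 - x\<^sup>2)\<^sup>2" for x :: real
  define g2 where "g2 x = (r' x * (real p * x ^ p) - rfun p x * (real p * (real p * x ^ (p - 1)))) /
      ((real p * x ^ p) * (real p * x ^ p))" for x
  have "((\<lambda>x. rfun p x / (real p * x ^ p)) has_real_derivative g2 x) (at x)" if "x \<in> {lo..hi}" for x
  proof -
    have "((\<lambda>x. real p * x ^ p) has_real_derivative real p * (real p * x ^ (p - 1))) (at x)"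
      by (auto intro!: derivative_eq_intros)
    from DERIV_divide[OF rfun_has_derivative[of x p] this] show ?thesis
      using in_lo_hi[OF that] p3 by (simp add: g2_def r'_def)
  qed
  moreover have "continuous_on {lo..hi} g2"
  proof -
    have "continuous_on {lo..hi} (rfun p)"
      by (rule DERIV_continuous_on, rule has_field_derivative_at_within, rule rfun_has_derivative)
         (use in_lo_hi in auto)
    then show ?thesis
      unfolding g2_def r'_def using p3 by (intro continuous_intros) (use in_lo_hi in force)+
  qed
  then obtain M where M: "M > 0" "\<forall>x\<in>{lo..hi}. \<bar>g2 x\<bar> \<le> M"
    using compact_bound by blast
  ultimately have "\<bar>gfun p x - gfun p m - rfun p m / (real p * m ^ p) * (x - m)\<bar> \<le> M * (x - m)\<^sup>2"
    if "x \<in> {lo..hi}" for x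
    using lo_hi that in_lo_hi p3
    by (intro taylor2_bound[of lo hi _ "\<lambda>x. rfun p x / (real p * x ^ p)" g2] gfun_has_derivative) auto
  then show ?thesis
    unfolding gfun_m kap_def using M by (intro exI[of _ M]) auto
qed

end

section \<open>Reduction to the binomial distribution\<close>

definition mag :: "nat \<Rightarrow> (nat \<Rightarrow> real) \<Rightarrow> real" where
  "mag N X = (\<Sum>i<N. X i) / real N"

text \<open>Magnetization and unnormalized total weight of the configurations with \<open>k\<close> spins \<open>+1\<close>.\<close>

definition xk :: "nat \<Rightarrow> nat \<Rightarrow> real" where
  "xk N k = 2 * real k / real N - 1"

definition vk :: "real \<Rightarrow> nat \<Rightarrow> nat \<Rightarrow> nat \<Rightarrow> real" where
  "vk \<beta> p N k = real (N choose k) * exp (\<beta> * real N * xk N k ^ p)"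

lemma finite_config_space: "finite (config_space N)"
  unfolding config_space_def by (intro finite_PiE) auto

lemma config_space_values: "X \<in> config_space N \<Longrightarrow> i < N \<Longrightarrow> X i = - 1 \<or> X i = 1"
  by (auto simp: config_space_def PiE_iff)

text \<open>The sum admits repeated indices, so it factorizes exactly into a p-th power, with no
  lower order corrections.\<close>

lemma hamil_eq:
  assumes "1 \<le> N"
  shows "hamil \<beta> p N X = \<beta> * real N * mag N X ^ p"
proof -
  have "(\<Sum>\<iota>\<in>PiE {..<p} (\<lambda>_. {..<N}). \<Prod>k<p. X (\<iota> k)) = (\<Prod>k<p. \<Sum>i<N. X i)"
    by (rule prod_sum_PiE[symmetric]) auto
  then have "hamil \<beta> p N X = \<beta> * (real N powr (1 - real p) * (\<Sum>i<N. X i) ^ p)"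
    by (simp add: hamil_def)
  also have "real N powr (1 - real p) = real N / real N ^ p"
    using assms by (simp add: powr_diff powr_realpow)
  finally show ?thesis
    by (simp add: mag_def power_divide)
qed

lemma sum_config_space:
  fixes f :: "real \<Rightarrow> real"
  shows "(\<Sum>X\<in>config_space N. f (\<Sum>i<N. X i)) = (\<Sum>k\<le>N. real (N choose k) * f (2 * real k - real N))"
proof -
  have sum_if: "(\<Sum>i<N. if i \<in> A then 1 else - 1) = 2 * real (card A) - real N"
    if "A \<subseteq> {..<N}" for A
  proof -
    have "(\<Sum>i<N. if i \<in> A then 1 else - 1) = (\<Sum>i<N. 2 * (if i \<in> A then 1 else 0) - (1::real))"
      by (intro sum.cong) auto
    also have "\<dots> = 2 * real (card A) - real N"
      using that by (simp add: sum_subtractf sum.If_cases Int_absorb1 flip: sum_distrib_left)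
    finally show ?thesis .
  qed
  have "(\<Sum>X\<in>config_space N. f (\<Sum>i<N. X i)) = (\<Sum>A\<in>Pow {..<N}. f (2 * real (card A) - real N))"
  proof (rule sum.reindex_bij_witness
      [of _ "\<lambda>A. restrict (\<lambda>i. if i \<in> A then 1 else - 1) {..<N}" "\<lambda>X. {i\<in>{..<N}. X i = 1}"])
    fix X assume X: "X \<in> config_space N"
    show eq: "restrict (\<lambda>i. if i \<in> {i \<in> {..<N}. X i = 1} then 1 else - 1) {..<N} = X"
      using X config_space_values[OF X]
      by (auto simp: config_space_def restrict_def PiE_iff extensional_def fun_eq_iff) fastforce
    show "{i \<in> {..<N}. X i = 1} \<in> Pow {..<N}" by auto
    have "(\<Sum>i<N. X i) = (\<Sum>i<N. if i \<in> {i \<in> {..<N}. X i = 1} then 1 else - 1)"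
      using config_space_values[OF X] by (intro sum.cong) auto
    then show "f (2 * real (card {i \<in> {..<N}. X i = 1}) - real N) = f (\<Sum>i<N. X i)"
      by (subst (asm) sum_if) auto
  next
    fix A assume "A \<in> Pow {..<N}"
    then show "{i \<in> {..<N}. restrict (\<lambda>i. if i \<in> A then 1 else - 1) {..<N} i = (1::real)} = A"
      by auto
    show "restrict (\<lambda>i. if i \<in> A then 1 else - 1) {..<N} \<in> config_space N"
      by (auto simp: config_space_def)
  qed
  also have "\<dots> = (\<Sum>k\<le>N. \<Sum>A | A \<in> Pow {..<N} \<and> card A = k. f (2 * real (card A) - real N))"
    using card_mono[of "{..<N}"] by (intro sum.group[symmetric]) auto
  also have "\<dots> = (\<Sum>k\<le>N. real (N choose k) * f (2 * real k - real N))"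
    by (intro sum.cong refl) (simp add: n_subsets)
  finally show ?thesis .
qed

lemma sum_config_mag:
  fixes \<phi> :: "real \<Rightarrow> real"
  assumes "1 \<le> N"
  shows "(\<Sum>X\<in>config_space N. exp (hamil \<beta> p N X) * \<phi> (mag N X)) = (\<Sum>k\<le>N. vk \<beta> p N k * \<phi> (xk N k))"
proof -
  have "(\<Sum>X\<in>config_space N. exp (hamil \<beta> p N X) * \<phi> (mag N X))
    = (\<Sum>X\<in>config_space N. (\<lambda>s. exp (\<beta> * real N * (s / real N) ^ p) * \<phi> (s / real N)) (\<Sum>i<N. X i))"
    using assms by (simp add: hamil_eq mag_def)
  also have "\<dots> = (\<Sum>k\<le>N. vk \<beta> p N k * \<phi> (xk N k))"
    unfolding sum_config_space[where f = "\<lambda>s. exp (\<beta> * real N * (s / real N) ^ p) * \<phi> (s / real N)"]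
    using assms by (intro sum.cong refl) (simp add: vk_def xk_def diff_divide_distrib)
  finally show ?thesis .
qed

text \<open>For N \<ge> 1 this equals \<open>2 ^ N * partition_fn \<beta> p N\<close>.\<close>

definition Zk :: "real \<Rightarrow> nat \<Rightarrow> nat \<Rightarrow> real" where
  "Zk \<beta> p N = (\<Sum>k\<le>N. vk \<beta> p N k)"

lemma vk_pos: "k \<le> N \<Longrightarrow> 0 < vk \<beta> p N k"
  by (simp add: vk_def)

lemma Zk_pos: "0 < Zk \<beta> p N"
  unfolding Zk_def by (intro sum_pos vk_pos) auto

lemma cw_prob_eq:
  assumes "1 \<le> N"
  shows "cw_prob \<beta> p N X = exp (hamil \<beta> p N X) / Zk \<beta> p N"
  using sum_config_mag[OF assms, of \<beta> p "\<lambda>_. 1"]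
  by (simp add: cw_prob_def partition_fn_def Zk_def)

lemma xk_symmetric: "1 \<le> N \<Longrightarrow> k \<le> N \<Longrightarrow> xk N (N - k) = - xk N k"
  by (simp add: xk_def of_nat_diff field_simps)

text \<open>For even p, reversing all spins sends k to N - k, keeps the weight and negates the
  magnetization. A test function that vanishes on the nonpositive side thus sees each of the two
  maximizers once.\<close>

lemma sum_theta:
  fixes \<phi> :: "real \<Rightarrow> real"
  assumes N: "1 \<le> N" and \<phi>: "\<And>x. x \<le> 0 \<Longrightarrow> \<phi> x = 0"
  shows "(\<Sum>k\<le>N. vk \<beta> p N k * \<phi> (theta p (xk N k)))
      = (if even p then 2 else 1) * (\<Sum>k\<le>N. vk \<beta> p N k * \<phi> (xk N k))"
proof (cases "even p")
  case True
  have split: "\<phi> \<bar>x\<bar> = \<phi> x + \<phi> (- x)" for x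
    using \<phi>[of x] \<phi>[of "- x"] by (cases "0 < x") (auto simp: abs_if)
  have "(\<Sum>k\<le>N. vk \<beta> p N k * \<phi> (- xk N k)) = (\<Sum>k\<le>N. vk \<beta> p N k * \<phi> (xk N k))"
    by (rule sum.reindex_bij_witness[of _ "\<lambda>k. N - k" "\<lambda>k. N - k"])
       (use N True in \<open>auto simp: xk_symmetric vk_def binomial_symmetric[symmetric]\<close>)
  then show ?thesis
    using True by (simp add: theta_def split distrib_left sum.distrib)
qed (simp add: theta_def)

section \<open>Entropy estimates for binomial coefficients\<close>

text \<open>Consecutive terms of the sequence k^j / j! in j have ratio k / (j + 1), so it is largest
  at j = k.\<close>

lemma fact_mult_power_le: "fact k * k ^ j \<le> fact j * (k ^ k :: nat)"
proof (cases "k \<le> j")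
  case True
  then show ?thesis
  proof (induction j rule: dec_induct)
    case (step n)
    have "fact k * k ^ Suc n = k * (fact k * k ^ n)" by simp
    also have "\<dots> \<le> Suc n * (fact n * k ^ k)"
      using step by (intro mult_mono[of k "Suc n"]) auto
    finally show ?case by (simp add: algebra_simps)
  qed simp
next
  case False
  then have "j \<le> k" by simp
  then show ?thesis
  proof (induction j rule: inc_induct)
    case (step n)
    have "k * (fact k * k ^ n) \<le> Suc n * (fact n * k ^ k)"
      using step by (simp add: algebra_simps)
    also have "\<dots> \<le> k * (fact n * k ^ k)"
      using step by (intro mult_right_mono) auto
    finally show ?case using step by (simp only: mult_le_cancel1)
  qed simp
qed

text \<open>Up to the factor \<open>N ^ N\<close>, the two sides are the probabilities of j and k
  under the binomial law with success probability k / N, whose mode is k.\<close>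

lemma binomial_mode:
  assumes "k \<le> N" "j \<le> N"
  shows "real (N choose j) * real k ^ j * real (N - k) ^ (N - j)
    \<le> real (N choose k) * real k ^ k * real (N - k) ^ (N - k)"
proof -
  have f: "real k ^ j / fact j \<le> real k ^ k / fact k" for k j
  proof -
    have "real (fact k * k ^ j) \<le> real (fact j * k ^ k)"
      using fact_mult_power_le by (simp only: of_nat_le_iff)
    then show ?thesis by (simp add: field_simps)
  qed
  have e: "real (N choose i) * a * b = fact N * (a / fact i * (b / fact (N - i)))" if "i \<le> N" for i a b
    using that by (simp add: binomial_fact)
  show ?thesis
    unfolding e[OF assms(1)] e[OF assms(2)] using f by (intro mult_left_mono mult_mono) auto
qed

lemma exp_Ient_eq:
  assumes "1 \<le> N" "k \<le> N"
  shows "exp (real N * Ient (xk N k)) = 2 ^ N * (real k / real N) ^ k * (real (N - k) / real N) ^ (N - k)"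
proof -
  define q where "q = real k / real N"
  have q: "1 + xk N k = 2 * q" "1 - xk N k = 2 * (1 - q)" "real k = real N * q"
    "real (N - k) = real N * (1 - q)"
    using assms by (auto simp: q_def xk_def of_nat_diff field_simps)
  have "real N * Ient (xk N k) = real k * ln (2 * q) + real (N - k) * ln (2 * (1 - q))"
    unfolding Ient_def q by (simp add: field_simps)
  then have "exp (real N * Ient (xk N k)) = exp (real k * ln (2 * q)) * exp (real (N - k) * ln (2 * (1 - q)))"
    by (simp add: exp_add)
  \<comment> \<open>At \<open>k = 0\<close> both sides are 1, since \<open>0 ^ 0 = 1\<close>; the
    other end, \<open>k = N\<close>, works alike. The identity therefore includes magnetizations -1
    and 1.\<close>
  also have "exp (real k * ln (2 * q)) = (2 * q) ^ k"
    using assms by (cases "k = 0") (auto simp: q_def exp_of_nat_mult)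
  also have "exp (real (N - k) * ln (2 * (1 - q))) = (2 * (1 - q)) ^ (N - k)"
  proof (cases "k = N")
    case False
    then have "0 < 2 * (1 - q)" using assms by (auto simp: q_def field_simps)
    then show ?thesis by (simp only: exp_of_nat_mult exp_ln)
  qed simp
  also have "(2 * q) ^ k * (2 * (1 - q)) ^ (N - k) = 2 ^ (k + (N - k)) * q ^ k * (1 - q) ^ (N - k)"
    by (simp only: power_mult_distrib power_add) (simp only: mult_ac)
  also have "1 - q = real (N - k) / real N"
    using assms by (auto simp: q_def of_nat_diff field_simps)
  finally show ?thesis
    using assms by (simp add: q_def)
qed

lemma binomial_sum_one:
  assumes "1 \<le> N" "k \<le> N"
  shows "(\<Sum>j\<le>N. real (N choose j) * real k ^ j * real (N - k) ^ (N - j)) = real N ^ N"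
  using binomial_ring[of "real k" "real (N - k)" N] assms by (simp add: of_nat_diff)

text \<open>The right side is \<open>2 ^ N\<close> times the probability of the outcome k under the
  binomial law with success probability k / N. The next two bounds are the trivial ones for the
  probability of a mode.\<close>

lemma exp_Ient_binomial:
  assumes "1 \<le> N" "k \<le> N"
  shows "real (N choose k) * exp (real N * Ient (xk N k))
     = 2 ^ N * (real (N choose k) * real k ^ k * real (N - k) ^ (N - k)) / real N ^ N"
proof -
  have "real N ^ N = real N ^ k * real N ^ (N - k)"
    using assms by (simp flip: power_add)
  then show ?thesis
    using exp_Ient_eq[OF assms] by (simp add: power_divide)
qed

lemma binomial_le_entropy:
  assumes "1 \<le> N" "k \<le> N"
  shows "real (N choose k) * exp (real N * Ient (xk N k)) \<le> 2 ^ N"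
proof -
  have "real (N choose k) * real k ^ k * real (N - k) ^ (N - k) \<le> real N ^ N"
    unfolding binomial_sum_one[OF assms, symmetric]
    using assms by (intro member_le_sum[of k]) auto
  then show ?thesis
    using assms by (simp add: exp_Ient_binomial field_simps)
qed

text \<open>A mode has at least the average probability 1 / (N + 1). The polynomial loss is harmless
  against an exponential gap.\<close>

lemma binomial_ge_entropy:
  assumes "1 \<le> N" "k \<le> N"
  shows "2 ^ N \<le> real (N + 1) * (real (N choose k) * exp (real N * Ient (xk N k)))"
proof -
  have "real N ^ N \<le> (\<Sum>j\<le>N. real (N choose k) * real k ^ k * real (N - k) ^ (N - k))"
    unfolding binomial_sum_one[OF assms, symmetric]
    using assms by (intro sum_mono binomial_mode) auto
  then have "real N ^ N \<le> real (N + 1) * (real (N choose k) * real k ^ k * real (N - k) ^ (N - k))"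
    by simp
  then have "2 ^ N * real N ^ N \<le> 2 ^ N * (real (N + 1) * (real (N choose k) * real k ^ k * real (N - k) ^ (N - k)))"
    by (intro mult_left_mono) auto
  then show ?thesis
    unfolding exp_Ient_binomial[OF assms] using assms by (simp add: pos_le_divide_eq mult_ac)
qed

lemma vk_Hfun:
  "vk \<beta> p N k = real (N choose k) * exp (real N * Ient (xk N k)) * exp (real N * Hfun \<beta> p (xk N k))"
  by (simp add: vk_def Hfun_def mult.assoc algebra_simps flip: exp_add)

lemma vk_upper:
  assumes "1 \<le> N" "k \<le> N"
  shows "vk \<beta> p N k \<le> 2 ^ N * exp (real N * Hfun \<beta> p (xk N k))"
  unfolding vk_Hfun by (intro mult_right_mono binomial_le_entropy assms) auto

lemma vk_lower:
  assumes "1 \<le> N" "k \<le> N"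
  shows "2 ^ N * exp (real N * Hfun \<beta> p (xk N k)) \<le> real (N + 1) * vk \<beta> p N k"
  unfolding vk_Hfun mult.assoc[symmetric]
  using binomial_ge_entropy[OF assms] by (intro mult_right_mono) (auto simp: mult.assoc)

text \<open>For N \<ge> 1 and k \<le> N this is N ln 2 plus the log-probability of the mode k under
  the binomial law with success probability k / N: the part of the log-weight that varies slowly in
  k. Only its increments are ever estimated near m.\<close>

definition ak :: "nat \<Rightarrow> nat \<Rightarrow> real" where
  "ak N k = ln (real (N choose k)) + real N * Ient (xk N k)"

lemma ln_vk: "k \<le> N \<Longrightarrow> ln (vk \<beta> p N k) = ak N k + real N * Hfun \<beta> p (xk N k)"
  by (simp add: vk_def ak_def Hfun_def ln_mult algebra_simps)

lemma xk_Suc: "1 \<le> N \<Longrightarrow> xk N (Suc k) = xk N k + 2 / real N"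
  by (simp add: xk_def field_simps)

text \<open>With spacing \<epsilon> = 2 / N, the ratio of neighbouring binomial coefficients
  contributes ln (1 - x) - ln (1 + x + \<epsilon>), and the entropy contributes 2 artanh \<xi> for
  some \<xi> in the step. The leading terms -2 artanh x and 2 artanh x cancel; the remainder is
  O(\<epsilon>) because \<open>hi\<close> keeps the slope of artanh bounded.\<close>

lemma ak_step:
  assumes N: "1 \<le> N" and lo: "0 \<le> xk N k" and hi: "xk N (Suc k) \<le> hi" "hi < 1"
  shows "\<bar>ak N (Suc k) - ak N k\<bar> \<le> (4 / (1 - hi\<^sup>2) + 2) / real N"
proof -
  define \<epsilon> where "\<epsilon> = 2 / real N"
  define x where "x = xk N k"
  have e: "0 < \<epsilon>" using N by (simp add: \<epsilon>_def)
  have x: "0 \<le> x" "x + \<epsilon> \<le> hi" "xk N (Suc k) = x + \<epsilon>"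
    using xk_Suc[OF N, of k] assms by (auto simp: x_def \<epsilon>_def)
  have "x < 1" using x(2) hi e by linarith
  then have kN: "k < N"
    using N by (auto simp: x_def xk_def field_simps)
  have hi0: "0 < 1 - hi\<^sup>2"
    using x e hi by (intro one_minus_square_pos) auto
  have rec: "real (Suc k) * real (N choose Suc k) = real (N - k) * real (N choose k)"
    using binomial_absorb_comp[of N k] binomial_absorption[of k "N - 1"] kN N
    by (metis Suc_diff_1 Suc_times_binomial_eq binomial_absorb_comp mult.commute less_eq_Suc_le
        of_nat_mult One_nat_def)
  have "ln (real (Suc k) * real (N choose Suc k)) = ln (real (N - k) * real (N choose k))"
    by (simp only: rec)
  then have lnC: "ln (real (N choose Suc k)) - ln (real (N choose k)) = ln (real (N - k)) - ln (real (Suc k))"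
    using kN by (simp add: ln_mult del: of_nat_Suc)
  have Nk: "real (N - k) = real N / 2 * (1 - x)" "real (Suc k) = real N / 2 * (1 + (x + \<epsilon>))"
    using N kN by (auto simp: x_def xk_def \<epsilon>_def field_simps of_nat_diff)
  have lnC2: "ln (real (N choose Suc k)) - ln (real (N choose k)) = ln (1 - x) - ln (1 + (x + \<epsilon>))"
  proof -
    have "ln (real N / 2 * (1 - x)) = ln (real N / 2) + ln (1 - x)"
      by (rule ln_mult_pos) (use N x e hi in auto)
    moreover have "ln (real N / 2 * (1 + (x + \<epsilon>))) = ln (real N / 2) + ln (1 + (x + \<epsilon>))"
      by (rule ln_mult_pos) (use N x e hi in auto)
    ultimately show ?thesis unfolding lnC Nk by simp
  qed
  obtain \<xi> where \<xi>: "x < \<xi>" "\<xi> < x + \<epsilon>" "Ient (x + \<epsilon>) - Ient x = (x + \<epsilon> - x) * artanh \<xi>"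
    using MVT2[of x "x + \<epsilon>" Ient artanh] Ient_has_derivative x e hi by auto
  obtain \<zeta> where \<zeta>: "x < \<zeta>" "\<zeta> < \<xi>" "artanh \<xi> - artanh x = (\<xi> - x) * (1 / (1 - \<zeta>\<^sup>2))"
    using MVT2[of x \<xi> artanh "\<lambda>x. 1 / (1 - x\<^sup>2)"] artanh_real_has_field_derivative x \<xi> hi by auto
  have "\<zeta>\<^sup>2 \<le> hi\<^sup>2"
    using \<zeta> \<xi> x by (intro power_mono) auto
  then have "1 / (1 - \<zeta>\<^sup>2) \<le> 1 / (1 - hi\<^sup>2)" "0 \<le> 1 / (1 - \<zeta>\<^sup>2)"
    using hi0 by (auto intro!: divide_left_mono mult_pos_pos)
  then have art: "0 \<le> artanh \<xi> - artanh x" "artanh \<xi> - artanh x \<le> \<epsilon> * (1 / (1 - hi\<^sup>2))"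
  proof -
    show "0 \<le> artanh \<xi> - artanh x"
      unfolding \<zeta>(3) by (intro mult_nonneg_nonneg) (use \<zeta> \<open>0 \<le> 1 / (1 - \<zeta>\<^sup>2)\<close> in auto)
    show "artanh \<xi> - artanh x \<le> \<epsilon> * (1 / (1 - hi\<^sup>2))"
      unfolding \<zeta>(3)
      by (intro mult_mono \<open>1 / (1 - \<zeta>\<^sup>2) \<le> 1 / (1 - hi\<^sup>2)\<close> \<open>0 \<le> 1 / (1 - \<zeta>\<^sup>2)\<close>) (use \<xi> e in auto)
  qed
  have "ln ((1 + (x + \<epsilon>)) / (1 + x)) \<le> (1 + (x + \<epsilon>)) / (1 + x) - 1"
    using x e by (intro ln_le_minus_one divide_pos_pos) auto
  also have "\<dots> = \<epsilon> / (1 + x)" using x by (simp add: field_simps)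
  also have "\<dots> \<le> \<epsilon>" using x e by (simp add: divide_le_eq mult_le_cancel_left1)
  finally have ln1: "ln (1 + (x + \<epsilon>)) - ln (1 + x) \<le> \<epsilon>"
    using x e by (simp add: ln_div)
  have ln2: "0 \<le> ln (1 + (x + \<epsilon>)) - ln (1 + x)"
    using x e by simp
  have axeq: "ln (1 - x) = ln (1 + x) - 2 * artanh x"
    using artanh_eq[of x] x e hi by simp
  have "real N * (Ient (x + \<epsilon>) - Ient x) = 2 * artanh \<xi>"
    unfolding \<xi>(3) using N by (simp add: \<epsilon>_def)
  then have eq: "ak N (Suc k) - ak N k
     = 2 * (artanh \<xi> - artanh x) - (ln (1 + (x + \<epsilon>)) - ln (1 + x))"
    using lnC2 axeq unfolding ak_def x(3) x_def[symmetric] right_diff_distrib by linarith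
  have "\<bar>2 * A - D\<bar> \<le> 2 * (\<epsilon> * (1 / (1 - hi\<^sup>2))) + \<epsilon>"
    if "0 \<le> A" "A \<le> \<epsilon> * (1 / (1 - hi\<^sup>2))" "D \<le> \<epsilon>" "0 \<le> D" for A D
    using that by linarith
  then have "\<bar>ak N (Suc k) - ak N k\<bar> \<le> 2 * (\<epsilon> * (1 / (1 - hi\<^sup>2))) + \<epsilon>"
    unfolding eq using art ln1 ln2 by blast
  also have "\<dots> = (4 / (1 - hi\<^sup>2) + 2) / real N"
    by (simp add: \<epsilon>_def add_divide_distrib)
  finally show ?thesis .
qed

text \<open>One index step moves the magnetization by 2 / N, which is why the constant is half that
  of \<open>ak_step\<close>.\<close>

lemma ak_diff:
  assumes N: "1 \<le> N" and k: "0 \<le> xk N k" "xk N k \<le> hi" and j: "0 \<le> xk N j" "xk N j \<le> hi"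
    and hi: "hi < 1"
  shows "\<bar>ak N k - ak N j\<bar> \<le> (2 / (1 - hi\<^sup>2) + 1) * \<bar>xk N k - xk N j\<bar>"
proof -
  have main: "\<bar>ak N k - ak N j\<bar> \<le> (2 / (1 - hi\<^sup>2) + 1) * (xk N k - xk N j)"
    if "j \<le> k" and j: "0 \<le> xk N j" and k: "xk N k \<le> hi" for j k
  proof -
    have mono: "xk N a \<le> xk N b" if "a \<le> b" for a b
      using that N by (simp add: xk_def divide_right_mono)
    have "\<bar>ak N k - ak N j\<bar> \<le> ((4 / (1 - hi\<^sup>2) + 2) / real N) * (real k - real j)"
    proof (rule abs_telescope_le[OF that(1)])
      fix i assume i: "j \<le> i" "i < k"
      show "\<bar>ak N (Suc i) - ak N i\<bar> \<le> (4 / (1 - hi\<^sup>2) + 2) / real N"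
        by (rule ak_step[OF N _ _ hi]) (use mono[of j i] mono[of "Suc i" k] i j k in auto)
    qed
    also have "\<dots> = (2 / (1 - hi\<^sup>2) + 1) * (xk N k - xk N j)"
      using N by (simp add: xk_def field_simps)
    finally show ?thesis .
  qed
  show ?thesis
  proof (cases "j \<le> k")
    case True
    then show ?thesis
      using main[OF True j(1) k(2)] N by (simp add: xk_def divide_right_mono)
  next
    case False
    then have "\<bar>ak N j - ak N k\<bar> \<le> (2 / (1 - hi\<^sup>2) + 1) * (xk N j - xk N k)"
      using main[of k j] k j by simp
    moreover have "xk N k \<le> xk N j"
      using False by (simp add: xk_def divide_right_mono)
    ultimately show ?thesis by (simp add: abs_minus_commute)
  qed
qed

section \<open>The maximum pseudolikelihood estimate\<close>

text \<open>With \<open>u = up p N x\<close> and \<open>v = um p N x\<close>, flipping a spin \<open>+1\<close> (respectively \<open>-1\<close>) lowers the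
exponent of the model by \<open>\<beta> u\<close> (respectively \<open>- \<beta> v\<close>); \<open>nll\<close> is then the negative logarithm of the
pseudolikelihood per spin.\<close>

definition up :: "nat \<Rightarrow> nat \<Rightarrow> real \<Rightarrow> real" where
  "up p N x = real N * (x ^ p - (x - 2 / real N) ^ p)"

definition um :: "nat \<Rightarrow> nat \<Rightarrow> real \<Rightarrow> real" where
  "um p N x = real N * ((x + 2 / real N) ^ p - x ^ p)"

definition nll :: "real \<Rightarrow> real \<Rightarrow> real \<Rightarrow> real \<Rightarrow> real" where
  "nll x u v t = (1 + x) / 2 * ln (1 + exp (- t * u)) + (1 - x) / 2 * ln (1 + exp (t * v))"

abbreviation pnll :: "nat \<Rightarrow> nat \<Rightarrow> real \<Rightarrow> real \<Rightarrow> real" where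
  "pnll p N x \<equiv> nll x (up p N x) (um p N x)"

lemma mag_flip:
  assumes "i < N"
  shows "mag N (X(i := - X i)) = mag N X - 2 * X i / real N"
proof -
  have "(\<Sum>j<N. (X(i := - X i)) j) = (\<Sum>j<N. X j - (if j = i then 2 * X i else 0))"
    by (intro sum.cong) auto
  also have "\<dots> = (\<Sum>j<N. X j) - 2 * X i"
    using assms by (simp add: sum_subtractf)
  finally show ?thesis
    by (simp only: mag_def diff_divide_distrib)
qed

text \<open>The prefactors (1 + X_i) / 2 and (1 - X_i) / 2 select the case of the spin while keeping
  the exponent affine in X_i, so that its sum over i depends on the magnetization only.\<close>

lemma cond_prob_eq:
  assumes X: "X \<in> config_space N" and i: "i < N"
  shows "cond_prob \<beta> p N X i = exp (- ((1 + X i) / 2 * ln (1 + exp (- \<beta> * up p N (mag N X)))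
      + (1 - X i) / 2 * ln (1 + exp (\<beta> * um p N (mag N X)))))"
proof -
  have N: "1 \<le> N" using i by simp
  let ?x = "mag N X"
  have frac: "exp a / (exp a + exp b) = exp (- ln (1 + exp (b - a)))" for a b :: real
  proof -
    have "0 < exp a + exp b" by (simp add: add_pos_pos)
    moreover have "1 + exp (b - a) = (exp a + exp b) / exp a"
      by (simp add: exp_diff add_divide_distrib)
    ultimately show ?thesis by (simp add: exp_minus)
  qed
  have "cond_prob \<beta> p N X i = exp (- ln (1 + exp (hamil \<beta> p N (X(i := - X i)) - hamil \<beta> p N X)))"
    using Zk_pos[of \<beta> p N] unfolding cond_prob_def cw_prob_eq[OF N] frac[symmetric]
    by (simp flip: add_divide_distrib)
  also have "hamil \<beta> p N (X(i := - X i)) - hamil \<beta> p N X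
      = \<beta> * real N * ((?x - 2 * X i / real N) ^ p - ?x ^ p)"
    using i unfolding hamil_eq[OF N] by (simp add: mag_flip algebra_simps)
  finally have *: "cond_prob \<beta> p N X i
      = exp (- ln (1 + exp (\<beta> * real N * ((?x - 2 * X i / real N) ^ p - ?x ^ p))))" .
  from config_space_values[OF X i] show ?thesis
    unfolding * by (elim disjE) (simp_all add: up_def um_def algebra_simps)
qed

lemma pseudolik_eq:
  assumes X: "X \<in> config_space N" and N: "1 \<le> N"
  shows "pseudolik \<beta> p N X = exp (- real N * pnll p N (mag N X) \<beta>)"
proof -
  define A where "A = ln (1 + exp (- \<beta> * up p N (mag N X)))"
  define B where "B = ln (1 + exp (\<beta> * um p N (mag N X)))"
  have "pseudolik \<beta> p N X = exp (\<Sum>i<N. - ((1 + X i) / 2 * A + (1 - X i) / 2 * B))"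
    unfolding pseudolik_def using cond_prob_eq[OF X] by (simp add: exp_sum A_def B_def)
  also have "(\<Sum>i<N. - ((1 + X i) / 2 * A + (1 - X i) / 2 * B))
      = (\<Sum>i<N. - (A + B) / 2 + X i * ((B - A) / 2))"
    by (intro sum.cong refl) (simp add: field_simps)
  also have "\<dots> = real N * (- (A + B) / 2) + (\<Sum>i<N. X i) * ((B - A) / 2)"
    by (simp only: sum.distrib sum_distrib_right[symmetric]) simp
  also have "(\<Sum>i<N. X i) = real N * mag N X"
    using N by (simp add: mag_def)
  also have "real N * (- (A + B) / 2) + real N * mag N X * ((B - A) / 2)
      = - real N * pnll p N (mag N X) \<beta>"
    unfolding nll_def A_def[symmetric] B_def[symmetric] by (simp add: field_simps)
  finally show ?thesis .
qed

lemma is_MPLE_eq: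
  assumes "X \<in> config_space N" "1 \<le> N"
  shows "is_MPLE p N X b \<longleftrightarrow> (\<forall>t. pnll p N (mag N X) b \<le> pnll p N (mag N X) t)"
  using assms by (simp add: is_MPLE_def pseudolik_eq)

text \<open>For even p the map x to -x interchanges the two terms of \<open>nll\<close>, as it swaps
  flips of up and down spins. Every minimizer at x is therefore one at the folded
  magnetization.\<close>

lemma pnll_theta: "pnll p N (theta p x) = pnll p N x"
proof -
  have "pnll p N (- x) = pnll p N x" if "even p"
  proof -
    have "up p N (- x) = - um p N x" "um p N (- x) = - up p N x"
      using that power_minus_even[of p "x + 2 / real N"] power_minus_even[of p "x - 2 / real N"]
      by (simp_all add: up_def um_def algebra_simps)
    then show ?thesis
      by (intro ext) (simp add: nll_def)
  qed
  then show ?thesis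
    by (auto simp: theta_def abs_if)
qed

text \<open>Minus the derivative of ln (1 + exp (- s w)) in s, that is, w times a logistic function
  of s w.\<close>

definition psi :: "real \<Rightarrow> real \<Rightarrow> real" where
  "psi s w = w / (1 + exp (s * w))"

lemma one_plus_exp_pos: "0 < 1 + exp a" for a :: real
  by (simp add: add_pos_pos)

lemma one_plus_exp_nz [simp]: "1 + exp a \<noteq> 0" for a :: real
  using one_plus_exp_pos[of a] by linarith

lemma nll_has_derivative:
  "(nll x u v has_real_derivative (1 - x) / 2 * psi (- t) v - (1 + x) / 2 * psi t u) (at t)"
proof -
  have e: "exp a / (1 + exp a) = 1 / (1 + exp (- a))" for a :: real
    by (simp add: exp_minus field_simps)
  have 1: "((\<lambda>t. ln (1 + exp (- t * u))) has_real_derivative - psi t u) (at t)"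
  proof -
    have "((\<lambda>t. ln (1 + exp (- t * u))) has_real_derivative
        1 / (1 + exp (- t * u)) * (0 + exp (- t * u) * (- 1 * u))) (at t)"
      by (intro DERIV_ln_divide[THEN DERIV_chain2] DERIV_add DERIV_const DERIV_fun_exp
          DERIV_cmult_right DERIV_minus DERIV_ident one_plus_exp_pos)
    also have "1 / (1 + exp (- t * u)) * (0 + exp (- t * u) * (- 1 * u)) = - psi t u"
      using e[of "- t * u"] by (simp add: psi_def divide_inverse algebra_simps)
    finally show ?thesis .
  qed
  have 2: "((\<lambda>t. ln (1 + exp (t * v))) has_real_derivative psi (- t) v) (at t)"
  proof -
    have "((\<lambda>t. ln (1 + exp (t * v))) has_real_derivative
        1 / (1 + exp (t * v)) * (0 + exp (t * v) * (1 * v))) (at t)"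
      by (intro DERIV_ln_divide[THEN DERIV_chain2] DERIV_add DERIV_const DERIV_fun_exp
          DERIV_cmult_right DERIV_ident one_plus_exp_pos)
    also have "1 / (1 + exp (t * v)) * (0 + exp (t * v) * (1 * v)) = psi (- t) v"
      using e[of "t * v"] by (simp add: psi_def divide_inverse algebra_simps)
    finally show ?thesis .
  qed
  have "((\<lambda>t. (1 + x) / 2 * ln (1 + exp (- t * u)) + (1 - x) / 2 * ln (1 + exp (t * v)))
      has_real_derivative (1 + x) / 2 * (- psi t u) + (1 - x) / 2 * psi (- t) v) (at t)"
    by (intro DERIV_add DERIV_cmult 1 2)
  moreover have "(1 + x) / 2 * (- psi t u) + (1 - x) / 2 * psi (- t) v
      = (1 - x) / 2 * psi (- t) v - (1 + x) / 2 * psi t u"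
    by simp
  ultimately show ?thesis
    by (simp only: nll_def[abs_def])
qed

lemma psi_antimono: "0 < w \<Longrightarrow> s < t \<Longrightarrow> psi t w < psi s w"
  unfolding psi_def by (intro divide_strict_left_mono mult_pos_pos one_plus_exp_pos) auto

text \<open>The derivative in t is strictly increasing, since both u and v are positive and both
  prefactors are too. A sign change between t1 and t2 thus gives a minimizer and confines all
  minimizers.\<close>

lemma nll_minimizer:
  assumes x: "- 1 < x" "x < 1" and uv: "0 < u" "0 < v"
    and t: "t1 < t2"
    and neg: "(1 - x) / 2 * psi (- t1) v - (1 + x) / 2 * psi t1 u < 0"
    and pos: "0 < (1 - x) / 2 * psi (- t2) v - (1 + x) / 2 * psi t2 u"
  shows "\<exists>b. \<forall>t. nll x u v b \<le> nll x u v t"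
    and "(\<And>t. nll x u v b \<le> nll x u v t) \<Longrightarrow> b \<in> {t1..t2}"
proof -
  define d where "d t = (1 - x) / 2 * psi (- t) v - (1 + x) / 2 * psi t u" for t
  have D: "(nll x u v has_real_derivative d t) (at t)" for t
    unfolding d_def by (rule nll_has_derivative)
  have mono: "d s < d t" if "s < t" for s t
  proof -
    have "(1 - x) / 2 * psi (- s) v < (1 - x) / 2 * psi (- t) v"
      using x uv that by (intro mult_strict_left_mono psi_antimono) auto
    moreover have "(1 + x) / 2 * psi t u < (1 + x) / 2 * psi s u"
      using x uv that by (intro mult_strict_left_mono psi_antimono) auto
    ultimately show ?thesis unfolding d_def by linarith
  qed
  have "isCont d t" for t
    unfolding d_def psi_def by (intro continuous_intros one_plus_exp_nz)
  then have "\<exists>b\<ge>t1. b \<le> t2 \<and> d b = 0"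
    using neg pos t by (intro IVT) (auto simp only: d_def[symmetric] less_imp_le)
  then obtain b0 where b0: "d b0 = 0" by blast
  have "nll x u v b0 \<le> nll x u v t" for t
  proof -
    obtain s where s: "s \<in> {min b0 t..max b0 t}" "nll x u v t - nll x u v b0 = d s * (t - b0)"
      using MVT_abs[of b0 t "nll x u v" d] D by blast
    have "0 \<le> d s * (t - b0)"
    proof (cases "b0 \<le> t")
      case True
      then have "b0 \<le> s" using s by auto
      then have "0 \<le> d s" using mono[of b0 s] b0 by (cases "b0 = s") auto
      then show ?thesis using True by simp
    next
      case False
      then have "s \<le> b0" using s by auto
      then have "d s \<le> 0" using mono[of s b0] b0 by (cases "b0 = s") auto
      then show ?thesis using False by (simp add: mult_nonpos_nonpos)
    qed
    then show ?thesis using s by simp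
  qed
  then show "\<exists>b. \<forall>t. nll x u v b \<le> nll x u v t" by blast
  assume "\<And>t. nll x u v b \<le> nll x u v t"
  then have db: "d b = 0"
    by (intro DERIV_local_min[OF D zero_less_one]) auto
  have "d t1 < 0" "0 < d t2" using neg pos by (auto simp: d_def)
  then show "b \<in> {t1..t2}"
    using mono[of b t1] mono[of t2 b] db by fastforce
qed

text \<open>With q = 1 / (1 + exp (s w)) the derivative in w is q - s w q (1 - q), and q lies in
  [0, 1].\<close>

lemma psi_lipschitz:
  assumes "0 \<le> w" "w \<le> U" "0 \<le> w'" "w' \<le> U" "\<bar>s\<bar> \<le> B"
  shows "\<bar>psi s w - psi s w'\<bar> \<le> (1 + B * U) * \<bar>w - w'\<bar>"
proof -
  define f where "f w = 1 / (1 + exp (s * w)) - s * w * (1 / (1 + exp (s * w)) * (exp (s * w) / (1 + exp (s * w))))"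
    for w
  have D: "(psi s has_real_derivative f t) (at t)" for t
  proof -
    have "((\<lambda>w. 1 + exp (s * w)) has_real_derivative (0 + exp (s * t) * (s * 1))) (at t)"
      by (intro DERIV_add DERIV_const DERIV_fun_exp DERIV_cmult DERIV_ident)
    from DERIV_divide[OF DERIV_ident this one_plus_exp_nz]
    have "((\<lambda>w. w / (1 + exp (s * w))) has_real_derivative
       (1 * (1 + exp (s * t)) - t * (0 + exp (s * t) * (s * 1))) / ((1 + exp (s * t)) * (1 + exp (s * t)))) (at t)" .
    also have "(1 * (1 + exp (s * t)) - t * (0 + exp (s * t) * (s * 1))) / ((1 + exp (s * t)) * (1 + exp (s * t))) = f t"
      by (simp add: f_def diff_divide_distrib)
    finally show ?thesis by (simp add: psi_def[abs_def])
  qed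
  obtain t where t: "t \<in> {min w' w..max w' w}" "psi s w - psi s w' = f t * (w - w')"
    using MVT_abs[of w' w "psi s" f] D by blast
  have a: "1 / (1 + exp (s * t)) \<le> 1" "0 \<le> 1 / (1 + exp (s * t))"
      "exp (s * t) / (1 + exp (s * t)) \<le> 1" "0 \<le> exp (s * t) / (1 + exp (s * t))"
    using one_plus_exp_pos[of "s * t"] by (auto simp: divide_le_eq)
  have "\<bar>s * t\<bar> \<le> B * U"
    unfolding abs_mult using t assms by (intro mult_mono) auto
  have prod1: "1 / (1 + exp (s * t)) * (exp (s * t) / (1 + exp (s * t))) \<le> 1"
      "0 \<le> 1 / (1 + exp (s * t)) * (exp (s * t) / (1 + exp (s * t)))"
    using mult_mono[OF a(1) a(3)] a by (simp_all add: mult_nonneg_nonneg)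
  have "\<bar>s * t * (1 / (1 + exp (s * t)) * (exp (s * t) / (1 + exp (s * t))))\<bar> \<le> (B * U) * 1"
    unfolding abs_mult[of "s * t"] using prod1 \<open>\<bar>s * t\<bar> \<le> B * U\<close>
    by (intro mult_mono) auto
  then have "\<bar>f t\<bar> \<le> 1 + B * U"
    using a unfolding f_def by linarith
  then show ?thesis
    unfolding t(2) abs_mult by (intro mult_right_mono) auto
qed

lemma up_um_approx:
  "\<exists>C>0. \<forall>N\<ge>1. \<forall>x\<in>{0..1}. \<bar>up p N x - 2 * (real p * x ^ (p - 1))\<bar> \<le> C / real N \<and>
     \<bar>um p N x - 2 * (real p * x ^ (p - 1))\<bar> \<le> C / real N"
proof -
  \<comment> \<open>The interval contains x - 2 / N and x + 2 / N for all x in [0, 1] and N \<ge>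
    1.\<close>
  have "continuous_on {-3..3} (\<lambda>x::real. real p * (real (p - 1) * x ^ (p - 2)))"
    by (intro continuous_intros)
  then obtain M where M: "0 < M" "\<forall>x\<in>{-3..3}. \<bar>real p * (real (p - 1) * x ^ (p - 2))\<bar> \<le> M"
    using compact_bound by blast
  have T: "\<bar>y ^ p - x ^ p - real p * x ^ (p - 1) * (y - x)\<bar> \<le> M * (y - x)\<^sup>2"
    if "x \<in> {-3..3}" "y \<in> {-3..3}" for x y :: real
    by (rule taylor2_bound[of "-3" 3 "\<lambda>x. x ^ p" "\<lambda>x. real p * x ^ (p - 1)"
          "\<lambda>x. real p * (real (p - 1) * x ^ (p - 2))"])
       (use M that in \<open>auto intro!: derivative_eq_intros simp: numeral_2_eq_2\<close>)
  have "\<bar>up p N x - 2 * (real p * x ^ (p - 1))\<bar> \<le> 4 * M / real N \<and>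
     \<bar>um p N x - 2 * (real p * x ^ (p - 1))\<bar> \<le> 4 * M / real N"
    if N: "1 \<le> N" and x: "x \<in> {0..1}" for N :: nat and x :: real
  proof -
    define a where "a = real p * x ^ (p - 1)"
    define e where "e = 2 / real N"
    have e: "0 < e" "e \<le> 2" "real N * e = 2" using N by (auto simp: e_def divide_le_eq)
    have sc: "\<bar>real N * r\<bar> \<le> 4 * M / real N" if "\<bar>r\<bar> \<le> M * e\<^sup>2" for r
    proof -
      have "\<bar>real N * r\<bar> \<le> real N * (M * e\<^sup>2)"
        using that N by (simp add: abs_mult mult_left_mono)
      also have "\<dots> = 4 * M / real N"
        using N by (simp add: e_def power2_eq_square)
      finally show ?thesis .
    qed
    have "up p N x - 2 * a = real N * - ((x - e) ^ p - x ^ p - a * (x - e - x))"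
      using e by (simp add: up_def e_def[symmetric] algebra_simps)
    moreover have "um p N x - 2 * a = real N * ((x + e) ^ p - x ^ p - a * (x + e - x))"
      using e by (simp add: um_def e_def[symmetric] algebra_simps)
    moreover have "\<bar>- ((x - e) ^ p - x ^ p - a * (x - e - x))\<bar> \<le> M * e\<^sup>2"
      using T[of x "x - e"] x e by (simp add: a_def)
    moreover have "\<bar>(x + e) ^ p - x ^ p - a * (x + e - x)\<bar> \<le> M * e\<^sup>2"
      using T[of x "x + e"] x e by (simp add: a_def)
    ultimately show ?thesis
      unfolding a_def[symmetric] using sc by presburger
  qed
  then show ?thesis
    using M by (intro exI[of _ "4 * M"]) auto
qed

section \<open>Existence and location of the estimate near the maximizer\<close>

context supercritical
begin

text \<open>When u = v = 2 a, the score is a (1 - x) (exp (2 a t) - G) / (1 + exp (2 a t)) with G =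
  (1 + x) / (1 - x) = exp (2 a g), where g is \<open>gfun p x\<close>; so it vanishes at t = g.
  Displacing t by s moves it by at least a multiple of s, as exp y - 1 \<ge> y. The constant
  \<open>c\<close> takes the worst case of each factor over the interval.\<close>

lemma limit_score_bounds:
  assumes x: "x \<in> {lo..hi}" and s: "\<bar>s\<bar> \<le> 1" "0 < s" and B: "gfun p x + 1 \<le> B"
  defines "a \<equiv> real p * x ^ (p - 1)"
  defines "c \<equiv> 2 * (real p * lo ^ (p - 1))\<^sup>2 * (1 - hi) / (1 + exp (2 * real p * B))"
  shows "c * s \<le> (1 - x) / 2 * psi (- (gfun p x + s)) (2 * a) - (1 + x) / 2 * psi (gfun p x + s) (2 * a)"
    and "(1 - x) / 2 * psi (- (gfun p x - s)) (2 * a) - (1 + x) / 2 * psi (gfun p x - s) (2 * a) \<le> - (c * s)"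
proof -
  have x0: "0 < x" "x < 1" "lo \<le> x" "x \<le> hi" using in_lo_hi[OF x] x by auto
  have a: "real p * lo ^ (p - 1) \<le> a" "a \<le> real p" "0 < a"
    unfolding a_def using x0 lo_hi p3
    by (auto intro!: mult_left_mono power_mono mult_left_le power_le_one)
  have la: "0 < real p * lo ^ (p - 1)" using lo_hi p3 by simp
  have artpos: "0 < artanh x" using artanh_strict_mono[of 0 x] x0 by simp
  have g: "gfun p x * a = artanh x" "0 < gfun p x"
    using a artpos by (auto simp: gfun_def a_def)
  define G where "G = exp (2 * a * gfun p x)"
  have G: "G = (1 + x) / (1 - x)"
    using g x0 by (simp add: G_def artanh_def mult_ac)
  have G1: "1 \<le> G" using x0 by (simp add: G field_simps)
  have score: "(1 - x) / 2 * psi (- t) (2 * a) - (1 + x) / 2 * psi t (2 * a)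
      = a * (1 - x) * ((exp (2 * a * t) - G) / (1 + exp (2 * a * t)))" for t
  proof -
    define E where "E = exp (2 * a * t)"
    have E: "0 < E" "exp (- t * (2 * a)) = 1 / E" "exp (t * (2 * a)) = E"
      by (simp_all add: E_def exp_minus mult_ac inverse_eq_divide)
    have "2 * a / (1 + 1 / E) = 2 * a * E / (1 + E)"
      using E by (simp add: field_simps)
    then have "(1 - x) / 2 * psi (- t) (2 * a) - (1 + x) / 2 * psi t (2 * a)
        = (1 - x) / 2 * (2 * a * E / (1 + E)) - (1 + x) / 2 * (2 * a / (1 + E))"
      unfolding psi_def E by simp
    also have "\<dots> = a * ((1 - x) * E - (1 + x)) / (1 + E)"
    proof -
      have "(1 - x) / 2 * (2 * a * E / D) - (1 + x) / 2 * (2 * a / D) = a * ((1 - x) * E - (1 + x)) / D"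
        for D
        by (simp add: diff_divide_distrib right_diff_distrib) (simp add: algebra_simps)
      then show ?thesis .
    qed
    also have "\<dots> = a * ((1 - x) * E - (1 - x) * G) / (1 + E)" using x0 by (simp add: G)
    also have "\<dots> = a * (1 - x) * ((E - G) / (1 + E))" by (simp add: algebra_simps)
    finally show ?thesis unfolding E_def .
  qed
  define K where "K = 1 + exp (2 * real p * B)"
  have K: "0 < K" unfolding K_def by (rule one_plus_exp_pos)
  have cle: "c * s \<le> a * (1 - x) * (2 * a * s / K)"
  proof -
    have "(real p * lo ^ (p - 1))\<^sup>2 * (1 - hi) \<le> a\<^sup>2 * (1 - x)"
      using a la x0 lo_hi by (intro mult_mono power_mono) auto
    then have "(real p * lo ^ (p - 1))\<^sup>2 * (1 - hi) * (2 * s / K) \<le> a\<^sup>2 * (1 - x) * (2 * s / K)"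
      using s K by (intro mult_right_mono) auto
    then show ?thesis
      unfolding c_def K_def[symmetric] by (simp add: power2_eq_square mult_ac)
  qed
  have "2 * a * s \<le> exp (2 * a * s) - 1"
    using exp_ge_add_one_self[of "2 * a * s"] by linarith
  note e1 = this
  have KB: "1 + exp (2 * a * t) \<le> K" if "t \<le> B" "0 \<le> B" for t
  proof -
    have "2 * a * t \<le> 2 * a * B" using that a by simp
    also have "\<dots> \<le> 2 * real p * B" using that a by (intro mult_right_mono) auto
    finally show ?thesis by (simp add: K_def)
  qed
  have 1: "2 * a * s / K \<le> (exp (2 * a * (gfun p x + s)) - G) / (1 + exp (2 * a * (gfun p x + s)))"
  proof (rule frac_le)
    have "1 * (exp (2 * a * s) - 1) \<le> G * (exp (2 * a * s) - 1)"
      using G1 e1 a s by (intro mult_right_mono) (auto intro: order_trans[rotated])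
    moreover have "exp (2 * a * (gfun p x + s)) - G = G * (exp (2 * a * s) - 1)"
      by (simp add: G_def algebra_simps exp_add)
    ultimately show "2 * a * s \<le> exp (2 * a * (gfun p x + s)) - G"
      using e1 by (metis mult_1 order_trans)
    show "0 \<le> exp (2 * a * (gfun p x + s)) - G"
      unfolding G_def using a s by simp
    show "1 + exp (2 * a * (gfun p x + s)) \<le> K"
      using B g s by (intro KB) auto
  qed (rule one_plus_exp_pos)
  have 2: "2 * a * s / K \<le> (G - exp (2 * a * (gfun p x - s))) / (1 + exp (2 * a * (gfun p x - s)))"
  proof -
    define E where "E = exp (2 * a * (gfun p x - s))"
    have "G - E = E * (exp (2 * a * s) - 1)"
      by (simp add: G_def E_def algebra_simps flip: exp_add)
    \<comment> \<open>Dividing by \<open>E\<close> makes the denominator 1 + exp (2 a (s - g)),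
      which \<open>K\<close> bounds as well.\<close>
    then have "(G - E) / (1 + E) = (exp (2 * a * s) - 1) / (1 + 1 / E)"
      by (simp add: E_def field_simps)
    moreover have "2 * a * s / K \<le> (exp (2 * a * s) - 1) / (1 + 1 / E)"
    proof (rule frac_le[OF _ e1])
      have "1 / E = exp (2 * a * (s - gfun p x))"
        by (simp add: E_def exp_minus[symmetric] inverse_eq_divide[symmetric] algebra_simps)
      then show "1 + 1 / E \<le> K"
        using B g s KB[of "s - gfun p x"] by auto
      show "0 < 1 + 1 / E" by (simp add: E_def add_pos_pos)
      show "0 \<le> exp (2 * a * s) - 1" using a s by simp
    qed
    ultimately show ?thesis unfolding E_def by simp
  qed
  have ax: "0 \<le> a * (1 - x)" using a x0 by simp
  show "c * s \<le> (1 - x) / 2 * psi (- (gfun p x + s)) (2 * a) - (1 + x) / 2 * psi (gfun p x + s) (2 * a)"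
    unfolding score using cle mult_left_mono[OF 1 ax] by linarith
  have "(exp (2 * a * (gfun p x - s)) - G) / (1 + exp (2 * a * (gfun p x - s))) =
     - ((G - exp (2 * a * (gfun p x - s))) / (1 + exp (2 * a * (gfun p x - s))))"
    by (simp add: minus_divide_left)
  then show "(1 - x) / 2 * psi (- (gfun p x - s)) (2 * a) - (1 + x) / 2 * psi (gfun p x - s) (2 * a) \<le> - (c * s)"
    unfolding score using cle mult_left_mono[OF 2 ax] by simp
qed

text \<open>Replacing u and v by their common limit 2 a changes the score by at most L / N, while at
  distance s from its zero the limiting score has size at least c s. With s = K / N and c K > L the
  true score still changes sign across the interval.\<close>

lemma minimizer_near_gfun:
  "\<exists>K>0. \<forall>\<^sub>F N in sequentially. \<forall>x\<in>{lo..hi}. (\<exists>b. \<forall>t. pnll p N x b \<le> pnll p N x t) \<and>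
     (\<forall>b. (\<forall>t. pnll p N x b \<le> pnll p N x t) \<longrightarrow> \<bar>b - gfun p x\<bar> \<le> K / real N)"
proof -
  obtain M where M: "0 < M" "\<forall>x\<in>{lo..hi}. \<bar>gfun p x - \<beta> - kap * (x - m)\<bar> \<le> M * (x - m)\<^sup>2"
    using gfun_taylor by blast
  \<comment> \<open>Bounds g + 1: on the interval |x - m| \<le> 1, so each Taylor term is at most
    its coefficient.\<close>
  define B where "B = \<beta> + kap + M + 1"
  have B0: "0 < B" using beta_pos kap_pos M by (simp add: B_def)
  have gB: "gfun p x + 1 \<le> B" if "x \<in> {lo..hi}" for x
  proof -
    have "\<bar>x - m\<bar> \<le> 1" using that lo_hi by auto
    then have "(x - m)\<^sup>2 \<le> 1" using abs_square_le_1 by blast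
    then have "M * (x - m)\<^sup>2 \<le> M" "kap * (x - m) \<le> kap"
      using M kap_pos \<open>\<bar>x - m\<bar> \<le> 1\<close> by (auto intro!: mult_left_le)
    then show ?thesis using M(2)[rule_format, OF that] unfolding B_def by linarith
  qed
  have g0: "0 < gfun p x" if "x \<in> {lo..hi}" for x
    using in_lo_hi[OF that] artanh_strict_mono[of 0 x] p3 by (simp add: gfun_def)
  obtain C where C: "0 < C" "\<And>N x. 1 \<le> N \<Longrightarrow> x \<in> {0..1} \<Longrightarrow>
      \<bar>up p N x - 2 * (real p * x ^ (p - 1))\<bar> \<le> C / real N \<and>
      \<bar>um p N x - 2 * (real p * x ^ (p - 1))\<bar> \<le> C / real N"
    using up_um_approx[of p] by blast
  define U where "U = 2 * real p + C"
  define c where "c = 2 * (real p * lo ^ (p - 1))\<^sup>2 * (1 - hi) / (1 + exp (2 * real p * B))"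
  have c: "0 < c"
    unfolding c_def using lo_hi p3 by (intro divide_pos_pos mult_pos_pos one_plus_exp_pos) auto
  define L where "L = (1 + B * U) * C"
  have L: "0 < L" using B0 C p3 by (simp add: L_def U_def add_pos_pos)
  define K where "K = L / c + 1"
  have K: "0 < K" "L < c * K" using L c by (auto simp: K_def field_simps add_pos_pos)
  \<comment> \<open>A lower bound for a on the interval. Once C / N < b0, both u and v are positive,
    as \<open>nll_minimizer\<close> demands.\<close>
  define b0 where "b0 = real p * lo ^ (p - 1)"
  have b0: "0 < b0" using lo_hi p3 by (simp add: b0_def)
  have "\<forall>\<^sub>F N in sequentially. real N > max 1 (max K (C / b0))"
    using filterlim_real_sequentially unfolding filterlim_at_top_dense by blast
  then have "\<forall>\<^sub>F N in sequentially. \<forall>x\<in>{lo..hi}. (\<exists>b. \<forall>t. pnll p N x b \<le> pnll p N x t) \<and>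
     (\<forall>b. (\<forall>t. pnll p N x b \<le> pnll p N x t) \<longrightarrow> \<bar>b - gfun p x\<bar> \<le> K / real N)"
  proof (eventually_elim, intro ballI)
    fix N :: nat and x assume N: "real N > max 1 (max K (C / b0))" and x: "x \<in> {lo..hi}"
    define a where "a = real p * x ^ (p - 1)"
    define u where "u = up p N x"
    define v where "v = um p N x"
    have N1: "1 \<le> N" "0 < real N" "K / real N \<le> 1" "C / real N < b0" "C / real N \<le> C"
      using N K C b0 by (auto simp: field_simps)
    have x0: "0 < x" "x < 1" "lo \<le> x" "x \<le> hi" using in_lo_hi[OF x] x by auto
    have uv: "\<bar>u - 2 * a\<bar> \<le> C / real N" "\<bar>v - 2 * a\<bar> \<le> C / real N"
      using C(2)[OF N1(1), of x] x0 by (auto simp: u_def v_def a_def)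
    have a: "b0 \<le> a" "a \<le> real p"
      unfolding a_def b0_def using x0 lo_hi
      by (auto intro!: mult_left_mono power_mono mult_left_le power_le_one)
    have rng: "0 < u" "u \<le> U" "0 < v" "v \<le> U" "0 \<le> 2 * a" "2 * a \<le> U"
      using uv a b0 N1 C unfolding U_def by linarith+
    define s where "s = K / real N"
    have s: "0 < s" "s \<le> 1" "\<bar>s\<bar> \<le> 1" using K N1 by (auto simp: s_def)
    have approx: "\<bar>((1 - x) / 2 * psi (- t) v - (1 + x) / 2 * psi t u)
        - ((1 - x) / 2 * psi (- t) (2 * a) - (1 + x) / 2 * psi t (2 * a))\<bar> \<le> L / real N"
      if t: "\<bar>t\<bar> \<le> B" for t
    proof -
      have BU: "0 \<le> 1 + B * U" using B0 rng by (simp add: add_nonneg_nonneg)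
      have 1: "\<bar>psi (- t) v - psi (- t) (2 * a)\<bar> \<le> L / real N"
        using psi_lipschitz[of v U "2 * a" "- t" B] rng t mult_left_mono[OF uv(2) BU]
        by (simp add: L_def)
      have 2: "\<bar>psi t u - psi t (2 * a)\<bar> \<le> L / real N"
        using psi_lipschitz[of u U "2 * a" t B] rng t mult_left_mono[OF uv(1) BU]
        by (simp add: L_def)
      have eq: "((1 - x) / 2 * psi (- t) v - (1 + x) / 2 * psi t u)
        - ((1 - x) / 2 * psi (- t) (2 * a) - (1 + x) / 2 * psi t (2 * a))
        = (1 - x) / 2 * (psi (- t) v - psi (- t) (2 * a)) - (1 + x) / 2 * (psi t u - psi t (2 * a))"
        by (simp add: algebra_simps)
      have "\<bar>(1 - x) / 2 * (psi (- t) v - psi (- t) (2 * a))\<bar> \<le> (1 - x) / 2 * (L / real N)"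
        unfolding abs_mult using x0 1 by (intro mult_mono) auto
      moreover have "\<bar>(1 + x) / 2 * (psi t u - psi t (2 * a))\<bar> \<le> (1 + x) / 2 * (L / real N)"
        unfolding abs_mult using x0 2 by (intro mult_mono) auto
      moreover have "(1 - x) / 2 * y + (1 + x) / 2 * y = y" for y
        by (simp add: field_simps)
      note this[of "L / real N"]
      ultimately show ?thesis unfolding eq by linarith
    qed
    have Lc: "L / real N < c * s"
      using K N1 by (simp add: s_def divide_strict_right_mono)
    have tB: "\<bar>gfun p x + s\<bar> \<le> B" "\<bar>gfun p x - s\<bar> \<le> B"
      using gB[OF x] g0[OF x] s by auto
    have pos: "0 < (1 - x) / 2 * psi (- (gfun p x + s)) v - (1 + x) / 2 * psi (gfun p x + s) u"
      using approx[OF tB(1)] limit_score_bounds(1)[OF x s(3) s(1) gB[OF x]] Lc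
      unfolding a_def[symmetric] c_def[symmetric] by linarith
    have neg: "(1 - x) / 2 * psi (- (gfun p x - s)) v - (1 + x) / 2 * psi (gfun p x - s) u < 0"
      using approx[OF tB(2)] limit_score_bounds(2)[OF x s(3) s(1) gB[OF x]] Lc
      unfolding a_def[symmetric] c_def[symmetric] by linarith
    have lt: "gfun p x - s < gfun p x + s" "- 1 < x" using s x0 by auto
    have "\<exists>b. \<forall>t. nll x u v b \<le> nll x u v t"
      by (rule nll_minimizer(1)[OF lt(2) x0(2) rng(1,3) lt(1) neg pos])
    moreover have "\<bar>b - gfun p x\<bar> \<le> K / real N" if "\<forall>t. nll x u v b \<le> nll x u v t" for b
      using nll_minimizer(2)[OF lt(2) x0(2) rng(1,3) lt(1) neg pos, of b] that
      unfolding s_def by auto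
    ultimately show "(\<exists>b. \<forall>t. pnll p N x b \<le> pnll p N x t) \<and>
       (\<forall>b. (\<forall>t. pnll p N x b \<le> pnll p N x t) \<longrightarrow> \<bar>b - gfun p x\<bar> \<le> K / real N)"
      unfolding u_def v_def by blast
  qed
  then show ?thesis using K by blast
qed

lemma MPLE_linearization:
  assumes bhat: "\<And>N X. X \<in> config_space N \<Longrightarrow> \<exists>b. is_MPLE p N X b \<Longrightarrow> is_MPLE p N X (bhat N X)"
  shows "\<exists>C>0. \<forall>\<^sub>F N in sequentially. \<forall>X\<in>config_space N. theta p (mag N X) \<in> {lo..hi} \<longrightarrow>
    \<bar>bhat N X - \<beta> - kap * (theta p (mag N X) - m)\<bar> \<le> C * ((theta p (mag N X) - m)\<^sup>2 + 1 / real N)"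
proof -
  obtain M where M: "0 < M" "\<And>x. x \<in> {lo..hi} \<Longrightarrow> \<bar>gfun p x - \<beta> - kap * (x - m)\<bar> \<le> M * (x - m)\<^sup>2"
    using gfun_taylor by blast
  obtain K where K: "0 < K" and ev: "\<forall>\<^sub>F N in sequentially. \<forall>x\<in>{lo..hi}. (\<exists>b. \<forall>t. pnll p N x b \<le> pnll p N x t) \<and>
     (\<forall>b. (\<forall>t. pnll p N x b \<le> pnll p N x t) \<longrightarrow> \<bar>b - gfun p x\<bar> \<le> K / real N)"
    using minimizer_near_gfun by blast
  have "\<forall>\<^sub>F N in sequentially. \<forall>X\<in>config_space N. theta p (mag N X) \<in> {lo..hi} \<longrightarrow>
    \<bar>bhat N X - \<beta> - kap * (theta p (mag N X) - m)\<bar> \<le> (M + K) * ((theta p (mag N X) - m)\<^sup>2 + 1 / real N)"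
    using ev eventually_ge_at_top[of 1]
  proof (eventually_elim, intro ballI impI)
    fix N :: nat and X
    assume *: "\<forall>x\<in>{lo..hi}. (\<exists>b. \<forall>t. pnll p N x b \<le> pnll p N x t) \<and>
       (\<forall>b. (\<forall>t. pnll p N x b \<le> pnll p N x t) \<longrightarrow> \<bar>b - gfun p x\<bar> \<le> K / real N)"
      and N: "1 \<le> N" and X: "X \<in> config_space N" and \<theta>: "theta p (mag N X) \<in> {lo..hi}"
    let ?x = "theta p (mag N X)"
    have "is_MPLE p N X b \<longleftrightarrow> (\<forall>t. pnll p N ?x b \<le> pnll p N ?x t)" for b
      by (simp add: is_MPLE_eq[OF X N] pnll_theta)
    then have "\<bar>bhat N X - gfun p ?x\<bar> \<le> K / real N"
      using * \<theta> bhat[OF X] by blast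
    moreover have "0 \<le> K * (?x - m)\<^sup>2" "0 \<le> M / real N"
      using K M by auto
    moreover have "(M + K) * ((?x - m)\<^sup>2 + 1 / real N) = M * (?x - m)\<^sup>2 + K / real N + K * (?x - m)\<^sup>2 + M / real N"
      by (simp add: algebra_simps add_divide_distrib)
    ultimately show "\<bar>bhat N X - \<beta> - kap * (?x - m)\<bar> \<le> (M + K) * ((?x - m)\<^sup>2 + 1 / real N)"
      using M(2)[OF \<theta>] by linarith
  qed
  then show ?thesis using M K by (intro exI[of _ "M + K"]) auto
qed

end

section \<open>A local limit theorem near the maximizer\<close>

text \<open>One majorant for the powers 0, 1 and 3 of |z| that occur in the error of the
  log-weights.\<close>

lemma one_plus_square_powers:
  fixes z :: real
  shows "1 \<le> (1 + z\<^sup>2)\<^sup>2" "\<bar>z\<bar> \<le> (1 + z\<^sup>2)\<^sup>2" "\<bar>z\<bar> ^ 3 \<le> (1 + z\<^sup>2)\<^sup>2"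
proof -
  have "(\<bar>z\<bar> - 1)\<^sup>2 = z\<^sup>2 - 2 * \<bar>z\<bar> + 1"
    by (simp add: power2_diff)
  then have z1: "\<bar>z\<bar> \<le> 1 + z\<^sup>2"
    using zero_le_power2[of "\<bar>z\<bar> - 1"] zero_le_power2[of z] by linarith
  have "\<bar>z\<bar> * 1 \<le> (1 + z\<^sup>2) * (1 + z\<^sup>2)"
    using z1 by (intro mult_mono) auto
  then show "\<bar>z\<bar> \<le> (1 + z\<^sup>2)\<^sup>2"
    by (simp only: power2_eq_square[of "1 + z\<^sup>2"] mult_1_right)
  show "1 \<le> (1 + z\<^sup>2)\<^sup>2" by (intro one_le_power) auto
  have "\<bar>z\<bar> * \<bar>z\<bar>\<^sup>2 \<le> (1 + z\<^sup>2) * (1 + z\<^sup>2)"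
    using z1 by (intro mult_mono) auto
  then show "\<bar>z\<bar> ^ 3 \<le> (1 + z\<^sup>2)\<^sup>2"
    by (simp only: power2_eq_square[of "1 + z\<^sup>2"] power2_eq_square[of "\<bar>z\<bar>"] power3_eq_cube mult.assoc)
qed

context supercritical
begin

text \<open>The Taylor constant is fixed by choice so that the window radius \<open>del\<close> can
  be a constant shared by all later statements.\<close>

definition Mt :: real where
  "Mt = (SOME M. 0 < M \<and> (\<forall>x\<in>{lo..hi}. \<bar>H x - H m + lam / 2 * (x - m)\<^sup>2\<bar> \<le> M * \<bar>x - m\<bar> ^ 3))"

lemma Mt: "0 < Mt" "x \<in> {lo..hi} \<Longrightarrow> \<bar>H x - H m + lam / 2 * (x - m)\<^sup>2\<bar> \<le> Mt * \<bar>x - m\<bar> ^ 3"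
  using someI_ex[OF H_taylor[unfolded Bex_def]] unfolding Mt_def[symmetric] by blast+

text \<open>The last bound makes the cubic Taylor remainder at most half of the quadratic term: Mt
  d^3 \<le> lam d^2 / 4 for 0 \<le> d \<le> del. The others keep the window inside [lo, hi].\<close>

definition del :: real where
  "del = min (min (m - lo) (hi - m)) (lam / (4 * Mt))"

lemma del: "0 < del" "del < m" "del < 1" "\<bar>x - m\<bar> \<le> del \<Longrightarrow> x \<in> {lo..hi}" "4 * Mt * del \<le> lam"
proof -
  show "0 < del" using lo_hi lam_pos Mt by (auto simp: del_def)
  show "del < m" "del < 1" using lo_hi by (auto simp: del_def)
  show "\<bar>x - m\<bar> \<le> del \<Longrightarrow> x \<in> {lo..hi}" by (auto simp: del_def)
  have "del \<le> lam / (4 * Mt)" by (simp add: del_def)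
  then show "4 * Mt * del \<le> lam" using Mt(1) by (simp add: pos_le_divide_eq mult_ac)
qed

text \<open>The last index whose magnetization does not exceed m; its weight serves as reference for
  all others.\<close>

definition k0 :: "nat \<Rightarrow> nat" where
  "k0 N = nat \<lfloor>real N * (1 + m) / 2\<rfloor>"

lemma k0:
  assumes "1 \<le> N"
  shows "k0 N \<le> N" "m - 2 / real N < xk N (k0 N)" "xk N (k0 N) \<le> m" "\<bar>xk N (k0 N) - m\<bar> \<le> 2 / real N"
proof -
  have pos: "0 \<le> real N * (1 + m) / 2" using m_pos by simp
  have r: "real (k0 N) = of_int \<lfloor>real N * (1 + m) / 2\<rfloor>"
    unfolding k0_def using pos by simp
  have 1: "real (k0 N) \<le> real N * (1 + m) / 2" "real N * (1 + m) / 2 < real (k0 N) + 1"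
    unfolding r by linarith+
  have "2 * (real N * (1 + m) / 2 - 1) / real N < 2 * real (k0 N) / real N"
    using 1 assms by (intro divide_strict_right_mono) auto
  moreover have "2 * (real N * (1 + m) / 2 - 1) / real N = m + 1 - 2 / real N"
    using assms by (simp add: field_simps)
  ultimately show 2: "m - 2 / real N < xk N (k0 N)"
    by (simp add: xk_def)
  show 3: "xk N (k0 N) \<le> m"
    using 1 assms by (simp add: xk_def field_simps)
  from 2 3 show "\<bar>xk N (k0 N) - m\<bar> \<le> 2 / real N" by linarith
  have "real N * (1 + m) / 2 \<le> real N * (1 + 1) / 2"
    using m_less1 by (intro divide_right_mono mult_left_mono) auto
  then show "k0 N \<le> N" using 1 by simp
qed

definition zk :: "nat \<Rightarrow> nat \<Rightarrow> real" where
  "zk N k = kap * sqrt (real N) * (xk N k - m)"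

definition step :: "nat \<Rightarrow> real" where
  "step N = 2 * kap / sqrt (real N)"

lemma step_pos: "1 \<le> N \<Longrightarrow> 0 < step N"
  using kap_pos by (simp add: step_def)

lemma zk_Suc: "1 \<le> N \<Longrightarrow> zk N (Suc k) = zk N k + step N"
proof -
  assume N: "1 \<le> N"
  have "sqrt (real N) * (2 / real N) = 2 / sqrt (real N)"
    using N by (simp add: field_simps)
  then have "kap * (sqrt (real N) * (2 / real N)) = step N"
    by (simp add: step_def)
  then show ?thesis
    by (simp add: zk_def xk_Suc[OF N] algebra_simps)
qed

text \<open>Logarithmic error of the Gaussian approximation of the weights, relative to \<open>k0 N\<close>.\<close>

definition dev :: "nat \<Rightarrow> nat \<Rightarrow> real" where
  "dev N k = ln (vk \<beta> p N k) - ln (vk \<beta> p N (k0 N)) + (zk N k)\<^sup>2 / (2 * sig\<^sup>2)"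

lemma near_le: "1 \<le> N \<Longrightarrow> \<bar>xk N k - m\<bar> \<le> del \<Longrightarrow> k \<le> N"
proof -
  assume *: "1 \<le> N" "\<bar>xk N k - m\<bar> \<le> del"
  have "xk N k < 1" using del(4)[OF *(2)] lo_hi by auto
  then show ?thesis using *(1) by (simp add: xk_def field_simps)
qed

text \<open>The error splits into the increment of \<open>ak\<close> (\<open>T1\<close>), the cubic
  Taylor remainder at x (\<open>T2\<close>) and the offset of the reference point from m
  (\<open>T3\<close>). The first bound is small in N. The second is not, but it uses only half of
  the Gaussian exponent, so exp |dev| stays integrable against the density over the whole
  window.\<close>

lemma dev_bounds:
  "\<exists>C>0. \<forall>\<^sub>F N in sequentially. \<forall>k. \<bar>xk N k - m\<bar> \<le> del \<longrightarrow>
     \<bar>dev N k\<bar> \<le> C / sqrt (real N) * (1 + (zk N k)\<^sup>2)\<^sup>2 \<and> \<bar>dev N k\<bar> \<le> (zk N k)\<^sup>2 / (4 * sig\<^sup>2) + C"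
proof -
  define A where "A = 2 / (1 - hi\<^sup>2) + 1"
  have A: "0 < A"
    unfolding A_def using lo_hi one_minus_square_pos[of hi] by (intro add_pos_pos) auto
  define B where "B = 2 * lam + 4 * Mt"
  have B: "0 < B" using lam_pos Mt by (simp add: B_def)
  define C where "C = A / kap + 3 * A + Mt / kap ^ 3 + B"
  have C: "0 < C" using A B Mt kap_pos by (simp add: C_def add_pos_pos)
  have "\<forall>\<^sub>F N in sequentially. real N > max 2 (2 / del)"
    using filterlim_real_sequentially unfolding filterlim_at_top_dense by blast
  then have "\<forall>\<^sub>F N in sequentially. \<forall>k. \<bar>xk N k - m\<bar> \<le> del \<longrightarrow>
     \<bar>dev N k\<bar> \<le> C / sqrt (real N) * (1 + (zk N k)\<^sup>2)\<^sup>2 \<and> \<bar>dev N k\<bar> \<le> (zk N k)\<^sup>2 / (4 * sig\<^sup>2) + C"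
  proof (eventually_elim, intro allI impI)
    fix N k assume N: "real N > max 2 (2 / del)" and k: "\<bar>xk N k - m\<bar> \<le> del"
    have N1: "1 \<le> N" "0 < real N" "2 / real N \<le> 1" "2 / real N \<le> del"
      using N del(1) by (auto simp: field_simps)
    have "sqrt (real N) * 1 \<le> sqrt (real N) * sqrt (real N)"
      using N1 by (intro mult_left_mono) auto
    then have sN: "0 < sqrt (real N)" "1 / real N \<le> 1 / sqrt (real N)"
      using N1 by (auto intro!: divide_left_mono)
    define x where "x = xk N k"
    define x0 where "x0 = xk N (k0 N)"
    define d where "d = \<bar>x - m\<bar>"
    define z where "z = zk N k"
    have x0: "\<bar>x0 - m\<bar> \<le> 2 / real N" using k0(4)[OF N1(1)] by (simp add: x0_def)
    have xin: "x \<in> {lo..hi}" "x0 \<in> {lo..hi}"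
      using del(4)[of x] del(4)[of x0] k x0 N1 by (auto simp: x_def)
    have d: "0 \<le> d" "d \<le> del" using k by (auto simp: d_def x_def)
    have z: "\<bar>z\<bar> = kap * sqrt (real N) * d" "d = \<bar>z\<bar> / (kap * sqrt (real N))"
      using kap_pos N1 by (auto simp: z_def zk_def d_def x_def abs_mult)
    have z2: "z\<^sup>2 = kap\<^sup>2 * real N * d\<^sup>2"
      using N1 by (simp add: z_def zk_def d_def x_def power_mult_distrib)
    have zl: "z\<^sup>2 / (2 * sig\<^sup>2) = real N * (lam / 2 * d\<^sup>2)"
      using sig_pos unfolding z2 kap_sig by simp
    have zl4: "z\<^sup>2 / (4 * sig\<^sup>2) = real N * (lam / 4 * d\<^sup>2)"
      using sig_pos unfolding z2 kap_sig by simp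
    have kN: "k \<le> N" "k0 N \<le> N" using near_le N1 k k0 by auto
    define T1 where "T1 = ak N k - ak N (k0 N)"
    define T2 where "T2 = real N * (H x - H m + lam / 2 * d\<^sup>2)"
    define T3 where "T3 = real N * (H x0 - H m)"
    have dev: "dev N k = T1 + T2 - T3"
      unfolding dev_def z_def[symmetric] zl T1_def T2_def T3_def
      by (simp add: ln_vk kN x_def x0_def algebra_simps)
    have T1: "\<bar>T1\<bar> \<le> A * (d + 2 / real N)"
    proof -
      have "\<bar>T1\<bar> \<le> A * \<bar>x - x0\<bar>"
        unfolding T1_def A_def x_def x0_def using xin lo_hi
        by (intro ak_diff N1) (auto simp: x_def x0_def)
      also have "\<dots> \<le> A * (d + 2 / real N)"
        using A x0 by (intro mult_left_mono) (auto simp: d_def)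
      finally show ?thesis .
    qed
    have T2: "\<bar>T2\<bar> \<le> real N * (Mt * d ^ 3)"
      unfolding T2_def abs_mult using Mt(2)[OF xin(1)] N1 by (simp add: d_def)
    \<comment> \<open>The slope of H vanishes at m and the reference point is within 2 / N of it, so
      N times the difference is O(1 / N).\<close>
    have T3: "\<bar>T3\<bar> \<le> B / real N"
    proof -
      define e where "e = \<bar>x0 - m\<bar>"
      have e: "0 \<le> e" "e \<le> 2 / real N" "e \<le> 1" using x0 N1(3) by (simp_all only: e_def)
      have "\<bar>H x0 - H m\<bar> \<le> lam / 2 * e\<^sup>2 + Mt * e ^ 3"
      proof -
        have "\<bar>H x0 - H m + lam / 2 * e\<^sup>2\<bar> \<le> Mt * e ^ 3"
          using Mt(2)[OF xin(2)] by (simp add: e_def)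
        moreover have "0 \<le> lam / 2 * e\<^sup>2" using lam_pos by simp
        ultimately show ?thesis by linarith
      qed
      also have "Mt * e ^ 3 \<le> Mt * e\<^sup>2"
        using Mt e by (intro mult_left_mono power_decreasing) auto
      also have "lam / 2 * e\<^sup>2 + Mt * e\<^sup>2 = (lam / 2 + Mt) * e\<^sup>2" by (simp add: algebra_simps)
      also have "\<dots> \<le> (lam / 2 + Mt) * (2 / real N)\<^sup>2"
        using e lam_pos Mt by (intro mult_left_mono power_mono) auto
      finally have "real N * \<bar>H x0 - H m\<bar> \<le> real N * ((lam / 2 + Mt) * (2 / real N)\<^sup>2)"
        using N1 by (intro mult_left_mono) auto
      also have "\<dots> = B / real N"
        using N1 by (simp add: B_def power2_eq_square field_simps)
      finally show ?thesis using N1 by (simp add: T3_def abs_mult)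
    qed
    note p1 = one_plus_square_powers[of z]
    have "\<bar>dev N k\<bar> \<le> A * (d + 2 / real N) + real N * (Mt * d ^ 3) + B / real N"
      unfolding dev using T1 T2 T3 by linarith
    also have "\<dots> \<le> (A / kap * \<bar>z\<bar> + 2 * A * 1 + Mt / kap ^ 3 * \<bar>z\<bar> ^ 3 + B * 1) / sqrt (real N)"
    proof -
      have "A * d = A / kap * \<bar>z\<bar> / sqrt (real N)" by (simp add: z(2))
      moreover have "A * (2 / real N) \<le> 2 * A * 1 / sqrt (real N)"
        using mult_left_mono[OF sN(2), of "2 * A"] A by (simp add: mult.commute)
      moreover have "B / real N \<le> B * 1 / sqrt (real N)"
        using mult_left_mono[OF sN(2), of B] B by simp
      moreover have "real N * (Mt * d ^ 3) = Mt / kap ^ 3 * \<bar>z\<bar> ^ 3 / sqrt (real N)"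
      proof -
        have "real N = sqrt (real N) * sqrt (real N)" by simp
        then have "\<bar>z\<bar> ^ 3 = kap ^ 3 * (real N * sqrt (real N)) * d ^ 3"
          unfolding z(1) by (simp add: power_mult_distrib power3_eq_cube)
        then show ?thesis
          using kap_pos sN by (simp add: field_simps)
      qed
      ultimately show ?thesis
        unfolding add_divide_distrib distrib_left by linarith
    qed
    also have "\<dots> \<le> (A / kap * (1 + z\<^sup>2)\<^sup>2 + 2 * A * (1 + z\<^sup>2)\<^sup>2 + Mt / kap ^ 3 * (1 + z\<^sup>2)\<^sup>2 + B * (1 + z\<^sup>2)\<^sup>2) / sqrt (real N)"
      using A B Mt kap_pos sN by (intro divide_right_mono add_mono mult_left_mono p1) auto
    also have "\<dots> = (C - A) / sqrt (real N) * (1 + z\<^sup>2)\<^sup>2"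
      by (simp add: C_def algebra_simps)
    also have "\<dots> \<le> C / sqrt (real N) * (1 + z\<^sup>2)\<^sup>2"
      using A sN by (intro mult_right_mono divide_right_mono) auto
    finally have b1: "\<bar>dev N k\<bar> \<le> C / sqrt (real N) * (1 + z\<^sup>2)\<^sup>2" .
    have "real N * (Mt * d ^ 3) \<le> z\<^sup>2 / (4 * sig\<^sup>2)"
    proof -
      have "Mt * d ^ 3 = Mt * d * d\<^sup>2" by (simp add: power2_eq_square power3_eq_cube)
      also have "\<dots> \<le> lam / 4 * d\<^sup>2"
      proof (intro mult_right_mono)
        have "Mt * d \<le> Mt * del" using d Mt by (intro mult_left_mono) auto
        then show "Mt * d \<le> lam / 4" using del(5) by linarith
      qed simp
      finally show ?thesis unfolding zl4 using N1 by (intro mult_left_mono) auto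
    qed
    moreover have "A * (d + 2 / real N) \<le> A * 2"
      using A d N1 del(3) by (intro mult_left_mono) auto
    moreover have "B / real N \<le> B"
      using B N1 by (simp add: divide_le_eq mult_le_cancel_left1)
    moreover have "A * 2 + B \<le> C"
      using A Mt kap_pos by (simp add: C_def add_nonneg_nonneg)
    ultimately have b2: "\<bar>dev N k\<bar> \<le> z\<^sup>2 / (4 * sig\<^sup>2) + C"
      unfolding dev using T1 T2 T3 by linarith
    show "\<bar>dev N k\<bar> \<le> C / sqrt (real N) * (1 + (zk N k)\<^sup>2)\<^sup>2 \<and> \<bar>dev N k\<bar> \<le> (zk N k)\<^sup>2 / (4 * sig\<^sup>2) + C"
      using b1 b2 unfolding z_def by blast
  qed
  then show ?thesis using C by blast
qed

text \<open>The weight at \<open>k0\<close> divided by the Gaussian mass it should represent, cell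
  width times peak density. It plays the role of the partition function for one maximizer.\<close>

definition Wn :: "nat \<Rightarrow> real" where
  "Wn N = vk \<beta> p N (k0 N) * sqrt (2 * pi * sig\<^sup>2) / step N"

lemma Wn_pos: "1 \<le> N \<Longrightarrow> 0 < Wn N"
  unfolding Wn_def using vk_pos k0(1) step_pos sig_pos by simp

lemma vk_Wn:
  assumes "1 \<le> N" "k \<le> N"
  shows "vk \<beta> p N k / Wn N = step N * normal_density 0 sig (zk N k) * exp (dev N k)"
proof -
  have "exp (dev N k) = vk \<beta> p N k / vk \<beta> p N (k0 N) * exp ((zk N k)\<^sup>2 / (2 * sig\<^sup>2))"
    using vk_pos[OF assms(2)] vk_pos[OF k0(1)[OF assms(1)]]
    by (simp add: dev_def exp_add exp_diff)
  moreover have "normal_density 0 sig (zk N k) * exp ((zk N k)\<^sup>2 / (2 * sig\<^sup>2)) = 1 / sqrt (2 * pi * sig\<^sup>2)"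
    by (simp add: normal_density_def exp_minus)
  ultimately show ?thesis
    by (simp add: Wn_def mult_ac)
qed

text \<open>From y^2 \<le> 2 x^2 + 2 (x - y)^2. It allows the bound 1 / (1 + z^2) to be evaluated
  anywhere in a cell.\<close>

lemma one_plus_square_shift:
  fixes x y :: real
  assumes "\<bar>x - y\<bar> \<le> 1"
  shows "1 / (1 + x\<^sup>2) \<le> 3 / (1 + y\<^sup>2)"
proof -
  have "y\<^sup>2 \<le> 2 * x\<^sup>2 + 2 * (x - y)\<^sup>2"
    using zero_le_power2[of "2 * x - y"] by (simp add: power2_eq_square algebra_simps)
  moreover have "(x - y)\<^sup>2 \<le> 1" using assms abs_square_le_1 by blast
  moreover have "1 + b \<le> 3 * (1 + a)" if "b \<le> 2 * a + 2 * c" "c \<le> 1" "0 \<le> a" for a b c :: real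
    using that by argo
  ultimately have "1 + y\<^sup>2 \<le> 3 * (1 + x\<^sup>2)"
    using zero_le_power2[of x] by blast
  then show ?thesis by (simp add: divide_simps add_pos_nonneg add_nonneg_eq_0_iff)
qed

text \<open>Two errors per cell, the factor exp (dev) - 1 and the variation of the density across
  the cell, are each O(N^(-1/2)) / (1 + z^2). Multiplied by the cell width, this is comparable to an
  increment of arctan, so the bound can be summed over arbitrarily many cells.\<close>

lemma cell_bound:
  "\<exists>C>0. \<forall>\<^sub>F N in sequentially. \<forall>k. \<bar>xk N k - m\<bar> \<le> del \<longrightarrow>
     \<bar>vk \<beta> p N k / Wn N - (ncdf sig (zk N (Suc k)) - ncdf sig (zk N k))\<bar>
      \<le> C / sqrt (real N) * (arctan (zk N (Suc k)) - arctan (zk N k))"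
proof -
  obtain D where D: "0 < D" and ev: "\<forall>\<^sub>F N in sequentially. \<forall>k. \<bar>xk N k - m\<bar> \<le> del \<longrightarrow>
     \<bar>dev N k\<bar> \<le> D / sqrt (real N) * (1 + (zk N k)\<^sup>2)\<^sup>2 \<and> \<bar>dev N k\<bar> \<le> (zk N k)\<^sup>2 / (4 * sig\<^sup>2) + D"
    using dev_bounds by blast
  obtain P where P: "0 < P" "\<And>z. (1 + z\<^sup>2) ^ 3 \<le> P * exp (1 / (4 * sig\<^sup>2) * z\<^sup>2)"
    using poly_le_exp_square[of "1 / (4 * sig\<^sup>2)"] sig_pos by auto
  define c where "c = 1 / sqrt (2 * pi * sig\<^sup>2)"
  have c: "0 < c" using sig_pos by (simp add: c_def)
  have n_eq: "normal_density 0 sig z = c * exp (- z\<^sup>2 / (2 * sig\<^sup>2))" for z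
    by (simp add: normal_density_def c_def)
  have P': "(1 + z\<^sup>2)\<^sup>2 * exp (- z\<^sup>2 / (4 * sig\<^sup>2)) \<le> P / (1 + z\<^sup>2)" for z
  proof -
    have "(1 + z\<^sup>2)\<^sup>2 * (1 + z\<^sup>2) * exp (- z\<^sup>2 / (4 * sig\<^sup>2)) \<le> P * exp (1 / (4 * sig\<^sup>2) * z\<^sup>2) * exp (- z\<^sup>2 / (4 * sig\<^sup>2))"
      using P(2)[of z] by (intro mult_right_mono) (auto simp: power2_eq_square power3_eq_cube)
    also have "\<dots> = P" by (simp add: exp_minus)
    finally show ?thesis
      by (simp add: pos_le_divide_eq add_pos_nonneg mult_ac)
  qed
  have E1: "\<bar>z\<bar> * normal_density 0 sig z \<le> c * P / (1 + z\<^sup>2)" for z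
  proof -
    note 1 = one_plus_square_powers(2)[of z]
    have "- z\<^sup>2 / (2 * sig\<^sup>2) \<le> - z\<^sup>2 / (4 * sig\<^sup>2)"
      using sig_pos by (simp add: field_simps)
    then have "\<bar>z\<bar> * exp (- z\<^sup>2 / (2 * sig\<^sup>2)) \<le> (1 + z\<^sup>2)\<^sup>2 * exp (- z\<^sup>2 / (4 * sig\<^sup>2))"
      using 1 by (intro mult_mono) auto
    then have "\<bar>z\<bar> * exp (- z\<^sup>2 / (2 * sig\<^sup>2)) \<le> P / (1 + z\<^sup>2)"
      using P'[of z] by linarith
    then have "c * (\<bar>z\<bar> * exp (- z\<^sup>2 / (2 * sig\<^sup>2))) \<le> c * (P / (1 + z\<^sup>2))"
      using c by (intro mult_left_mono) auto
    then show ?thesis by (simp add: n_eq mult_ac)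
  qed
  define C1 where "C1 = c * D * exp D * P"
  define C2 where "C2 = c * P / sig\<^sup>2 * (2 * kap)"
  have C12: "0 < C1" "0 < C2" using c D P kap_pos sig_pos by (auto simp: C1_def C2_def)
  define C where "C = (C1 + C2) * 3"
  have C: "0 < C" using C12 by (simp add: C_def)
  have "\<forall>\<^sub>F N in sequentially. real N > max 1 (4 * kap\<^sup>2)"
    using filterlim_real_sequentially unfolding filterlim_at_top_dense by blast
  with ev have "\<forall>\<^sub>F N in sequentially. \<forall>k. \<bar>xk N k - m\<bar> \<le> del \<longrightarrow>
     \<bar>vk \<beta> p N k / Wn N - (ncdf sig (zk N (Suc k)) - ncdf sig (zk N k))\<bar>
      \<le> C / sqrt (real N) * (arctan (zk N (Suc k)) - arctan (zk N k))"
  proof (eventually_elim, intro allI impI)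
    fix N k assume N: "real N > max 1 (4 * kap\<^sup>2)" and k: "\<bar>xk N k - m\<bar> \<le> del"
      and *: "\<forall>k. \<bar>xk N k - m\<bar> \<le> del \<longrightarrow>
       \<bar>dev N k\<bar> \<le> D / sqrt (real N) * (1 + (zk N k)\<^sup>2)\<^sup>2 \<and> \<bar>dev N k\<bar> \<le> (zk N k)\<^sup>2 / (4 * sig\<^sup>2) + D"
    define z where "z = zk N k"
    define h where "h = step N"
    define e where "e = dev N k"
    have N1: "1 \<le> N" "0 < sqrt (real N)" using N by auto
    \<comment> \<open>N > 4 kap^2 makes a cell at most 1 wide, the range of
      \<open>one_plus_square_shift\<close>.\<close>
    have h: "0 < h" "h \<le> 1"
    proof -
      show "0 < h" unfolding h_def by (rule step_pos[OF N1(1)])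
      have "2 * kap \<le> sqrt (real N)"
        using N by (intro real_le_rsqrt) (simp add: power_mult_distrib)
      then show "h \<le> 1" using N1 by (simp add: h_def step_def divide_le_eq)
    qed
    have e: "\<bar>e\<bar> \<le> D / sqrt (real N) * (1 + z\<^sup>2)\<^sup>2" "\<bar>e\<bar> \<le> z\<^sup>2 / (4 * sig\<^sup>2) + D"
      using * k by (auto simp: e_def z_def)
    have v: "vk \<beta> p N k / Wn N = h * (normal_density 0 sig z * exp e)"
      using vk_Wn[OF N1(1) near_le[OF N1(1) k]] by (simp add: h_def z_def e_def)
    have zS: "zk N (Suc k) = z + h" using zk_Suc[OF N1(1)] by (simp add: z_def h_def)
    have a1: "\<bar>normal_density 0 sig z * exp e - normal_density 0 sig z\<bar> \<le> C1 / sqrt (real N) * (1 / (1 + z\<^sup>2))"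
    proof -
      have "\<bar>normal_density 0 sig z * exp e - normal_density 0 sig z\<bar> = normal_density 0 sig z * \<bar>exp e - 1\<bar>"
      proof -
        have "normal_density 0 sig z * exp e - normal_density 0 sig z = normal_density 0 sig z * (exp e - 1)"
          by (simp add: right_diff_distrib)
        then show ?thesis by (simp add: abs_mult)
      qed
      also have "\<dots> \<le> normal_density 0 sig z * (\<bar>e\<bar> * exp \<bar>e\<bar>)"
        by (intro mult_left_mono abs_exp_diff_one_le) auto
      also have "\<dots> \<le> normal_density 0 sig z * (D / sqrt (real N) * (1 + z\<^sup>2)\<^sup>2 * exp (z\<^sup>2 / (4 * sig\<^sup>2) + D))"
        using e D by (intro mult_left_mono mult_mono) auto
      also have "\<dots> = c * D * exp D / sqrt (real N) * ((1 + z\<^sup>2)\<^sup>2 * (exp (- z\<^sup>2 / (2 * sig\<^sup>2)) * exp (z\<^sup>2 / (4 * sig\<^sup>2))))"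
        by (simp add: n_eq exp_add mult_ac)
      \<comment> \<open>Half of the Gaussian exponent has paid for exp |e|; the remaining half
        absorbs the polynomial factor through \<open>P'\<close>.\<close>
      also have "exp (- z\<^sup>2 / (2 * sig\<^sup>2)) * exp (z\<^sup>2 / (4 * sig\<^sup>2)) = exp (- z\<^sup>2 / (4 * sig\<^sup>2))"
        unfolding exp_add[symmetric] by simp
      also have "c * D * exp D / sqrt (real N) * ((1 + z\<^sup>2)\<^sup>2 * exp (- z\<^sup>2 / (4 * sig\<^sup>2)))
          \<le> c * D * exp D / sqrt (real N) * (P / (1 + z\<^sup>2))"
        using c D N1 by (intro mult_left_mono P') auto
      finally show ?thesis by (simp add: C1_def)
    qed
    obtain \<xi> where \<xi>: "\<xi> \<in> {min z (z + h)..max z (z + h)}"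
        "ncdf sig (z + h) - ncdf sig z = normal_density 0 sig \<xi> * (z + h - z)"
      using MVT_abs[of z "z + h" "ncdf sig" "normal_density 0 sig"] ncdf_has_derivative[OF sig_pos] by blast
    obtain \<zeta> where \<zeta>: "\<zeta> \<in> {min z \<xi>..max z \<xi>}"
        "normal_density 0 sig \<xi> - normal_density 0 sig z = (- \<zeta> / sig\<^sup>2 * normal_density 0 sig \<zeta>) * (\<xi> - z)"
      using MVT_abs[of z \<xi> "normal_density 0 sig" "\<lambda>t. - t / sig\<^sup>2 * normal_density 0 sig t"]
        normal_density_has_derivative[OF sig_pos] by blast
    obtain \<eta> where \<eta>: "\<eta> \<in> {min z (z + h)..max z (z + h)}"
        "arctan (z + h) - arctan z = inverse (1 + \<eta>\<^sup>2) * (z + h - z)"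
      using MVT_abs[of z "z + h" arctan "\<lambda>t. inverse (1 + t\<^sup>2)"] DERIV_arctan by blast
    have a2: "\<bar>normal_density 0 sig \<xi> - normal_density 0 sig z\<bar> \<le> C2 / sqrt (real N) * (1 / (1 + \<zeta>\<^sup>2))"
    proof -
      have "\<bar>normal_density 0 sig \<xi> - normal_density 0 sig z\<bar> = (\<bar>\<zeta>\<bar> * normal_density 0 sig \<zeta>) / sig\<^sup>2 * \<bar>\<xi> - z\<bar>"
        unfolding \<zeta>(2) by (simp add: abs_mult)
      also have "\<dots> \<le> (c * P / (1 + \<zeta>\<^sup>2)) / sig\<^sup>2 * h"
        using \<xi>(1) h c P sig_pos by (intro mult_mono divide_right_mono E1) auto
      also have "\<dots> = C2 / sqrt (real N) * (1 / (1 + \<zeta>\<^sup>2))"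
        by (simp add: C2_def h_def step_def mult_ac)
      finally show ?thesis .
    qed
    have sh: "1 / (1 + z\<^sup>2) \<le> 3 / (1 + \<eta>\<^sup>2)" "1 / (1 + \<zeta>\<^sup>2) \<le> 3 / (1 + \<eta>\<^sup>2)"
      using \<eta>(1) \<zeta>(1) \<xi>(1) h by (auto intro!: one_plus_square_shift)
    have "\<bar>normal_density 0 sig z * exp e - normal_density 0 sig \<xi>\<bar>
        \<le> C1 / sqrt (real N) * (1 / (1 + z\<^sup>2)) + C2 / sqrt (real N) * (1 / (1 + \<zeta>\<^sup>2))"
      using a1 a2 by linarith
    also have "\<dots> \<le> C1 / sqrt (real N) * (3 / (1 + \<eta>\<^sup>2)) + C2 / sqrt (real N) * (3 / (1 + \<eta>\<^sup>2))"
      using C12 N1 by (intro add_mono mult_left_mono sh) auto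
    also have "\<dots> = C / sqrt (real N) * inverse (1 + \<eta>\<^sup>2)"
      by (simp add: C_def divide_inverse algebra_simps)
    finally have "h * \<bar>normal_density 0 sig z * exp e - normal_density 0 sig \<xi>\<bar>
        \<le> h * (C / sqrt (real N) * inverse (1 + \<eta>\<^sup>2))"
      using h by (intro mult_left_mono) auto
    moreover have "\<bar>vk \<beta> p N k / Wn N - (ncdf sig (z + h) - ncdf sig z)\<bar>
        = h * \<bar>normal_density 0 sig z * exp e - normal_density 0 sig \<xi>\<bar>"
    proof -
      have "h * (normal_density 0 sig z * exp e) - normal_density 0 sig \<xi> * (z + h - z)
          = h * (normal_density 0 sig z * exp e - normal_density 0 sig \<xi>)"
        by (simp add: algebra_simps)
      then show ?thesis unfolding v \<xi>(2) using h by (simp add: abs_mult)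
    qed
    moreover have "h * (C / sqrt (real N) * inverse (1 + \<eta>\<^sup>2)) = C / sqrt (real N) * (arctan (z + h) - arctan z)"
      unfolding \<eta>(2) by simp
    ultimately show "\<bar>vk \<beta> p N k / Wn N - (ncdf sig (zk N (Suc k)) - ncdf sig (zk N k))\<bar>
      \<le> C / sqrt (real N) * (arctan (zk N (Suc k)) - arctan (zk N k))"
      unfolding zS z_def[symmetric] by linarith
  qed
  then show ?thesis using C by blast
qed

end

section \<open>Summation over the window, and the mass outside it\<close>

lemma finite_convex_nat:
  fixes S :: "nat set"
  assumes "finite S" "S \<noteq> {}" "\<And>a b c. a \<in> S \<Longrightarrow> b \<in> S \<Longrightarrow> a \<le> c \<Longrightarrow> c \<le> b \<Longrightarrow> c \<in> S"
  shows "S = {Min S..<Suc (Max S)}"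
proof (intro equalityI subsetI)
  fix c assume "c \<in> {Min S..<Suc (Max S)}"
  then show "c \<in> S"
    by (intro assms(3)[of "Min S" "Max S" c] Min_in Max_in assms(1,2)) auto
qed (use assms(1,2) in \<open>auto simp: less_Suc_eq_le\<close>)

context supercritical
begin

definition near :: "nat \<Rightarrow> nat set" where
  "near N = {k. \<bar>xk N k - m\<bar> \<le> del}"

lemma near_subset: "1 \<le> N \<Longrightarrow> near N \<subseteq> {..N}"
  using near_le by (auto simp: near_def)

lemma finite_near: "1 \<le> N \<Longrightarrow> finite (near N)"
  using near_subset finite_subset by blast

lemma near_zk: "1 \<le> N \<Longrightarrow> k \<in> near N \<longleftrightarrow> \<bar>zk N k\<bar> \<le> kap * sqrt (real N) * del"
proof -
  assume N: "1 \<le> N"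
  have pos: "0 < kap * sqrt (real N)" using kap_pos N by simp
  have "\<bar>zk N k\<bar> = kap * sqrt (real N) * \<bar>xk N k - m\<bar>"
    unfolding zk_def abs_mult[of "kap * sqrt (real N)"] using pos by simp
  then show ?thesis
    unfolding near_def mem_Collect_eq using mult_le_cancel_left_pos[OF pos] by metis
qed

lemma zk_mono: "i \<le> j \<Longrightarrow> zk N i \<le> zk N j"
  unfolding zk_def xk_def using kap_pos
  by (intro mult_left_mono diff_right_mono divide_right_mono) auto

lemma exp_neg_le_inverse_sqrt:
  assumes "0 < q" "1 \<le> N"
  shows "exp (- (q * real N)) \<le> (1 / q) / sqrt (real N)"
proof -
  have "q * real N \<le> exp (q * real N)"
    using exp_ge_add_one_self[of "q * real N"] by linarith
  then have "exp (- (q * real N)) \<le> 1 / (q * real N)"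
    unfolding exp_minus inverse_eq_divide using assms by (intro divide_left_mono) auto
  also have "\<dots> \<le> 1 / (q * sqrt (real N))"
  proof -
    have "sqrt (real N) * 1 \<le> sqrt (real N) * sqrt (real N)"
      using assms by (intro mult_left_mono) auto
    then show ?thesis
      using assms by (intro divide_left_mono) auto
  qed
  finally show ?thesis by simp
qed

text \<open>The indices counted form an interval [a, b), so the cell comparison telescopes to the
  normal mass between z_a and z_b. It remains to replace the left end by minus infinity and the
  right end by t.\<close>

lemma near_partial_sum:
  "\<exists>C>0. \<forall>\<^sub>F N in sequentially. \<forall>t.
     \<bar>(\<Sum>k\<in>{k\<in>near N. zk N k \<le> t}. vk \<beta> p N k) / Wn N - ncdf sig t\<bar> \<le> C / sqrt (real N)"
proof -
  obtain C0 where C0: "0 < C0" and ev: "\<forall>\<^sub>F N in sequentially. \<forall>k. \<bar>xk N k - m\<bar> \<le> del \<longrightarrow>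
     \<bar>vk \<beta> p N k / Wn N - (ncdf sig (zk N (Suc k)) - ncdf sig (zk N k))\<bar>
      \<le> C0 / sqrt (real N) * (arctan (zk N (Suc k)) - arctan (zk N k))"
    using cell_bound by blast
  define q where "q = (kap * del / 2)\<^sup>2 / (2 * sig\<^sup>2)"
  have q: "0 < q" using kap_pos del sig_pos by (simp add: q_def)
  define C where "C = C0 * 4 + 2 * (1 / q) + 2 * kap / sig"
  have C: "0 < C" using C0 q kap_pos sig_pos by (simp add: C_def add_pos_pos)
  have "\<forall>\<^sub>F N in sequentially. real N > max 1 (4 / del)"
    using filterlim_real_sequentially unfolding filterlim_at_top_dense by blast
  with ev have "\<forall>\<^sub>F N in sequentially. \<forall>t.
     \<bar>(\<Sum>k\<in>{k\<in>near N. zk N k \<le> t}. vk \<beta> p N k) / Wn N - ncdf sig t\<bar> \<le> C / sqrt (real N)"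
  proof (eventually_elim, intro allI)
    fix N t assume N: "real N > max 1 (4 / del)"
      and cell: "\<forall>k. \<bar>xk N k - m\<bar> \<le> del \<longrightarrow>
       \<bar>vk \<beta> p N k / Wn N - (ncdf sig (zk N (Suc k)) - ncdf sig (zk N k))\<bar>
        \<le> C0 / sqrt (real N) * (arctan (zk N (Suc k)) - arctan (zk N k))"
    have N1: "1 \<le> N" "0 < sqrt (real N)" using N by auto
    \<comment> \<open>Half the window radius in the z scale: an end point that misses the edge by
      one cell, of width h \<le> R, is still beyond -R or R, where the normal tails are
      exponentially small in N.\<close>
    define R where "R = kap * sqrt (real N) * del / 2"
    define h where "h = step N"
    define e where "e = (1 / q) / sqrt (real N)"
    define S where "S = {k\<in>near N. zk N k \<le> t}"
    have R: "0 < R" using kap_pos N1 del by (simp add: R_def)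
    have h: "0 < h" unfolding h_def by (rule step_pos[OF N1(1)])
    have hR: "h \<le> R"
    proof -
      have "4 \<le> real N * del" using N del by (simp add: field_simps)
      then have "kap * 4 \<le> kap * (real N * del)"
        using kap_pos by (intro mult_left_mono) auto
      moreover have "R * sqrt (real N) = kap * (real N * del) / 2"
      proof -
        have "R * sqrt (real N) = kap * ((sqrt (real N) * sqrt (real N)) * del) / 2"
          by (simp only: R_def) (simp only: times_divide_eq_left mult_ac)
        then show ?thesis by simp
      qed
      ultimately have "2 * kap \<le> R * sqrt (real N)" by linarith
      then show ?thesis
        unfolding h_def step_def using N1(2) by (simp only: pos_divide_le_eq)
    qed
    have nearz: "k \<in> near N \<longleftrightarrow> \<bar>zk N k\<bar> \<le> 2 * R" for k
      using near_zk[OF N1(1)] by (simp add: R_def)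
    have zS: "zk N (Suc k) = zk N k + h" for k
      using zk_Suc[OF N1(1)] by (simp add: h_def)
    have tail: "ncdf sig (- R) \<le> e" "1 - ncdf sig R \<le> e"
    proof -
      have "R\<^sup>2 / (2 * sig\<^sup>2) = q * real N"
        using N1 by (simp add: R_def q_def power_mult_distrib power_divide)
      then have "exp (- R\<^sup>2 / (2 * sig\<^sup>2)) \<le> e"
        using exp_neg_le_inverse_sqrt[OF q N1(1)] by (simp add: e_def)
      then show "ncdf sig (- R) \<le> e" "1 - ncdf sig R \<le> e"
        using normal_tail[OF sig_pos, of R] R by auto
    qed
    \<comment> \<open>Index 0 lies strictly left of the window because del < 1, so the first index
      of the window has a predecessor.\<close>
    have z0: "zk N 0 < - 2 * R"
    proof -
      have "kap * sqrt (real N) * (- 1 - m) < kap * sqrt (real N) * (- del)"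
        using kap_pos N1 del m_pos by (intro mult_strict_left_mono) auto
      then show ?thesis by (simp add: zk_def xk_def R_def)
    qed
    \<comment> \<open>The three sources of error: the arctan sum (4 exceeds pi), the two normal
      tails, and one cell width at the threshold.\<close>
    have CC: "C0 * 4 / sqrt (real N) + 2 * e + h / sig = C / sqrt (real N)"
      by (simp add: C_def e_def h_def step_def add_divide_distrib)
    have pos: "0 \<le> C0 * 4 / sqrt (real N)" "0 \<le> e" "0 \<le> h / sig"
      using C0 q h sig_pos by (auto simp: e_def)
    show "\<bar>(\<Sum>k\<in>{k\<in>near N. zk N k \<le> t}. vk \<beta> p N k) / Wn N - ncdf sig t\<bar> \<le> C / sqrt (real N)"
    proof (cases "S = {}")
      case True
      \<comment> \<open>The first index of the window. Having just entered it, z_j < -R; since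
        nothing is counted, t lies below z_j, and the normal mass up to t is a tail.\<close>
      define j where "j = (LEAST k. - 2 * R \<le> zk N k)"
      have "- 2 * R \<le> zk N N"
      proof -
        have "0 \<le> zk N N"
          unfolding zk_def xk_def using kap_pos m_less1 N1 by (intro mult_nonneg_nonneg) auto
        then show ?thesis using R by linarith
      qed
      then have j: "- 2 * R \<le> zk N j" unfolding j_def by (rule LeastI)
      have "j \<noteq> 0" using j z0 by (intro notI) simp
      then obtain i where i: "j = Suc i" by (cases j) auto
      have "\<not> - 2 * R \<le> zk N i"
        using not_less_Least[of i "\<lambda>k. - 2 * R \<le> zk N k"] i unfolding j_def by simp
      then have "zk N j < - R" using hR zS[of i] i by simp
      moreover have "j \<notin> S" using True by simp
      ultimately have "t < - R"
        using j R unfolding S_def nearz by auto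
      then have "ncdf sig t \<le> e"
        using ncdf_mono[OF sig_pos, of t "- R"] tail by linarith
      moreover have "0 \<le> ncdf sig t" using ncdf_bounds sig_pos by auto
      ultimately show ?thesis
        unfolding S_def[symmetric] True CC[symmetric] using pos by simp
    next
      case False
      have fin: "finite S" unfolding S_def using finite_near[OF N1(1)] by simp
      define a where "a = Min S"
      define b where "b = Suc (Max S)"
      have S: "S = {a..<b}"
        unfolding a_def b_def
      proof (rule finite_convex_nat[OF fin False])
        fix i j c assume "i \<in> S" "j \<in> S" "i \<le> c" "c \<le> j"
        then show "c \<in> S"
          using zk_mono[of i c N] zk_mono[of c j N] unfolding S_def nearz by auto
      qed
      have aS: "a \<in> S" using fin False by (simp add: a_def)
      have bS: "Max S \<in> S" using fin False by simp
      have ab: "a \<le> b" using aS S by auto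
      have za: "zk N a \<le> - R"
      proof -
        have "a \<noteq> 0"
          using aS z0 R unfolding S_def nearz by (intro notI) simp
        then obtain i where i: "a = Suc i" by (cases a) auto
        have "i \<notin> S" using S i by simp
        then have "zk N i < - 2 * R"
          using aS zS[of i] h i unfolding S_def nearz by auto
        then show ?thesis using zS[of i] i hR by simp
      qed
      have zb: "zk N b \<le> t + h"
        using bS zS[of "Max S"] unfolding b_def S_def by auto
      have "b \<notin> S" using S by simp
      \<comment> \<open>The first uncounted index has either passed the threshold or left the window
        on the right.\<close>
      then have zb2: "t < zk N b \<or> R \<le> zk N b"
        using bS zS[of "Max S"] h R unfolding b_def S_def nearz by auto
      have Ga: "0 \<le> ncdf sig (zk N a)" "ncdf sig (zk N a) \<le> e"
        using ncdf_bounds[OF sig_pos] ncdf_mono[OF sig_pos za] tail by auto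
      have Gb1: "ncdf sig (zk N b) \<le> ncdf sig t + h / sig"
        using ncdf_mono[OF sig_pos zb] ncdf_lipschitz[OF sig_pos, of "t + h" t] h by simp
      have Gb2: "ncdf sig t - e \<le> ncdf sig (zk N b)"
        using zb2
      proof
        assume "t < zk N b"
        then show ?thesis using ncdf_mono[OF sig_pos, of t "zk N b"] pos by linarith
      next
        assume "R \<le> zk N b"
        then show ?thesis
          using ncdf_mono[OF sig_pos, of R "zk N b"] tail ncdf_bounds(2)[OF sig_pos, of t] by linarith
      qed
      have "\<bar>(\<Sum>k\<in>S. vk \<beta> p N k / Wn N) - (ncdf sig (zk N b) - ncdf sig (zk N a))\<bar>
          = \<bar>\<Sum>k\<in>S. vk \<beta> p N k / Wn N - (ncdf sig (zk N (Suc k)) - ncdf sig (zk N k))\<bar>"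
        unfolding S using sum_Suc_diff'[OF ab, of "\<lambda>k. ncdf sig (zk N k)"] by (simp add: sum_subtractf)
      also have "\<dots> \<le> (\<Sum>k\<in>S. \<bar>vk \<beta> p N k / Wn N - (ncdf sig (zk N (Suc k)) - ncdf sig (zk N k))\<bar>)"
        by (rule sum_abs)
      also have "\<dots> \<le> (\<Sum>k\<in>S. C0 / sqrt (real N) * (arctan (zk N (Suc k)) - arctan (zk N k)))"
        using cell by (intro sum_mono) (auto simp: S_def near_def)
      also have "\<dots> = C0 / sqrt (real N) * (arctan (zk N b) - arctan (zk N a))"
        unfolding S sum_distrib_left[symmetric] sum_Suc_diff'[OF ab, of "\<lambda>k. arctan (zk N k)"] by simp
      also have "\<dots> \<le> C0 / sqrt (real N) * 4"
        using arctan_ubound[of "zk N b"] arctan_lbound[of "zk N a"] pi_less_4 C0 N1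
        by (intro mult_left_mono) auto
      finally have "\<bar>(\<Sum>k\<in>S. vk \<beta> p N k) / Wn N - (ncdf sig (zk N b) - ncdf sig (zk N a))\<bar> \<le> C0 * 4 / sqrt (real N)"
        by (simp add: sum_divide_distrib)
      then show ?thesis
        unfolding S_def[symmetric] CC[symmetric] using Ga Gb1 Gb2 pos by linarith
    qed
  qed
  then show ?thesis using C by blast
qed

text \<open>Each far weight is exponentially smaller than the one at \<open>k0\<close>: the gap
  \<epsilon> loses \<epsilon> / 2 to the offset of \<open>k0\<close> from m, and the number of terms
  and the entropy bound cost (N + 1)^2. So the whole far mass is at most the single weight at
  \<open>k0\<close>, which is O(N^(-1/2)) in units of \<open>Wn\<close>.\<close>

lemma far_sum:
  "\<exists>C>0. \<forall>\<^sub>F N in sequentially.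
     (\<Sum>k\<in>{k. k \<le> N \<and> \<not> \<bar>theta p (xk N k) - m\<bar> \<le> del}. vk \<beta> p N k) / Wn N \<le> C / sqrt (real N)"
proof -
  obtain \<epsilon> where \<epsilon>: "0 < \<epsilon>" "\<And>x. x \<in> {-1..1} \<Longrightarrow> del \<le> \<bar>theta p x - m\<bar> \<Longrightarrow> H x \<le> H m - \<epsilon>"
    using H_gap[OF del(1)] by blast
  define C where "C = 2 * kap / sqrt (2 * pi * sig\<^sup>2)"
  have C: "0 < C" using kap_pos sig_pos by (simp add: C_def)
  have e1: "\<forall>\<^sub>F N in sequentially. (real N + 1)\<^sup>2 * exp (- (real N * (\<epsilon> / 2))) \<le> 1"
  proof -
    have "((\<lambda>N. (real N + 1)\<^sup>2 * exp (- (real N * (\<epsilon> / 2)))) \<longlongrightarrow> 0) sequentially"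
      using \<epsilon>(1) by real_asymp
    from order_tendstoD(2)[OF this zero_less_one] show ?thesis
      by (rule eventually_mono) (rule less_imp_le)
  qed
  have e2: "\<forall>\<^sub>F N in sequentially. H m - \<epsilon> / 2 \<le> H (xk N (k0 N))"
  proof -
    have "isCont H m"
      using Hfun_has_derivative[of m] m_pos m_less1 by (intro DERIV_isCont) auto
    moreover have "(\<lambda>N. xk N (k0 N)) \<longlonglongrightarrow> m"
    proof (rule tendsto_sandwich)
      show "\<forall>\<^sub>F N in sequentially. m - 2 / real N \<le> xk N (k0 N)"
        using eventually_ge_at_top[of 1] by eventually_elim (use k0(2) in \<open>auto intro: less_imp_le\<close>)
      show "\<forall>\<^sub>F N in sequentially. xk N (k0 N) \<le> m"
        using eventually_ge_at_top[of 1] by eventually_elim (use k0(3) in auto)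
      show "(\<lambda>N. m - 2 / real N) \<longlonglongrightarrow> m" by real_asymp
    qed auto
    ultimately have "(\<lambda>N. H (xk N (k0 N))) \<longlonglongrightarrow> H m"
      by (rule isCont_tendsto_compose)
    from order_tendstoD(1)[OF this, of "H m - \<epsilon> / 2"] \<epsilon>(1)
    have "\<forall>\<^sub>F N in sequentially. H m - \<epsilon> / 2 < H (xk N (k0 N))" by simp
    then show ?thesis
      by (rule eventually_mono) (rule less_imp_le)
  qed
  have "\<forall>\<^sub>F N in sequentially.
     (\<Sum>k\<in>{k. k \<le> N \<and> \<not> \<bar>theta p (xk N k) - m\<bar> \<le> del}. vk \<beta> p N k) / Wn N \<le> C / sqrt (real N)"
    using e1 e2 eventually_ge_at_top[of 1]
  proof eventually_elim
    fix N assume 1: "(real N + 1)\<^sup>2 * exp (- (real N * (\<epsilon> / 2))) \<le> 1"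
      and 2: "H m - \<epsilon> / 2 \<le> H (xk N (k0 N))" and N: "1 \<le> N"
    define F where "F = {k. k \<le> N \<and> \<not> \<bar>theta p (xk N k) - m\<bar> \<le> del}"
    define A where "A = 2 ^ N * exp (real N * (H m - \<epsilon>))"
    have F: "finite F" "card F \<le> N + 1"
      using card_mono[of "{..N}" F] by (auto simp: F_def intro: finite_subset[of _ "{..N}"])
    have "(\<Sum>k\<in>F. vk \<beta> p N k) \<le> (\<Sum>k\<in>F. A)"
    proof (rule sum_mono)
      fix k assume k: "k \<in> F"
      then have kN: "k \<le> N" by (simp add: F_def)
      then have "xk N k \<in> {-1..1}" using N by (auto simp: xk_def field_simps)
      then have "H (xk N k) \<le> H m - \<epsilon>" using k by (intro \<epsilon>) (auto simp: F_def)
      then have "2 ^ N * exp (real N * H (xk N k)) \<le> A"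
        unfolding A_def by (intro mult_left_mono iffD2[OF exp_le_cancel_iff]) auto
      then show "vk \<beta> p N k \<le> A" using vk_upper[OF N kN, of \<beta> p] by linarith
    qed
    also have "\<dots> \<le> (real N + 1) * A"
      using F by (simp add: A_def)
    also have "A = exp (- (real N * (\<epsilon> / 2))) * (2 ^ N * exp (real N * (H m - \<epsilon> / 2)))"
      by (simp add: A_def mult.left_commute flip: exp_add) (simp add: algebra_simps)
    also have "2 ^ N * exp (real N * (H m - \<epsilon> / 2)) \<le> 2 ^ N * exp (real N * H (xk N (k0 N)))"
      using 2 by (intro mult_left_mono iffD2[OF exp_le_cancel_iff]) auto
    also have "2 ^ N * exp (real N * H (xk N (k0 N))) \<le> (real N + 1) * vk \<beta> p N (k0 N)"
      using vk_lower[OF N k0(1)[OF N], of \<beta> p] by (simp add: add.commute)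
    finally have "(\<Sum>k\<in>F. vk \<beta> p N k) \<le> (real N + 1) * (exp (- (real N * (\<epsilon> / 2))) * ((real N + 1) * vk \<beta> p N (k0 N)))"
      by (simp add: mult_left_mono)
    also have "\<dots> = ((real N + 1)\<^sup>2 * exp (- (real N * (\<epsilon> / 2)))) * vk \<beta> p N (k0 N)"
      by (simp add: power2_eq_square)
    also have "\<dots> \<le> 1 * vk \<beta> p N (k0 N)"
      using vk_pos[OF k0(1)[OF N]] by (intro mult_right_mono 1) (auto intro: less_imp_le)
    finally have "(\<Sum>k\<in>F. vk \<beta> p N k) / Wn N \<le> vk \<beta> p N (k0 N) / Wn N"
      using Wn_pos[OF N] by (intro divide_right_mono) auto
    also have "\<dots> = C / sqrt (real N)"
      using vk_pos[OF k0(1)[OF N], of \<beta> p] by (simp add: Wn_def C_def step_def)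
    finally show "(\<Sum>k\<in>{k. k \<le> N \<and> \<not> \<bar>theta p (xk N k) - m\<bar> \<le> del}. vk \<beta> p N k) / Wn N \<le> C / sqrt (real N)"
      unfolding F_def .
  qed
  then show ?thesis using C by blast
qed

section \<open>Law of the linearized statistic\<close>

definition Ystat :: "nat \<Rightarrow> (nat \<Rightarrow> real) \<Rightarrow> real" where
  "Ystat N X = kap * sqrt (real N) * (theta p (mag N X) - m)"

definition prob :: "nat \<Rightarrow> ((nat \<Rightarrow> real) \<Rightarrow> bool) \<Rightarrow> real" where
  "prob N P = (\<Sum>X\<in>{X\<in>config_space N. P X}. cw_prob \<beta> p N X)"

lemma prob_theta:
  assumes "1 \<le> N"
  shows "prob N (\<lambda>X. P (theta p (mag N X)))
    = (\<Sum>k\<le>N. vk \<beta> p N k * (if P (theta p (xk N k)) then 1 else 0)) / Zk \<beta> p N"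
proof -
  have "prob N (\<lambda>X. P (theta p (mag N X)))
      = (\<Sum>X\<in>config_space N. if P (theta p (mag N X)) then cw_prob \<beta> p N X else 0)"
    unfolding prob_def by (rule sum.inter_filter) (rule finite_config_space)
  also have "\<dots> = (\<Sum>X\<in>config_space N. exp (hamil \<beta> p N X) * (if P (theta p (mag N X)) then 1 else 0)) / Zk \<beta> p N"
    unfolding sum_divide_distrib by (intro sum.cong refl) (simp add: cw_prob_eq[OF assms])
  finally show ?thesis
    unfolding sum_config_mag[OF assms, of \<beta> p "\<lambda>x. if P (theta p x) then 1 else 0"] .
qed

text \<open>Numerator and partition function are expressed by the same partial sums s: the
  probability is r s(t) / (r s(R) + J), with J the far mass and r the number of maximizers. As s(R)
  is near 1 and J near 0, the factor r cancels up to the error.\<close>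

lemma near_cdf:
  "\<exists>C>0. \<forall>\<^sub>F N in sequentially. \<forall>t.
     \<bar>prob N (\<lambda>X. \<bar>theta p (mag N X) - m\<bar> \<le> del \<and> Ystat N X \<le> t) - ncdf sig t\<bar> \<le> C / sqrt (real N)"
proof -
  obtain C1 where C1: "0 < C1" and ev1: "\<forall>\<^sub>F N in sequentially. \<forall>t.
     \<bar>(\<Sum>k\<in>{k\<in>near N. zk N k \<le> t}. vk \<beta> p N k) / Wn N - ncdf sig t\<bar> \<le> C1 / sqrt (real N)"
    using near_partial_sum by blast
  obtain C2 where C2: "0 < C2" and ev2: "\<forall>\<^sub>F N in sequentially.
     (\<Sum>k\<in>{k. k \<le> N \<and> \<not> \<bar>theta p (xk N k) - m\<bar> \<le> del}. vk \<beta> p N k) / Wn N \<le> C2 / sqrt (real N)"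
    using far_sum by blast
  define q where "q = (kap * del)\<^sup>2 / (2 * sig\<^sup>2)"
  have q: "0 < q" using kap_pos del sig_pos by (simp add: q_def)
  define C where "C = 2 * (4 * C1 + 2 * (1 / q) + C2)"
  have C: "0 < C" using C1 C2 q by (simp add: C_def add_pos_pos)
  define r :: real where "r = (if even p then 2 else 1)"
  have r: "1 \<le> r" "r \<le> 2" by (auto simp: r_def)
  have "\<forall>\<^sub>F N in sequentially. real N > max 1 ((2 * (C1 + 1 / q))\<^sup>2)"
    using filterlim_real_sequentially unfolding filterlim_at_top_dense by blast
  with ev1 ev2 have "\<forall>\<^sub>F N in sequentially. \<forall>t.
     \<bar>prob N (\<lambda>X. \<bar>theta p (mag N X) - m\<bar> \<le> del \<and> Ystat N X \<le> t) - ncdf sig t\<bar> \<le> C / sqrt (real N)"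
  proof (eventually_elim, intro allI)
    fix N t assume N: "real N > max 1 ((2 * (C1 + 1 / q))\<^sup>2)"
      and sum: "\<forall>t. \<bar>(\<Sum>k\<in>{k\<in>near N. zk N k \<le> t}. vk \<beta> p N k) / Wn N - ncdf sig t\<bar> \<le> C1 / sqrt (real N)"
      and far: "(\<Sum>k\<in>{k. k \<le> N \<and> \<not> \<bar>theta p (xk N k) - m\<bar> \<le> del}. vk \<beta> p N k) / Wn N \<le> C2 / sqrt (real N)"
    have N1: "1 \<le> N" "0 < sqrt (real N)" using N by auto
    \<comment> \<open>The window radius in the z scale, so that the threshold R cuts nothing off and
      \<open>s R\<close> is the full window mass.\<close>
    define R where "R = kap * sqrt (real N) * del"
    have R: "0 \<le> R" using kap_pos del by (simp add: R_def)
    define s where "s t = (\<Sum>k\<in>{k\<in>near N. zk N k \<le> t}. vk \<beta> p N k) / Wn N" for t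
    define J where "J = (\<Sum>k\<in>{k. k \<le> N \<and> \<not> \<bar>theta p (xk N k) - m\<bar> \<le> del}. vk \<beta> p N k) / Wn N"
    define e1 where "e1 = C1 / sqrt (real N)"
    define e2 where "e2 = C2 / sqrt (real N)"
    define e3 where "e3 = (1 / q) / sqrt (real N)"
    have W: "0 < Wn N" by (rule Wn_pos[OF N1(1)])
    have s: "\<bar>s t - ncdf sig t\<bar> \<le> e1" for t using sum by (simp add: s_def e1_def)
    have J: "0 \<le> J" "J \<le> e2"
      using far W by (auto simp: J_def e2_def intro!: divide_nonneg_pos sum_nonneg less_imp_le[OF vk_pos])
    have tail: "1 - ncdf sig R \<le> e3"
    proof -
      have "R\<^sup>2 / (2 * sig\<^sup>2) = q * real N"
        using N1 by (simp add: R_def q_def power_mult_distrib)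
      then have "exp (- R\<^sup>2 / (2 * sig\<^sup>2)) \<le> e3"
        using exp_neg_le_inverse_sqrt[OF q N1(1)] by (simp add: e3_def)
      then show ?thesis using normal_tail(2)[OF sig_pos R] by linarith
    qed
    have sR: "\<bar>s R - 1\<bar> \<le> e1 + e3"
      using s[of R] tail ncdf_bounds(2)[OF sig_pos, of R] by linarith
    have small: "e1 + e3 \<le> 1 / 2"
    proof -
      have "2 * (C1 + 1 / q) \<le> sqrt (real N)"
        using N by (intro real_le_rsqrt) auto
      then have "(C1 + 1 / q) / sqrt (real N) \<le> 1 / 2"
        using N1 by (simp add: divide_le_eq)
      then show ?thesis by (simp add: e1_def e3_def add_divide_distrib)
    qed
    have theta_sum: "(\<Sum>k\<le>N. vk \<beta> p N k * (if \<bar>theta p (xk N k) - m\<bar> \<le> del \<and> kap * sqrt (real N) * (theta p (xk N k) - m) \<le> t then 1 else 0))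
        = r * (s t * Wn N)" for t
    proof -
      have "(\<Sum>k\<le>N. vk \<beta> p N k * (if \<bar>theta p (xk N k) - m\<bar> \<le> del \<and> kap * sqrt (real N) * (theta p (xk N k) - m) \<le> t then 1 else 0))
        = r * (\<Sum>k\<le>N. vk \<beta> p N k * (if \<bar>xk N k - m\<bar> \<le> del \<and> kap * sqrt (real N) * (xk N k - m) \<le> t then 1 else 0))"
        \<comment> \<open>The indicator vanishes at nonpositive arguments because del < m.\<close>
        unfolding r_def by (rule sum_theta[OF N1(1)]) (use del(2) in auto)
      also have "(\<Sum>k\<le>N. vk \<beta> p N k * (if \<bar>xk N k - m\<bar> \<le> del \<and> kap * sqrt (real N) * (xk N k - m) \<le> t then 1 else 0))
         = (\<Sum>k\<in>{k\<in>near N. zk N k \<le> t}. vk \<beta> p N k)"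
        using near_subset[OF N1(1)]
        by (intro sum.mono_neutral_cong_right) (auto simp: near_def zk_def)
      finally show ?thesis using W by (simp add: s_def)
    qed
    have Z: "Zk \<beta> p N = (r * s R + J) * Wn N"
    proof -
      have "Zk \<beta> p N = (\<Sum>k\<le>N. vk \<beta> p N k * (if \<bar>theta p (xk N k) - m\<bar> \<le> del \<and> kap * sqrt (real N) * (theta p (xk N k) - m) \<le> R then 1 else 0))
          + (\<Sum>k\<le>N. if \<not> \<bar>theta p (xk N k) - m\<bar> \<le> del then vk \<beta> p N k else 0)"
        unfolding Zk_def sum.distrib[symmetric]
      proof (intro sum.cong refl)
        fix k
        have "kap * sqrt (real N) * (theta p (xk N k) - m) \<le> R" if "\<bar>theta p (xk N k) - m\<bar> \<le> del"
          unfolding R_def using that kap_pos by (intro mult_left_mono) auto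
        then show "vk \<beta> p N k = vk \<beta> p N k * (if \<bar>theta p (xk N k) - m\<bar> \<le> del \<and> kap * sqrt (real N) * (theta p (xk N k) - m) \<le> R then 1 else 0)
            + (if \<not> \<bar>theta p (xk N k) - m\<bar> \<le> del then vk \<beta> p N k else 0)"
          by auto
      qed
      also have "(\<Sum>k\<le>N. if \<not> \<bar>theta p (xk N k) - m\<bar> \<le> del then vk \<beta> p N k else 0) = J * Wn N"
        using W by (simp add: J_def sum.inter_filter[symmetric])
      finally show ?thesis unfolding theta_sum by (simp add: algebra_simps)
    qed
    have "prob N (\<lambda>X. \<bar>theta p (mag N X) - m\<bar> \<le> del \<and> Ystat N X \<le> t) = r * (s t * Wn N) / ((r * s R + J) * Wn N)"
      unfolding Ystat_def
      using prob_theta[OF N1(1), of "\<lambda>x. \<bar>x - m\<bar> \<le> del \<and> kap * sqrt (real N) * (x - m) \<le> t"]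
      unfolding theta_sum Z by simp
    then have prob: "prob N (\<lambda>X. \<bar>theta p (mag N X) - m\<bar> \<le> del \<and> Ystat N X \<le> t) = r * s t / (r * s R + J)"
      using W by simp
    define g where "g = ncdf sig t"
    have g: "0 \<le> g" "g \<le> 1" unfolding g_def using ncdf_bounds[OF sig_pos] by auto
    have den: "1 / 2 \<le> r * s R + J"
    proof -
      have "1 * (1 / 2) \<le> r * s R" using sR small r by (intro mult_mono) auto
      then show ?thesis using J by linarith
    qed
    have "\<bar>r * s t - g * (r * s R + J)\<bar> \<le> 4 * e1 + 2 * e3 + e2"
    proof -
      \<comment> \<open>Clearing the denominator separates the error at t, the defect of the window
        mass from 1, and the far mass.\<close>
      have eq: "r * s t - g * (r * s R + J) = r * (s t - g) - r * (g * (s R - 1)) - g * J"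
        by (simp add: algebra_simps)
      have "\<bar>a - b - c\<bar> \<le> 4 * e1 + 2 * e3 + e2"
        if "\<bar>a\<bar> \<le> 2 * e1" "\<bar>b\<bar> \<le> 2 * (1 * (e1 + e3))" "0 \<le> c" "c \<le> 1 * e2" for a b c
        using that unfolding distrib_left mult_1 by linarith
      moreover have "\<bar>r * (s t - g)\<bar> \<le> 2 * e1"
        unfolding abs_mult using r s[of t] by (intro mult_mono) (auto simp: g_def)
      moreover have "\<bar>r * (g * (s R - 1))\<bar> \<le> 2 * (1 * (e1 + e3))"
        unfolding abs_mult using r g sR by (intro mult_mono) auto
      moreover have "0 \<le> g * J" using g J by simp
      moreover have "g * J \<le> 1 * e2" using g J by (intro mult_mono) auto
      ultimately show ?thesis unfolding eq by blast
    qed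
    moreover have "prob N (\<lambda>X. \<bar>theta p (mag N X) - m\<bar> \<le> del \<and> Ystat N X \<le> t) - g
        = (r * s t - g * (r * s R + J)) / (r * s R + J)"
      unfolding prob using den by (simp add: field_simps)
    ultimately have "\<bar>prob N (\<lambda>X. \<bar>theta p (mag N X) - m\<bar> \<le> del \<and> Ystat N X \<le> t) - g\<bar>
        \<le> (4 * e1 + 2 * e3 + e2) / (1 / 2)"
      using den by (simp only: abs_divide) (intro frac_le, auto)
    also have "\<dots> = C / sqrt (real N)"
      by (simp add: C_def e1_def e2_def e3_def add_divide_distrib)
    finally show "\<bar>prob N (\<lambda>X. \<bar>theta p (mag N X) - m\<bar> \<le> del \<and> Ystat N X \<le> t) - ncdf sig t\<bar> \<le> C / sqrt (real N)"
      unfolding g_def .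
  qed
  then show ?thesis using C by blast
qed

end

section \<open>From the linearized statistic to the estimator\<close>

context supercritical
begin

lemma cw_prob_nonneg: "1 \<le> N \<Longrightarrow> 0 \<le> cw_prob \<beta> p N X"
  using Zk_pos[of \<beta> p N] by (simp add: cw_prob_eq)

lemma prob_subadditive:
  assumes "1 \<le> N" "\<And>X. X \<in> config_space N \<Longrightarrow> P X \<Longrightarrow> Q X \<or> R X"
  shows "prob N P \<le> prob N Q + prob N R"
proof -
  have "prob N P \<le> (\<Sum>X\<in>{X\<in>config_space N. Q X} \<union> {X\<in>config_space N. R X}. cw_prob \<beta> p N X)"
    unfolding prob_def using assms finite_config_space
    by (intro sum_mono2 cw_prob_nonneg) auto
  also have "\<dots> \<le> prob N Q + prob N R"
    unfolding prob_def using assms(1) finite_config_space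
    by (subst sum.union_inter[symmetric]) (auto intro!: sum_nonneg cw_prob_nonneg)
  finally show ?thesis .
qed

lemma prob_compl:
  assumes "1 \<le> N"
  shows "prob N (\<lambda>X. \<not> P X) = 1 - prob N P"
proof -
  have "prob N (\<lambda>X. True) = 1"
    using prob_theta[OF assms, of "\<lambda>_. True"] Zk_pos[of \<beta> p N] by (simp add: Zk_def)
  moreover have "prob N (\<lambda>X. True) = prob N P + prob N (\<lambda>X. \<not> P X)"
    unfolding prob_def using finite_config_space
    by (subst sum.union_disjoint[symmetric]) (auto intro!: sum.cong)
  ultimately show ?thesis by simp
qed

text \<open>Off an event of probability O(N^(-1/2)) the rescaled estimate is within e of
  \<open>Ystat\<close>, so its distribution function is squeezed between those at t - e and t + e.
  The Lipschitz bound for the normal law turns this shift into an error e / sig.\<close>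

lemma MPLE_berry_esseen:
  assumes bhat: "\<And>N X. X \<in> config_space N \<Longrightarrow> \<exists>b. is_MPLE p N X b \<Longrightarrow> is_MPLE p N X (bhat N X)"
  shows "\<exists>C>0. \<forall>\<^sub>F N in sequentially. \<forall>t.
    \<bar>prob N (\<lambda>X. sqrt (real N) * (bhat N X - \<beta>) \<le> t) - ncdf sig t\<bar> \<le> C * (ln (real N) / sqrt (real N))"
proof -
  obtain C1 where C1: "0 < C1" and ev1: "\<forall>\<^sub>F N in sequentially. \<forall>t.
     \<bar>prob N (\<lambda>X. \<bar>theta p (mag N X) - m\<bar> \<le> del \<and> Ystat N X \<le> t) - ncdf sig t\<bar> \<le> C1 / sqrt (real N)"
    using near_cdf by blast
  obtain C2 where C2: "0 < C2" and ev2: "\<forall>\<^sub>F N in sequentially. \<forall>X\<in>config_space N. theta p (mag N X) \<in> {lo..hi} \<longrightarrow>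
    \<bar>bhat N X - \<beta> - kap * (theta p (mag N X) - m)\<bar> \<le> C2 * ((theta p (mag N X) - m)\<^sup>2 + 1 / real N)"
    using MPLE_linearization[OF bhat] by blast
  define C3 where "C3 = C2 * (sig\<^sup>2 / kap\<^sup>2 + 1)"
  have C3: "0 < C3" unfolding C3_def using C2 by (intro mult_pos_pos add_nonneg_pos) auto
  define C where "C = 3 * C1 + C3 / sig + 2"
  have C: "0 < C" using C1 C3 sig_pos by (simp add: C_def add_pos_pos)
  have "\<forall>\<^sub>F N in sequentially. 1 \<le> ln (real N)"
    by real_asymp
  with ev1 ev2 eventually_ge_at_top[of 1] have "\<forall>\<^sub>F N in sequentially. \<forall>t.
    \<bar>prob N (\<lambda>X. sqrt (real N) * (bhat N X - \<beta>) \<le> t) - ncdf sig t\<bar> \<le> C * (ln (real N) / sqrt (real N))"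
  proof (eventually_elim, intro allI)
    fix N t
    assume cdf: "\<forall>t. \<bar>prob N (\<lambda>X. \<bar>theta p (mag N X) - m\<bar> \<le> del \<and> Ystat N X \<le> t) - ncdf sig t\<bar> \<le> C1 / sqrt (real N)"
      and lin: "\<forall>X\<in>config_space N. theta p (mag N X) \<in> {lo..hi} \<longrightarrow>
        \<bar>bhat N X - \<beta> - kap * (theta p (mag N X) - m)\<bar> \<le> C2 * ((theta p (mag N X) - m)\<^sup>2 + 1 / real N)"
      and N1: "1 \<le> N" and lnN: "1 \<le> ln (real N)"
    define nr where "nr X \<longleftrightarrow> \<bar>theta p (mag N X) - m\<bar> \<le> del" for X
    define l where "l = ln (real N)"
    \<comment> \<open>Chosen so that the normal tail beyond L is exactly bounded by N^(-1/2); the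
      quadratic error of the linearization is then of order L^2 / sqrt N.\<close>
    define L where "L = sig * sqrt l"
    define e where "e = C3 * (l / sqrt (real N))"
    define c where "c = C1 / sqrt (real N)"
    define A where "A X \<longleftrightarrow> sqrt (real N) * (bhat N X - \<beta>) \<le> t" for X
    have sN: "0 < sqrt (real N)" using N1 by simp
    have l: "1 \<le> l" using lnN by (simp add: l_def)
    have L: "0 \<le> L" "L\<^sup>2 = sig\<^sup>2 * l"
      using sig_pos l by (auto simp: L_def power_mult_distrib)
    have e: "0 \<le> e" using C3 l by (simp add: e_def)
    have cdf: "\<bar>prob N (\<lambda>X. nr X \<and> Ystat N X \<le> t) - ncdf sig t\<bar> \<le> c" for t
      using cdf by (simp add: nr_def c_def)
    have tails: "ncdf sig (- L) \<le> 1 / sqrt (real N)" "1 - ncdf sig L \<le> 1 / sqrt (real N)"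
    proof -
      have "exp (- L\<^sup>2 / (2 * sig\<^sup>2)) = exp (- (ln (real N) / 2))"
        unfolding L(2) using sig_pos by (simp add: l_def)
      also have "\<dots> = 1 / sqrt (real N)"
        using N1 by (simp add: exp_minus inverse_eq_divide ln_sqrt[symmetric])
      finally show "ncdf sig (- L) \<le> 1 / sqrt (real N)" "1 - ncdf sig L \<le> 1 / sqrt (real N)"
        using normal_tail[OF sig_pos L(1)] by auto
    qed
    have close: "\<bar>sqrt (real N) * (bhat N X - \<beta>) - Ystat N X\<bar> \<le> e"
      if X: "X \<in> config_space N" "nr X" "\<bar>Ystat N X\<bar> \<le> L" for X
    proof -
      define d where "d = theta p (mag N X) - m"
      have Y: "Ystat N X = kap * sqrt (real N) * d" by (simp add: Ystat_def d_def)
      have "(Ystat N X)\<^sup>2 \<le> L\<^sup>2" using X(3) by (metis abs_ge_zero power2_abs power_mono)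
      then have "kap\<^sup>2 * (real N * d\<^sup>2) \<le> sig\<^sup>2 * l"
        unfolding Y L(2) using N1 by (simp add: power_mult_distrib mult.assoc)
      then have "real N * d\<^sup>2 \<le> sig\<^sup>2 / kap\<^sup>2 * l"
        using kap_pos by (simp add: field_simps)
      moreover have "sig\<^sup>2 / kap\<^sup>2 * l + 1 \<le> (sig\<^sup>2 / kap\<^sup>2 + 1) * l"
        using l by (simp add: algebra_simps)
      ultimately have Nd: "real N * d\<^sup>2 + 1 \<le> (sig\<^sup>2 / kap\<^sup>2 + 1) * l" by linarith
      have "theta p (mag N X) \<in> {lo..hi}" using X(2) del(4) by (simp add: nr_def)
      then have "\<bar>bhat N X - \<beta> - kap * d\<bar> \<le> C2 * (d\<^sup>2 + 1 / real N)"
        using lin X(1) by (simp add: d_def)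
      also have "d\<^sup>2 + 1 / real N = (real N * d\<^sup>2 + 1) / real N"
        using N1 by (simp add: field_simps)
      also have "C2 * ((real N * d\<^sup>2 + 1) / real N) \<le> C2 * (((sig\<^sup>2 / kap\<^sup>2 + 1) * l) / real N)"
        using C2 Nd by (intro mult_left_mono divide_right_mono) auto
      also have "\<dots> = C3 * (l / real N)" by (simp add: C3_def)
      finally have "sqrt (real N) * \<bar>bhat N X - \<beta> - kap * d\<bar> \<le> sqrt (real N) * (C3 * (l / real N))"
        using sN by (intro mult_left_mono) auto
      also have "sqrt (real N) * (C3 * (l / real N)) = C3 * l * (sqrt (real N) / real N)"
        by simp
      also have "sqrt (real N) / real N = 1 / sqrt (real N)"
        using N1 by (simp add: field_simps)
      also have "sqrt (real N) * \<bar>bhat N X - \<beta> - kap * d\<bar> = \<bar>sqrt (real N) * (bhat N X - \<beta>) - Ystat N X\<bar>"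
      proof -
        have "sqrt (real N) * (bhat N X - \<beta>) - Ystat N X = sqrt (real N) * (bhat N X - \<beta> - kap * d)"
          unfolding Y by (simp add: algebra_simps)
        then show ?thesis using sN by (simp add: abs_mult)
      qed
      finally show ?thesis by (simp add: e_def)
    qed
    \<comment> \<open>This includes the configurations outside the window, where nothing is known
      about \<open>bhat\<close>. No separate estimate is needed for them: \<open>near_cdf\<close> at
      L and -L already shows that the good event carries almost all the mass.\<close>
    define bad where "bad X \<longleftrightarrow> \<not> (nr X \<and> \<bar>Ystat N X\<bar> \<le> L)" for X
    have bad: "prob N bad \<le> 2 / sqrt (real N) + 2 * c"
    proof -
      have "prob N (\<lambda>X. nr X \<and> Ystat N X \<le> L) \<le> prob N (\<lambda>X. nr X \<and> \<bar>Ystat N X\<bar> \<le> L) + prob N (\<lambda>X. nr X \<and> Ystat N X \<le> - L)"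
        by (rule prob_subadditive[OF N1]) auto
      moreover have "prob N bad = 1 - prob N (\<lambda>X. nr X \<and> \<bar>Ystat N X\<bar> \<le> L)"
        using prob_compl[OF N1, of "\<lambda>X. nr X \<and> \<bar>Ystat N X\<bar> \<le> L"] by (simp add: bad_def[abs_def])
      ultimately show ?thesis
        using cdf[of L] cdf[of "- L"] tails by linarith
    qed
    have up: "prob N A \<le> prob N (\<lambda>X. nr X \<and> Ystat N X \<le> t + e) + prob N bad"
    proof (rule prob_subadditive[OF N1])
      fix X assume "X \<in> config_space N" "A X"
      then show "(nr X \<and> Ystat N X \<le> t + e) \<or> bad X"
        using close[of X] unfolding A_def bad_def by fastforce
    qed
    have down: "prob N (\<lambda>X. nr X \<and> Ystat N X \<le> t - e) \<le> prob N A + prob N bad"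
    proof (rule prob_subadditive[OF N1])
      fix X assume "X \<in> config_space N" "nr X \<and> Ystat N X \<le> t - e"
      then show "A X \<or> bad X"
        using close[of X] unfolding A_def bad_def by fastforce
    qed
    have lip: "ncdf sig (t + e) \<le> ncdf sig t + e / sig" "ncdf sig t - e / sig \<le> ncdf sig (t - e)"
      using ncdf_lipschitz[OF sig_pos, of "t + e" t] ncdf_lipschitz[OF sig_pos, of "t - e" t] e by auto
    have "\<bar>prob N A - ncdf sig t\<bar> \<le> 3 * c + e / sig + 2 / sqrt (real N)"
      using up down bad cdf[of "t + e"] cdf[of "t - e"] lip by linarith
    also have "\<dots> = (3 * C1 * 1 + C3 / sig * l + 2 * 1) / sqrt (real N)"
      by (simp add: c_def e_def add_divide_distrib)
    also have "\<dots> \<le> (3 * C1 * l + C3 / sig * l + 2 * l) / sqrt (real N)"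
      using l C1 C3 sig_pos sN by (intro divide_right_mono add_mono mult_left_mono) auto
    also have "\<dots> = C * (l / sqrt (real N))"
      by (simp add: C_def algebra_simps add_divide_distrib)
    finally show "\<bar>prob N (\<lambda>X. sqrt (real N) * (bhat N X - \<beta>) \<le> t) - ncdf sig t\<bar> \<le> C * (ln (real N) / sqrt (real N))"
      unfolding A_def l_def .
  qed
  then show ?thesis using C by blast
qed

end

section \<open>The threshold hypothesis and the final bound\<close>

lemma supercriticalI:
  assumes p: "3 \<le> p" and \<beta>: "\<beta> > beta_star p" and m: "0 < m" "m \<le> 1"
    and max: "\<forall>x\<in>{-1..1}. Hfun \<beta> p x \<le> Hfun \<beta> p m"
  shows "supercritical p \<beta> m"
proof -
  have bdd: "bdd_above (Hfun b p ` {0..1})" for b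
  proof -
    have "continuous_on {0..1} (Hfun b p)"
      by (rule continuous_on_subset[OF continuous_on_Hfun]) auto
    then have "compact (Hfun b p ` {0..1})"
      by (intro compact_continuous_image) auto
    then show ?thesis
      by (intro bounded_imp_bdd_above compact_imp_bounded)
  qed
  define S where "S = {b. b \<ge> 0 \<and> (SUP x\<in>{0..1}. Hfun b p x) > 0}"
  \<comment> \<open>An infimum below \<beta> yields an element below \<beta> only if the set is
    nonempty. The witness is 1, since at x = 1 the function has the value 1 - ln 2 > 0.\<close>
  have "Hfun 1 p 1 \<le> (SUP x\<in>{0..1}. Hfun 1 p x)"
    by (rule cSUP_upper[OF _ bdd]) auto
  moreover have "0 < Hfun 1 p 1"
    using ln_2_less_1 by (simp add: Hfun_def Ient_def)
  ultimately have "S \<noteq> {}" by (auto simp: S_def intro!: exI[of _ 1])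
  moreover have "Inf S < \<beta>" using \<beta> by (simp add: beta_star_def S_def)
  ultimately obtain b where b: "b \<in> S" "b < \<beta>" using cInf_lessD by blast
  then have b0: "0 \<le> b" "0 < (SUP x\<in>{0..1}. Hfun b p x)" by (auto simp: S_def)
  have "\<exists>x\<in>{0..1}. 0 < Hfun b p x"
  proof (rule ccontr)
    assume "\<not> (\<exists>x\<in>{0..1}. 0 < Hfun b p x)"
    then have "(SUP x\<in>{0..1}. Hfun b p x) \<le> 0"
      by (intro cSUP_least) (auto simp: not_less)
    then show False using b0 by simp
  qed
  then obtain x where x: "0 \<le> x" "x \<le> 1" "0 < Hfun b p x" by auto
  \<comment> \<open>For x \<ge> 0 the function increases with the parameter, so positivity at some b
    < \<beta> carries over to \<beta> and to its maximum.\<close>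
  have "b * x ^ p \<le> \<beta> * x ^ p" using b x by (intro mult_right_mono) auto
  then have "Hfun b p x \<le> Hfun \<beta> p x" by (simp add: Hfun_def)
  moreover have "Hfun \<beta> p x \<le> Hfun \<beta> p m" using max x by auto
  ultimately show ?thesis
    using p b b0 m max x by unfold_locales (auto intro: less_le_trans)
qed

text \<open>\<open>bhat\<close> is any selection of a maximizer where one exists and is
  unconstrained elsewhere. The maximizer \<open>m\<close> enters through its defining property; that
  it is the only positive one is proved in the locale.\<close>

theorem theorem3p3:
  fixes p :: nat and \<beta> m :: real and bhat :: "nat \<Rightarrow> (nat \<Rightarrow> real) \<Rightarrow> real"
  assumes "p \<ge> 3"
    and "\<beta> > beta_star p"
    and "0 < m" and "m \<le> 1"
    and "\<forall>x\<in>{-1..1}. Hfun \<beta> p x \<le> Hfun \<beta> p m"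
    and "\<forall>N. \<forall>X\<in>config_space N. (\<exists>b. is_MPLE p N X b) \<longrightarrow> is_MPLE p N X (bhat N X)"
  shows "(\<lambda>N. SUP x::real. \<bar>(\<Sum>X\<in>{X\<in>config_space N. sqrt (real N) * (bhat N X - \<beta>) \<le> x}.
              cw_prob \<beta> p N X)
           - measure (density lborel (normal_density 0
               (sqrt (- deriv (deriv (Hfun \<beta> p)) m / (real p ^ 2 * m ^ (2 * p - 2))))))
               {..x}\<bar>)
         \<in> O(\<lambda>N. ln (real N) / sqrt (real N))"
proof -
  interpret supercritical p \<beta> m
    using assms by (intro supercriticalI)
  have sig: "sqrt (- deriv (deriv (Hfun \<beta> p)) m / (real p ^ 2 * m ^ (2 * p - 2))) = sig"
    unfolding deriv_deriv_H by (simp add: sig_def)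
  define D where "D N x = \<bar>prob N (\<lambda>X. sqrt (real N) * (bhat N X - \<beta>) \<le> x) - ncdf sig x\<bar>" for N x
  have "\<And>N X. X \<in> config_space N \<Longrightarrow> \<exists>b. is_MPLE p N X b \<Longrightarrow> is_MPLE p N X (bhat N X)"
    using assms(6) by blast
  from MPLE_berry_esseen[OF this] obtain C where
    ev: "\<forall>\<^sub>F N in sequentially. \<forall>x. D N x \<le> C * (ln (real N) / sqrt (real N))"
    unfolding D_def by blast
  have "(\<lambda>N. SUP x. D N x) \<in> O(\<lambda>N. ln (real N) / sqrt (real N))"
  proof (rule bigoI[of _ C])
    show "\<forall>\<^sub>F N in sequentially. norm (SUP x. D N x) \<le> C * norm (ln (real N) / sqrt (real N))"
      using ev eventually_ge_at_top[of 1]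
    proof eventually_elim
      fix N :: nat assume D: "\<forall>x. D N x \<le> C * (ln (real N) / sqrt (real N))" and N: "1 \<le> N"
      have "(SUP x. D N x) \<le> C * (ln (real N) / sqrt (real N))"
        by (rule cSUP_least) (use D in auto)
      moreover have "D N 0 \<le> (SUP x. D N x)"
        by (rule cSUP_upper) (use D in \<open>auto intro!: bdd_aboveI2\<close>)
      moreover have "0 \<le> D N 0" by (simp add: D_def)
      moreover have "norm (ln (real N) / sqrt (real N)) = ln (real N) / sqrt (real N)"
        using N by simp
      ultimately show "norm (SUP x. D N x) \<le> C * norm (ln (real N) / sqrt (real N))"
        by (simp only: real_norm_def)
    qed
  qed
  then show ?thesis
    unfolding D_def prob_def sig .
qed

end
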